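(* Let $(X,\omega_X)$ be a compact connected Kähler manifold of dimension $n$, and let $(\widetilde{\mathcal E}_\lambda)_{\lambda\in Q'_0}$, $(\phi_a)_{a\in Q'_1}$ be a holomorphic family over $X\times S$ of stable $(Q,\mathcal K)$-bundles on $X$ parameterized by a reduced complex space $S$, equipped with hermitian metrics $k^\lambda$ on $\widetilde{\mathcal E}_\lambda$ of class $C^\infty$ on $X\times S$ whose restrictions to each fiber $X\times\{s\}$ solve the quiver vortex equation with constants $\tau'_\lambda$. Let $\Omega^\lambda$ be the curvature form of $(\widetilde{\mathcal E}_\lambda,k^\lambda)$ on $X\times S$, and let $\omega_{WP}$ be the generalized Weil-Petersson form on $S$. Then $$\omega_{WP}=\frac12\sum_{\lambda\in Q'_0}\int_X n_\lambda\,\mathrm{tr}(\Omega^\lambda\wedge\Omega^\lambda)\wedge\frac{\omega_X^{n-1}}{(n-1)!}+\sqrt{-1}\sum_{\lambda\in Q'_0}\tau'_\lambda\int_X\mathrm{tr}(\Omega^\lambda)\wedge\frac{\omega_X^{n}}{n!}+\sum_{a\in Q'_1}\sqrt{-1}\,\partial\overline\partial\left(\int_X\mathrm{tr}(\phi_a\phi_a^* )\frac{\omega_X^n}{n!}\right),$$ where $\int_X$ denotes integration along the fibers of $X\times S\to S$ and $\omega_X^k=\omega_X\wedge\dots\wedge\omega_X$ ($k$ factors).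
   Context: Quiver bundles. $Q=(Q_0,Q_1)$ is a locally finite quiver with head and tail maps $h,t:Q_1\to Q_0$ (written $ha,ta$), and $\mathcal K$ is a set of relations, i.e. finite complex linear combinations of paths with common tail and common head; $(Q,\mathcal K)$ is the quiver with relations that Álvarez-Cónsul and García-Prada associate to a proper parabolic subgroup $P$ of a connected semisimple complex affine algebraic group $G$ (vertices $\lambda$ are the integral dominant weights of $P$, labelling irreducible $P$-representations $M_\lambda$), and $n_\lambda\ge 1$ is the integer (multiplicity of $M_\lambda$) attached to the vertex $\lambda$. Only these data enter the statement. A $(Q,\mathcal K)$-bundle on a complex manifold is a collection of holomorphic vector bundles $\mathcal E_\lambda$ ($\lambda\in Q_0$), zero for all but finitely many $\lambda$, and holomorphic bundle maps $\phi_a:\mathcal E_{ta}\to\mathcal E_{ha}$ ($a\in Q_1$) satisfying all relations in $\mathcal K$ (a path acts by composition). $Q'_0$ is the set of $\lambda$ with $\mathcal E_\lambda\ne0$, and $Q'_1$ the set of arrows with head and tail in $Q'_0$. A holomorphic family over $S$ is a $(Q,\mathcal K)$-bundle on $X\times S$; its members are the restrictions to $X\times\{s\}$. Quiver vortex equation. For real constants $\tau'_\lambda$, hermitian metrics $k_\lambda$ on $\mathcal E_\lambda$ over $X$ solve it if for every $\lambda\in Q'_0$ $$\sqrt{-1}\,n_\lambda\Lambda F_{k_\lambda}+\sum_{a\in h^{-1}(\lambda)}\phi_a\phi_a^*-\sum_{a\in t^{-1}(\lambda)}\phi_a^*\phi_a=\tau'_\lambda\,\mathrm{id}_{\mathcal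 E_\lambda},$$ where $F$ is the Chern curvature form, $\Lambda$ is the adjoint of wedging with $\omega_X$, and ${}^*$ is the adjoint with respect to the metrics. Stability is the slope stability corresponding to this equation: with $\deg\mathcal E=\mathrm{Vol}(X)^{-1}\int_X \mathrm{tr}(\sqrt{-1}\Lambda F)\,\omega_X^n/n!$ one has $\sum_\lambda(n_\lambda\deg\mathcal E_\lambda-\tau'_\lambda\,\mathrm{rk}\,\mathcal E_\lambda)=0$, and $\sum_\lambda(n_\lambda\deg\mathcal E'_\lambda-\tau'_\lambda\,\mathrm{rk}\,\mathcal E'_\lambda)<0$ for all coherent $Q$-subsheaves $\mathcal E'$ with $0<\sum\mathrm{rk}\,\mathcal E'_\lambda<\sum\mathrm{rk}\,\mathcal E_\lambda$. Tensor notation. $z^\alpha$ are local coordinates on $X$, $s^i$ local coordinates on $S$ (on a smooth ambient space of minimal dimension if $S$ is singular; all forms then are understood via local extensions to the ambient space). $\omega_X=\sqrt{-1}g_{\alpha\overline\beta}dz^\alpha\wedge dz^{\overline\beta}$, $g\,dV=\omega_X^n/n!$. $\nabla$ is the Chern connection of $(\widetilde{\mathcal E}_\lambda,k^\lambda)$ on $X\times S$ and the induced connections on $\mathrm{Hom}$ bundles, $R^\lambda_{A\overline B}=[\nabla_A,\nabla_{\overline B}]$ for coordinate directions $A,B$ of $X\times S$, so that $\Omega^\lambda=\sum R^\lambda_{A\overline B}\,dw^A\wedge dw^{\overline B}$ over all coordinates $w=(z,s)$, and $\sqrt{-1}\Lambda F_{k_\lambda}=g^{\overline\beta\alpha}R^\lambda_{\alpha\overline\beta}$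 on fibers. A semicolon denotes covariant derivatives; $\phi_{a;i}=\nabla_{\partial/\partial s^i}\phi_a$ and $\phi^*_{a;\overline\jmath}=\nabla_{\overline\jmath}(\phi_a^* )=(\phi_{a;j})^*$. Generalized Weil-Petersson form: $\omega_{WP}=\sqrt{-1}\,G^{WP}_{i\overline\jmath}\,ds^i\wedge ds^{\overline\jmath}$ with $$G^{WP}_{i\overline\jmath}=\int_X\sum_{a\in Q'_1}\mathrm{tr}(\phi_{a;i}\phi^*_{a;\overline\jmath})\,g\,dV+\int_X\sum_{\lambda\in Q'_0}n_\lambda\,\mathrm{tr}(g^{\overline\beta\alpha}R^\lambda_{i\overline\beta}R^\lambda_{\alpha\overline\jmath})\,g\,dV.$$ *)

theory Defs
  imports "HOL-Analysis.Analysis" "Jordan_Normal_Form.Schur_Decomposition"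
begin

section \<open>Calculus on \<open>\<complex>\<^sup>N\<close>\<close>

text \<open>
  The dimension of the ambient space of a complex space varies from point to point, so
  \<open>\<complex>\<^sup>N\<close> is the set of sequences that vanish from index \<open>N\<close> on.
\<close>

type_synonym cvec = "nat \<Rightarrow> complex"

definition Cn :: "nat \<Rightarrow> cvec set" where
  "Cn N = {w. \<forall>i\<ge>N. w i = 0}"

text \<open>Real derivative in direction \<open>c\<close> (\<open>c = 1\<close> or \<open>c = \<i>\<close>) of the coordinate \<open>w\<^sup>A\<close>.\<close>

definition pline :: "nat \<Rightarrow> complex \<Rightarrow> (cvec \<Rightarrow> complex) \<Rightarrow> cvec \<Rightarrow> real \<Rightarrow> complex" where
  "pline A c f w = (\<lambda>t. f (w(A := w A + of_real t * c)))"

definition pdir :: "nat \<Rightarrow> complex \<Rightarrow> (cvec \<Rightarrow> complex) \<Rightarrow> cvec \<Rightarrow> complex" where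
  "pdir A c f w = vector_derivative (pline A c f w) (at 0)"

definition wdel :: "nat \<Rightarrow> (cvec \<Rightarrow> complex) \<Rightarrow> cvec \<Rightarrow> complex" where
  "wdel A f w = (pdir A 1 f w - \<i> * pdir A \<i> f w) / 2"

definition wdelbar :: "nat \<Rightarrow> (cvec \<Rightarrow> complex) \<Rightarrow> cvec \<Rightarrow> complex" where
  "wdelbar A f w = (pdir A 1 f w + \<i> * pdir A \<i> f w) / 2"

text \<open>In the following, \<open>D\<close> is relatively open in \<open>Cn N\<close>.\<close>

primrec Ck_on :: "nat \<Rightarrow> nat \<Rightarrow> cvec set \<Rightarrow> (cvec \<Rightarrow> complex) \<Rightarrow> bool" where
  "Ck_on 0 N D f \<longleftrightarrow> continuous_on D f"
| "Ck_on (Suc k) N D f \<longleftrightarrow> continuous_on D f \<and>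
     (\<forall>A<N. \<forall>c\<in>{1, \<i>}. (\<forall>w\<in>D. pline A c f w differentiable (at 0)) \<and> Ck_on k N D (pdir A c f))"

definition smooth_on :: "nat \<Rightarrow> cvec set \<Rightarrow> (cvec \<Rightarrow> complex) \<Rightarrow> bool" where
  "smooth_on N D f \<longleftrightarrow> (\<forall>k. Ck_on k N D f)"

definition holo_on :: "nat \<Rightarrow> cvec set \<Rightarrow> (cvec \<Rightarrow> complex) \<Rightarrow> bool" where
  "holo_on N D f \<longleftrightarrow> continuous_on D f \<and>
     (\<forall>A<N. \<forall>w\<in>D. (\<lambda>t. f (w(A := t))) field_differentiable (at (w A)))"

definition analytic_subset :: "nat \<Rightarrow> cvec set \<Rightarrow> cvec set \<Rightarrow> bool" where
  "analytic_subset N U A \<longleftrightarrow> A \<subseteq> U \<and>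
     (\<forall>p\<in>U. \<exists>V fs. openin (top_of_set (Cn N)) V \<and> p \<in> V \<and> V \<subseteq> U \<and> finite fs \<and>
        (\<forall>f\<in>fs. holo_on N V f) \<and> A \<inter> V = {w \<in> V. \<forall>f\<in>fs. f w = 0})"


section \<open>Differential forms\<close>

text \<open>
  A form at a point of \<open>\<complex>\<^sup>N\<close> is the family of its coefficients in the monomial basis of the
  exterior algebra. The basis covectors are numbered: \<open>dw\<^sup>A\<close> has number \<open>2 * A\<close> and its conjugate
  has number \<open>2 * A + 1\<close>; the finite set \<open>K\<close> stands for the product of its members in
  increasing order.
\<close>

type_synonym form = "nat set \<Rightarrow> complex"

definition wsign :: "nat set \<Rightarrow> nat set \<Rightarrow> complex" where
  "wsign I J = (-1) ^ card {(i, j). i \<in> I \<and> j \<in> J \<and> j < i}"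

definition wedge :: "form \<Rightarrow> form \<Rightarrow> form" where
  "wedge \<alpha> \<beta> = (\<lambda>K. \<Sum>I\<in>Pow K. wsign I (K - I) * \<alpha> I * \<beta> (K - I))"

definition fscale :: "complex \<Rightarrow> form \<Rightarrow> form" where
  "fscale c \<alpha> = (\<lambda>K. c * \<alpha> K)"

definition fconst :: "complex \<Rightarrow> form" where
  "fconst c = (\<lambda>K. if K = {} then c else 0)"

definition dw :: "nat \<Rightarrow> form" where
  "dw A = (\<lambda>K. if K = {2 * A} then 1 else 0)"

definition dwbar :: "nat \<Rightarrow> form" where
  "dwbar A = (\<lambda>K. if K = {2 * A + 1} then 1 else 0)"

primrec fpow :: "form \<Rightarrow> nat \<Rightarrow> form" where
  "fpow \<alpha> 0 = fconst 1"
| "fpow \<alpha> (Suc m) = wedge \<alpha> (fpow \<alpha> m)"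

definition form11 :: "nat \<Rightarrow> (nat \<Rightarrow> nat \<Rightarrow> complex) \<Rightarrow> form" where
  "form11 N c = (\<lambda>K. \<Sum>A<N. \<Sum>B<N. c A B * wedge (dw A) (dwbar B) K)"

definition fdel :: "nat \<Rightarrow> (cvec \<Rightarrow> form) \<Rightarrow> cvec \<Rightarrow> form" where
  "fdel N \<alpha> w = (\<lambda>K. \<Sum>A<N. wedge (dw A) (\<lambda>I. wdel A (\<lambda>w. \<alpha> w I) w) K)"

definition fdelbar :: "nat \<Rightarrow> (cvec \<Rightarrow> form) \<Rightarrow> cvec \<Rightarrow> form" where
  "fdelbar N \<alpha> w = (\<lambda>K. \<Sum>A<N. wedge (dwbar A) (\<lambda>I. wdelbar A (\<lambda>w. \<alpha> w I) w) K)"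

definition ext_deriv :: "nat \<Rightarrow> (cvec \<Rightarrow> form) \<Rightarrow> cvec \<Rightarrow> form" where
  "ext_deriv N \<alpha> w = (\<lambda>K. fdel N \<alpha> w K + fdelbar N \<alpha> w K)"


section \<open>Reduced complex spaces and complex manifolds\<close>

text \<open>
  A chart of a reduced complex space is a homeomorphism \<open>coords\<close> of the open set \<open>patch\<close>
  onto an analytic subset of an open set of \<open>\<complex>\<^sup>N\<close>, with \<open>N = edim\<close>. As the space is reduced, its
  holomorphic functions are genuine functions, namely those that locally extend to holomorphic
  functions of the ambient space; \<open>C\<^sup>\<infinity>\<close> functions are those with local \<open>C\<^sup>\<infinity>\<close> extensions.
\<close>

record 'y chart =
  patch :: "'y set"
  edim :: nat
  coords :: "'y \<Rightarrow> cvec"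

definition cinv :: "'y chart \<Rightarrow> cvec \<Rightarrow> 'y" where
  "cinv c = inv_into (patch c) (coords c)"

definition local_model :: "'y::topological_space chart \<Rightarrow> bool" where
  "local_model c \<longleftrightarrow> open (patch c) \<and>
     (\<exists>\<kappa>. homeomorphism (patch c) (coords c ` patch c) (coords c) \<kappa>) \<and>
     (\<exists>U. openin (top_of_set (Cn (edim c))) U \<and> analytic_subset (edim c) U (coords c ` patch c))"

definition locally_extends ::
  "(nat \<Rightarrow> cvec set \<Rightarrow> (cvec \<Rightarrow> complex) \<Rightarrow> bool) \<Rightarrow> 'y chart \<Rightarrow> 'y set \<Rightarrow> ('y \<Rightarrow> complex) \<Rightarrow> bool"
  where
  "locally_extends P c D f \<longleftrightarrow>
     (\<forall>y \<in> D \<inter> patch c. \<exists>V F. openin (top_of_set (Cn (edim c))) V \<and> coords c y \<in> V \<and>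
        P (edim c) V F \<and> (\<forall>y' \<in> D \<inter> patch c. coords c y' \<in> V \<longrightarrow> f y' = F (coords c y')))"

definition holo_related :: "'y chart \<Rightarrow> 'y chart \<Rightarrow> bool" where
  "holo_related c c' \<longleftrightarrow>
     (\<forall>A < edim c'. locally_extends holo_on c (patch c \<inter> patch c') (\<lambda>y. coords c' y A))"

definition compatible_chart :: "'y::topological_space chart set \<Rightarrow> 'y chart \<Rightarrow> bool" where
  "compatible_chart AY c \<longleftrightarrow>
     local_model c \<and> (\<forall>c'\<in>AY. holo_related c c' \<and> holo_related c' c)"

definition complex_space :: "'y::t2_space chart set \<Rightarrow> bool" where
  "complex_space AY \<longleftrightarrow> (\<Union>c\<in>AY. patch c) = UNIV \<and> (\<forall>c\<in>AY. compatible_chart AY c)"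

definition complex_manifold :: "nat \<Rightarrow> 'y::t2_space chart set \<Rightarrow> bool" where
  "complex_manifold n AY \<longleftrightarrow> complex_space AY \<and>
     (\<forall>c\<in>AY. edim c = n \<and> openin (top_of_set (Cn n)) (coords c ` patch c))"

text \<open>Local coordinates around \<open>s0\<close> on a smooth ambient space of minimal dimension.\<close>

definition minimal_chart_at :: "'y::topological_space chart set \<Rightarrow> 'y \<Rightarrow> 'y chart \<Rightarrow> bool" where
  "minimal_chart_at AY s0 c \<longleftrightarrow> compatible_chart AY c \<and> s0 \<in> patch c \<and>
     (\<forall>c'. compatible_chart AY c' \<and> s0 \<in> patch c' \<longrightarrow> edim c \<le> edim c')"

definition holo_fun :: "'y chart set \<Rightarrow> 'y set \<Rightarrow> ('y \<Rightarrow> complex) \<Rightarrow> bool" where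
  "holo_fun AY D f \<longleftrightarrow> (\<forall>c\<in>AY. locally_extends holo_on c D f)"

definition smooth_fun :: "'y chart set \<Rightarrow> 'y set \<Rightarrow> ('y \<Rightarrow> complex) \<Rightarrow> bool" where
  "smooth_fun AY D f \<longleftrightarrow> (\<forall>c\<in>AY. locally_extends smooth_on c D f)"

definition join :: "nat \<Rightarrow> cvec \<Rightarrow> cvec \<Rightarrow> cvec" where
  "join n z s = (\<lambda>i. if i < n then z i else s (i - n))"

definition prod_atlas :: "'x chart set \<Rightarrow> 's chart set \<Rightarrow> ('x \<times> 's) chart set" where
  "prod_atlas AX AS =
     {\<lparr>patch = patch c \<times> patch c', edim = edim c + edim c',
       coords = (\<lambda>(x, s). join (edim c) (coords c x) (coords c' s))\<rparr> | c c'. c \<in> AX \<and> c' \<in> AS}"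


section \<open>Integration over a compact complex manifold\<close>

definition lebesgue_Cn :: "nat \<Rightarrow> cvec measure" where
  "lebesgue_Cn n =
     distr (PiM {..<n} (\<lambda>_. lborel :: complex measure)) borel (\<lambda>z i. if i < n then z i else 0)"

record 'x pieces =
  psize :: nat
  pchart :: "nat \<Rightarrow> 'x chart"
  pnbhd :: "nat \<Rightarrow> 'x set"
  pweight :: "nat \<Rightarrow> 'x \<Rightarrow> real"

definition partition_of_unity :: "'x::t2_space chart set \<Rightarrow> 'x pieces \<Rightarrow> bool" where
  "partition_of_unity AX P \<longleftrightarrow>
     (\<forall>j < psize P. pchart P j \<in> AX \<and> open (pnbhd P j) \<and> pnbhd P j \<subseteq> patch (pchart P j) \<and>
        smooth_fun AX UNIV (\<lambda>x. of_real (pweight P j x)) \<and> (\<forall>x. 0 \<le> pweight P j x) \<and>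
        closure {x. pweight P j x \<noteq> 0} \<subseteq> pnbhd P j) \<and>
     (\<forall>x. (\<Sum>j < psize P. pweight P j x) = 1)"

text \<open>
  Integration along the fibers of \<open>X \<times> S \<rightarrow> S\<close>. The first \<open>n\<close> coordinates are those of \<open>X\<close>, the
  others are coordinates of the ambient space of \<open>S\<close>; \<open>\<eta> j\<close> is the form in the coordinates of the
  \<open>j\<close>-th piece. The coefficient of \<open>K\<close> is the integral of the coefficient of
  \<open>dz\<^sup>1 \<and> dz\<^sup>1\<^sup>b\<^sup>a\<^sup>r \<and> \<dots> \<and> dz\<^sup>n \<and> dz\<^sup>n\<^sup>b\<^sup>a\<^sup>r\<close> times the monomial \<open>K\<close> in the base coordinates, and
  \<open>dz \<and> dz\<^sup>b\<^sup>a\<^sup>r = -2 * \<i> * dx \<and> dy\<close>.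
\<close>

definition fiber_int :: "nat \<Rightarrow> 'x pieces \<Rightarrow> (nat \<Rightarrow> cvec \<Rightarrow> form) \<Rightarrow> cvec \<Rightarrow> form" where
  "fiber_int n P \<eta> s = (\<lambda>K. \<Sum>j < psize P. integral\<^sup>L (lebesgue_Cn n)
     (\<lambda>z. indicator (coords (pchart P j) ` pnbhd P j) z *
          of_real (pweight P j (cinv (pchart P j) z)) *
          ((-2 * \<i>) ^ n * \<eta> j (join n z s) ({..<2 * n} \<union> (+) (2 * n) ` K))))"

text \<open>Integral over \<open>X\<close> of the top degree form given by \<open>\<eta> c\<close> in the chart \<open>c\<close>.\<close>

definition mfd_int :: "nat \<Rightarrow> 'x::t2_space chart set \<Rightarrow> ('x chart \<Rightarrow> cvec \<Rightarrow> form) \<Rightarrow> complex" where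
  "mfd_int n AX \<eta> = (THE I. \<forall>P. partition_of_unity AX P \<longrightarrow>
     I = fiber_int n P (\<lambda>j. \<eta> (pchart P j)) (\<lambda>_. 0) {})"


section \<open>Hermitian matrices, Kaehler manifolds\<close>

definition herm_pos :: "nat \<Rightarrow> complex mat \<Rightarrow> bool" where
  "herm_pos r H \<longleftrightarrow> H \<in> carrier_mat r r \<and> mat_adjoint H = H \<and>
     (\<forall>v :: nat \<Rightarrow> complex. (\<exists>p<r. v p \<noteq> 0) \<longrightarrow>
        0 < Re (\<Sum>p<r. \<Sum>q<r. cnj (v p) * H $$ (p, q) * v q))"

definition minv :: "complex mat \<Rightarrow> complex mat" where
  "minv A = (THE B. B \<in> carrier_mat (dim_row A) (dim_row A) \<and> inverts_mat A B \<and> inverts_mat B A)"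

definition mtrace :: "complex mat \<Rightarrow> complex" where
  "mtrace A = (\<Sum>p<dim_row A. A $$ (p, p))"

text \<open>The form \<open>\<omega> = \<i> * g\<^sub>\<alpha>\<^sub>\<beta> dz\<^sup>\<alpha> \<and> dz\<^sup>\<beta>\<^sup>b\<^sup>a\<^sup>r\<close>; \<open>g c z\<close> is the matrix of coefficients in the chart \<open>c\<close>.\<close>

definition kform :: "nat \<Rightarrow> ('x chart \<Rightarrow> cvec \<Rightarrow> complex mat) \<Rightarrow> 'x chart \<Rightarrow> cvec \<Rightarrow> form" where
  "kform n g c z = form11 n (\<lambda>\<alpha> \<beta>. \<i> * g c z $$ (\<alpha>, \<beta>))"

definition kaehler_manifold ::
  "nat \<Rightarrow> 'x::t2_space chart set \<Rightarrow> ('x chart \<Rightarrow> cvec \<Rightarrow> complex mat) \<Rightarrow> bool" where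
  "kaehler_manifold n AX g \<longleftrightarrow> complex_manifold n AX \<and>
     (\<forall>c\<in>AX.
        (\<forall>z \<in> coords c ` patch c. herm_pos n (g c z)) \<and>
        (\<forall>\<alpha><n. \<forall>\<beta><n. smooth_on n (coords c ` patch c) (\<lambda>z. g c z $$ (\<alpha>, \<beta>))) \<and>
        (\<forall>z \<in> coords c ` patch c. \<forall>K\<subseteq>{..<2 * n}. ext_deriv n (kform n g c) z K = 0)) \<and>
     (\<forall>c\<in>AX. \<forall>c'\<in>AX. \<forall>x \<in> patch c \<inter> patch c'. \<forall>\<alpha><n. \<forall>\<beta><n.
        g c (coords c x) $$ (\<alpha>, \<beta>) =
          (\<Sum>\<gamma><n. \<Sum>\<delta><n. g c' (coords c' x) $$ (\<gamma>, \<delta>) *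
             wdel \<alpha> (\<lambda>z. coords c' (cinv c z) \<gamma>) (coords c x) *
             cnj (wdel \<beta> (\<lambda>z. coords c' (cinv c z) \<delta>) (coords c x))))"

definition kvol :: "nat \<Rightarrow> ('x chart \<Rightarrow> cvec \<Rightarrow> complex mat) \<Rightarrow> 'x chart \<Rightarrow> cvec \<Rightarrow> form" where
  "kvol n g c z = fscale (1 / fact n) (fpow (kform n g c z) n)"

text \<open>\<open>ginv g c z \<beta> \<alpha>\<close> is the coefficient of the inverse metric tensor with first index
  \<open>\<beta>\<close> (barred) and second index \<open>\<alpha>\<close>.\<close>

definition ginv :: "('x chart \<Rightarrow> cvec \<Rightarrow> complex mat) \<Rightarrow> 'x chart \<Rightarrow> cvec \<Rightarrow> nat \<Rightarrow> nat \<Rightarrow> complex" where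
  "ginv g c z \<beta> \<alpha> = minv (g c z) $$ (\<beta>, \<alpha>)"


section \<open>Holomorphic vector bundles and hermitian metrics\<close>

text \<open>
  A bundle is given by holomorphic frames over the sets \<open>tdom i\<close>; a section with component
  columns \<open>\<sigma>\<^sub>i\<close> satisfies \<open>\<sigma>\<^sub>i = trans i j * \<sigma>\<^sub>j\<close>.
\<close>

record ('y, 'i) vbundle =
  idx :: "'i set"
  tdom :: "'i \<Rightarrow> 'y set"
  rk :: nat
  trans :: "'i \<Rightarrow> 'i \<Rightarrow> 'y \<Rightarrow> complex mat"

definition holo_bundle :: "'y::topological_space chart set \<Rightarrow> ('y, 'i) vbundle \<Rightarrow> bool" where
  "holo_bundle AY E \<longleftrightarrow>
     (\<forall>i\<in>idx E. open (tdom E i)) \<and> (\<Union>i\<in>idx E. tdom E i) = UNIV \<and>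
     (\<forall>i\<in>idx E. \<forall>j\<in>idx E.
        (\<forall>y \<in> tdom E i \<inter> tdom E j. trans E i j y \<in> carrier_mat (rk E) (rk E)) \<and>
        (\<forall>p<rk E. \<forall>q<rk E. holo_fun AY (tdom E i \<inter> tdom E j) (\<lambda>y. trans E i j y $$ (p, q)))) \<and>
     (\<forall>i\<in>idx E. \<forall>y \<in> tdom E i. trans E i i y = 1\<^sub>m (rk E)) \<and>
     (\<forall>i\<in>idx E. \<forall>j\<in>idx E. \<forall>l\<in>idx E. \<forall>y \<in> tdom E i \<inter> tdom E j \<inter> tdom E l.
        trans E i j y * trans E j l y = trans E i l y)"

text \<open>In the frame \<open>i\<close> the inner product of \<open>\<sigma>\<close> and \<open>\<tau>\<close> is \<open>\<tau>\<^sub>i\<^sup>* * h i * \<sigma>\<^sub>i\<close>.\<close>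

definition herm_metric ::
  "'y::topological_space chart set \<Rightarrow> ('y, 'i) vbundle \<Rightarrow> ('i \<Rightarrow> 'y \<Rightarrow> complex mat) \<Rightarrow> bool" where
  "herm_metric AY E h \<longleftrightarrow>
     (\<forall>i\<in>idx E. (\<forall>y \<in> tdom E i. herm_pos (rk E) (h i y)) \<and>
        (\<forall>p<rk E. \<forall>q<rk E. smooth_fun AY (tdom E i) (\<lambda>y. h i y $$ (p, q)))) \<and>
     (\<forall>i\<in>idx E. \<forall>j\<in>idx E. \<forall>y \<in> tdom E i \<inter> tdom E j.
        h j y = mat_adjoint (trans E i j y) * h i y * trans E i j y)"

text \<open>
  Local formulas in holomorphic frames, for metrics \<open>H\<close>, \<open>Ht\<close>, \<open>Hh\<close> and a bundle map \<open>\<Phi>\<close> from the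
  bundle with metric \<open>Ht\<close> to the one with metric \<open>Hh\<close>. The Chern connection is
  \<open>\<nabla>\<^sub>A = \<partial>\<^sub>A + H\<inverse> \<partial>\<^sub>A H\<close>, \<open>\<nabla>\<^sub>B\<^sub>b\<^sub>a\<^sub>r = \<partial>\<^sub>B\<^sub>b\<^sub>a\<^sub>r\<close>, so that the commutator \<open>[\<nabla>\<^sub>A, \<nabla>\<^sub>B\<^sub>b\<^sub>a\<^sub>r]\<close> is
  \<open>- \<partial>\<^sub>B\<^sub>b\<^sub>a\<^sub>r (H\<inverse> \<partial>\<^sub>A H)\<close>.
\<close>

definition dmat :: "((cvec \<Rightarrow> complex) \<Rightarrow> cvec \<Rightarrow> complex) \<Rightarrow> (cvec \<Rightarrow> complex mat) \<Rightarrow> cvec \<Rightarrow> complex mat"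
  where
  "dmat \<delta> F w = mat (dim_row (F w)) (dim_col (F w)) (\<lambda>(p, q). \<delta> (\<lambda>w. F w $$ (p, q)) w)"

definition chern_conn :: "nat \<Rightarrow> (cvec \<Rightarrow> complex mat) \<Rightarrow> cvec \<Rightarrow> complex mat" where
  "chern_conn A H w = minv (H w) * dmat (wdel A) H w"

definition curv :: "nat \<Rightarrow> nat \<Rightarrow> (cvec \<Rightarrow> complex mat) \<Rightarrow> cvec \<Rightarrow> complex mat" where
  "curv A B H w = - dmat (wdelbar B) (chern_conn A H) w"

definition hadj ::
  "(cvec \<Rightarrow> complex mat) \<Rightarrow> (cvec \<Rightarrow> complex mat) \<Rightarrow> (cvec \<Rightarrow> complex mat) \<Rightarrow> cvec \<Rightarrow> complex mat"
  where
  "hadj Ht Hh \<Phi> w = minv (Ht w) * mat_adjoint (\<Phi> w) * Hh w"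

definition cov_del ::
  "nat \<Rightarrow> (cvec \<Rightarrow> complex mat) \<Rightarrow> (cvec \<Rightarrow> complex mat) \<Rightarrow> (cvec \<Rightarrow> complex mat) \<Rightarrow> cvec \<Rightarrow> complex mat"
  where
  "cov_del A Ht Hh \<Phi> w = dmat (wdel A) \<Phi> w + chern_conn A Hh w * \<Phi> w - \<Phi> w * chern_conn A Ht w"

text \<open>The covariant derivative of \<open>\<Phi>\<^sup>*\<close> in direction \<open>B\<^sub>b\<^sub>a\<^sub>r\<close>.\<close>

definition cov_delbar_adj ::
  "nat \<Rightarrow> (cvec \<Rightarrow> complex mat) \<Rightarrow> (cvec \<Rightarrow> complex mat) \<Rightarrow> (cvec \<Rightarrow> complex mat) \<Rightarrow> cvec \<Rightarrow> complex mat"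
  where
  "cov_delbar_adj B Ht Hh \<Phi> w = dmat (wdelbar B) (hadj Ht Hh \<Phi>) w"

definition in_chart :: "'y chart \<Rightarrow> ('y \<Rightarrow> 'b) \<Rightarrow> cvec \<Rightarrow> 'b" where
  "in_chart c f z = f (cinv c z)"

definition mean_curv_entry ::
  "nat \<Rightarrow> ('x chart \<Rightarrow> cvec \<Rightarrow> complex mat) \<Rightarrow> 'x chart \<Rightarrow> (cvec \<Rightarrow> complex mat) \<Rightarrow> cvec \<Rightarrow>
   nat \<Rightarrow> nat \<Rightarrow> complex" where
  "mean_curv_entry n g c H z p q = (\<Sum>\<alpha><n. \<Sum>\<beta><n. ginv g c z \<beta> \<alpha> * curv \<alpha> \<beta> H z $$ (p, q))"

text \<open>The choice of the frame around the point \<open>cinv c z\<close> does not affect the trace.\<close>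

definition has_degree ::
  "nat \<Rightarrow> 'x::t2_space chart set \<Rightarrow> ('x chart \<Rightarrow> cvec \<Rightarrow> complex mat) \<Rightarrow> ('x, 'i) vbundle \<Rightarrow> real \<Rightarrow> bool"
  where
  "has_degree n AX g E d \<longleftrightarrow>
     (\<exists>h. herm_metric AX E h \<and>
        of_real d * mfd_int n AX (kvol n g) =
          mfd_int n AX (\<lambda>c z.
            let i = (SOME i. i \<in> idx E \<and> cinv c z \<in> tdom E i)
            in fscale (\<Sum>p<rk E. mean_curv_entry n g c (in_chart c (h i)) z p p) (kvol n g c z)))"


section \<open>Quivers with relations and their bundles\<close>

record ('q, 'a) quiver =
  verts :: "'q set"
  arrows :: "'a set"
  head :: "'a \<Rightarrow> 'q"
  tail :: "'a \<Rightarrow> 'q"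

definition locally_finite_quiver :: "('q, 'a) quiver \<Rightarrow> bool" where
  "locally_finite_quiver Q \<longleftrightarrow>
     (\<forall>a\<in>arrows Q. head Q a \<in> verts Q \<and> tail Q a \<in> verts Q) \<and>
     (\<forall>v\<in>verts Q. finite {a \<in> arrows Q. head Q a = v \<or> tail Q a = v})"

text \<open>The arrow at the front of the list is applied first.\<close>

fun is_path :: "('q, 'a) quiver \<Rightarrow> 'q \<Rightarrow> 'a list \<Rightarrow> 'q \<Rightarrow> bool" where
  "is_path Q v [] v' \<longleftrightarrow> v = v'"
| "is_path Q v (a # p) v' \<longleftrightarrow> a \<in> arrows Q \<and> tail Q a = v \<and> is_path Q (head Q a) p v'"

text \<open>A relation \<open>(v, v', c)\<close> is the linear combination with coefficients \<open>c\<close> of paths from \<open>v\<close> to \<open>v'\<close>.\<close>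

type_synonym ('q, 'a) relation = "'q \<times> 'q \<times> ('a list \<Rightarrow> complex)"

definition quiver_with_relations :: "('q, 'a) quiver \<Rightarrow> ('q, 'a) relation set \<Rightarrow> bool" where
  "quiver_with_relations Q R \<longleftrightarrow> locally_finite_quiver Q \<and>
     (\<forall>(v, v', c)\<in>R. v \<in> verts Q \<and> v' \<in> verts Q \<and> finite {p. c p \<noteq> 0} \<and>
        (\<forall>p. c p \<noteq> 0 \<longrightarrow> is_path Q v p v'))"

definition verts' :: "('q, 'a) quiver \<Rightarrow> ('q \<Rightarrow> ('y, 'i) vbundle) \<Rightarrow> 'q set" where
  "verts' Q E = {v \<in> verts Q. 0 < rk (E v)}"

definition arrows' :: "('q, 'a) quiver \<Rightarrow> ('q \<Rightarrow> ('y, 'i) vbundle) \<Rightarrow> 'a set" where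
  "arrows' Q E = {a \<in> arrows Q. head Q a \<in> verts' Q E \<and> tail Q a \<in> verts' Q E}"

definition frames_at ::
  "('q, 'a) quiver \<Rightarrow> ('q \<Rightarrow> ('y, 'i) vbundle) \<Rightarrow> ('q \<Rightarrow> 'i) \<Rightarrow> 'y \<Rightarrow> bool" where
  "frames_at Q E fr y \<longleftrightarrow> (\<forall>v\<in>verts Q. fr v \<in> idx (E v) \<and> y \<in> tdom (E v) (fr v))"

fun path_map ::
  "('q, 'a) quiver \<Rightarrow> ('q \<Rightarrow> ('y, 'i) vbundle) \<Rightarrow> ('a \<Rightarrow> 'i \<Rightarrow> 'i \<Rightarrow> 'y \<Rightarrow> complex mat) \<Rightarrow>
   ('q \<Rightarrow> 'i) \<Rightarrow> 'y \<Rightarrow> 'q \<Rightarrow> 'a list \<Rightarrow> complex mat" where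
  "path_map Q E \<phi> fr y v [] = 1\<^sub>m (rk (E v))"
| "path_map Q E \<phi> fr y v (a # p) =
     path_map Q E \<phi> fr y (head Q a) p * \<phi> a (fr (tail Q a)) (fr (head Q a)) y"

text \<open>\<open>\<phi> a i j\<close> is the matrix of \<open>\<phi>\<^sub>a\<close> in the frames \<open>i\<close> of the tail and \<open>j\<close> of the head of \<open>a\<close>.\<close>

definition quiver_bundle ::
  "'y::topological_space chart set \<Rightarrow> ('q, 'a) quiver \<Rightarrow> ('q, 'a) relation set \<Rightarrow>
   ('q \<Rightarrow> ('y, 'i) vbundle) \<Rightarrow> ('a \<Rightarrow> 'i \<Rightarrow> 'i \<Rightarrow> 'y \<Rightarrow> complex mat) \<Rightarrow> bool" where
  "quiver_bundle AY Q R E \<phi> \<longleftrightarrow>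
     (\<forall>v\<in>verts Q. holo_bundle AY (E v)) \<and> finite (verts' Q E) \<and>
     (\<forall>a\<in>arrows Q. let Et = E (tail Q a); Eh = E (head Q a) in
        (\<forall>i\<in>idx Et. \<forall>j\<in>idx Eh.
           (\<forall>y \<in> tdom Et i \<inter> tdom Eh j. \<phi> a i j y \<in> carrier_mat (rk Eh) (rk Et)) \<and>
           (\<forall>p<rk Eh. \<forall>q<rk Et. holo_fun AY (tdom Et i \<inter> tdom Eh j) (\<lambda>y. \<phi> a i j y $$ (p, q)))) \<and>
        (\<forall>i\<in>idx Et. \<forall>i'\<in>idx Et. \<forall>j\<in>idx Eh. \<forall>j'\<in>idx Eh.
           \<forall>y \<in> tdom Et i \<inter> tdom Et i' \<inter> tdom Eh j \<inter> tdom Eh j'.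
             \<phi> a i' j' y = trans Eh j' j y * \<phi> a i j y * trans Et i i' y)) \<and>
     (\<forall>(v, v', c)\<in>R. \<forall>y fr. frames_at Q E fr y \<longrightarrow>
        (\<forall>p<rk (E v'). \<forall>q<rk (E v).
           (\<Sum>\<pi> | c \<pi> \<noteq> 0. c \<pi> * path_map Q E \<phi> fr y v \<pi> $$ (p, q)) = 0))"

definition restrict_bundle :: "'s \<Rightarrow> ('x \<times> 's, 'i) vbundle \<Rightarrow> ('x, 'i) vbundle" where
  "restrict_bundle s E = \<lparr>idx = idx E, tdom = (\<lambda>i. {x. (x, s) \<in> tdom E i}), rk = rk E,
     trans = (\<lambda>i j x. trans E i j (x, s))\<rparr>"

definition restrict_mor ::
  "'s \<Rightarrow> ('a \<Rightarrow> 'i \<Rightarrow> 'i \<Rightarrow> 'x \<times> 's \<Rightarrow> complex mat) \<Rightarrow> 'a \<Rightarrow> 'i \<Rightarrow> 'i \<Rightarrow> 'x \<Rightarrow> complex mat" where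
  "restrict_mor s \<phi> = (\<lambda>a i j x. \<phi> a i j (x, s))"

definition restrict_metric ::
  "'s \<Rightarrow> ('q \<Rightarrow> 'i \<Rightarrow> 'x \<times> 's \<Rightarrow> complex mat) \<Rightarrow> 'q \<Rightarrow> 'i \<Rightarrow> 'x \<Rightarrow> complex mat" where
  "restrict_metric s k = (\<lambda>v i x. k v i (x, s))"

text \<open>
  The quiver vortex equation on \<open>X\<close>, entry by entry in local coordinates and frames. Arrows that
  leave \<open>verts'\<close> contribute zero because the bundle at their other end has rank zero.
\<close>

definition quiver_vortex ::
  "nat \<Rightarrow> 'x chart set \<Rightarrow> ('x chart \<Rightarrow> cvec \<Rightarrow> complex mat) \<Rightarrow> ('q, 'a) quiver \<Rightarrow>
   ('q \<Rightarrow> nat) \<Rightarrow> ('q \<Rightarrow> real) \<Rightarrow> ('q \<Rightarrow> ('x, 'i) vbundle) \<Rightarrow>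
   ('a \<Rightarrow> 'i \<Rightarrow> 'i \<Rightarrow> 'x \<Rightarrow> complex mat) \<Rightarrow> ('q \<Rightarrow> 'i \<Rightarrow> 'x \<Rightarrow> complex mat) \<Rightarrow> bool" where
  "quiver_vortex n AX g Q m \<tau> E \<phi> k \<longleftrightarrow>
     (\<forall>c\<in>AX. \<forall>x \<in> patch c. \<forall>fr. frames_at Q E fr x \<longrightarrow>
       (let z = coords c x;
            H = (\<lambda>v. in_chart c (k v (fr v)));
            \<Phi> = (\<lambda>a. in_chart c (\<phi> a (fr (tail Q a)) (fr (head Q a))));
            \<Phi>s = (\<lambda>a. hadj (H (tail Q a)) (H (head Q a)) (\<Phi> a))
        in \<forall>v \<in> verts' Q E. \<forall>p<rk (E v). \<forall>q<rk (E v).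
             of_nat (m v) * mean_curv_entry n g c (H v) z p q
             + (\<Sum>a | a \<in> arrows Q \<and> head Q a = v. (\<Phi> a z * \<Phi>s a z) $$ (p, q))
             - (\<Sum>a | a \<in> arrows Q \<and> tail Q a = v. (\<Phi>s a z * \<Phi> a z) $$ (p, q))
             = of_real (\<tau> v) * (1\<^sub>m (rk (E v)) $$ (p, q))))"


section \<open>Coherent subsheaves and stability\<close>

text \<open>
  A section over \<open>D\<close> is given by its components in all frames; values outside of \<open>D \<inter> tdom E i\<close>
  and components beyond the rank are irrelevant, so sections are compared by \<open>agree\<close>.
\<close>

type_synonym ('x, 'i) sect = "'i \<Rightarrow> 'x \<Rightarrow> nat \<Rightarrow> complex"
type_synonym ('x, 'i) subsheaf = "'x set \<Rightarrow> ('x, 'i) sect set"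

definition is_section :: "'x chart set \<Rightarrow> ('x, 'i) vbundle \<Rightarrow> 'x set \<Rightarrow> ('x, 'i) sect \<Rightarrow> bool" where
  "is_section AX E D \<sigma> \<longleftrightarrow>
     (\<forall>i\<in>idx E. \<forall>p<rk E. holo_fun AX (D \<inter> tdom E i) (\<lambda>x. \<sigma> i x p)) \<and>
     (\<forall>i\<in>idx E. \<forall>j\<in>idx E. \<forall>x \<in> D \<inter> tdom E i \<inter> tdom E j. \<forall>p<rk E.
        \<sigma> i x p = (\<Sum>q<rk E. trans E i j x $$ (p, q) * \<sigma> j x q))"

definition agree :: "('x, 'i) vbundle \<Rightarrow> 'x set \<Rightarrow> ('x, 'i) sect \<Rightarrow> ('x, 'i) sect \<Rightarrow> bool" where
  "agree E D \<sigma> \<sigma>' \<longleftrightarrow> (\<forall>i\<in>idx E. \<forall>x \<in> D \<inter> tdom E i. \<forall>p<rk E. \<sigma> i x p = \<sigma>' i x p)"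

definition sect_comb :: "('x \<Rightarrow> complex) list \<Rightarrow> ('x, 'i) sect list \<Rightarrow> ('x, 'i) sect" where
  "sect_comb fs bs = (\<lambda>i x p. \<Sum>l<length bs. (fs ! l) x * (bs ! l) i x p)"

definition holo_tuple :: "'x chart set \<Rightarrow> 'x set \<Rightarrow> nat \<Rightarrow> ('x \<Rightarrow> complex) list \<Rightarrow> bool" where
  "holo_tuple AX D r fs \<longleftrightarrow> length fs = r \<and> (\<forall>f\<in>set fs. holo_fun AX D f)"

text \<open>Subsheaves of modules of the sheaf of holomorphic sections of \<open>E\<close>.\<close>

definition is_subsheaf ::
  "'x::topological_space chart set \<Rightarrow> ('x, 'i) vbundle \<Rightarrow> ('x, 'i) subsheaf \<Rightarrow> bool" where
  "is_subsheaf AX E F \<longleftrightarrow>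
     (\<forall>D. open D \<longrightarrow>
        (\<forall>\<sigma>\<in>F D. is_section AX E D \<sigma>) \<and>
        (\<forall>fs bs. set bs \<subseteq> F D \<and> holo_tuple AX D (length bs) fs \<longrightarrow> sect_comb fs bs \<in> F D) \<and>
        (\<forall>D' \<subseteq> D. open D' \<longrightarrow> F D \<subseteq> F D') \<and>
        (\<forall>\<sigma>. is_section AX E D \<sigma> \<and>
             (\<forall>x\<in>D. \<exists>D'. open D' \<and> x \<in> D' \<and> D' \<subseteq> D \<and> (\<exists>\<sigma>'\<in>F D'. agree E D' \<sigma> \<sigma>'))
             \<longrightarrow> \<sigma> \<in> F D))"

definition sheaf_finite_type ::
  "'x::topological_space chart set \<Rightarrow> ('x, 'i) vbundle \<Rightarrow> ('x, 'i) subsheaf \<Rightarrow> bool" where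
  "sheaf_finite_type AX E F \<longleftrightarrow>
     (\<forall>x. \<exists>D bs. open D \<and> x \<in> D \<and> set bs \<subseteq> F D \<and>
        (\<forall>D' \<subseteq> D. open D' \<longrightarrow> (\<forall>\<sigma> \<in> F D'. \<forall>y \<in> D'.
           \<exists>D'' fs. open D'' \<and> y \<in> D'' \<and> D'' \<subseteq> D' \<and> holo_tuple AX D'' (length bs) fs \<and>
             agree E D'' \<sigma> (sect_comb fs bs))))"

definition is_syzygy ::
  "'x chart set \<Rightarrow> ('x, 'i) vbundle \<Rightarrow> ('x, 'i) sect list \<Rightarrow> 'x set \<Rightarrow> ('x \<Rightarrow> complex) list \<Rightarrow> bool" where
  "is_syzygy AX E bs D fs \<longleftrightarrow>
     holo_tuple AX D (length bs) fs \<and> agree E D (sect_comb fs bs) (\<lambda>_ _ _. 0)"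

definition sheaf_relations_finite_type ::
  "'x::topological_space chart set \<Rightarrow> ('x, 'i) vbundle \<Rightarrow> ('x, 'i) subsheaf \<Rightarrow> bool" where
  "sheaf_relations_finite_type AX E F \<longleftrightarrow>
     (\<forall>D bs. open D \<and> set bs \<subseteq> F D \<longrightarrow>
       (\<forall>x\<in>D. \<exists>D1 gs. open D1 \<and> x \<in> D1 \<and> D1 \<subseteq> D \<and> (\<forall>\<gamma>\<in>set gs. is_syzygy AX E bs D1 \<gamma>) \<and>
         (\<forall>D' \<subseteq> D1. open D' \<longrightarrow> (\<forall>fs. is_syzygy AX E bs D' fs \<longrightarrow> (\<forall>y \<in> D'.
            \<exists>D'' hs. open D'' \<and> y \<in> D'' \<and> D'' \<subseteq> D' \<and> holo_tuple AX D'' (length gs) hs \<and>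
              (\<forall>l<length bs. \<forall>x'\<in>D''.
                 (fs ! l) x' = (\<Sum>e<length gs. (hs ! e) x' * (gs ! e ! l) x')))))))"

definition coherent_subsheaf ::
  "'x::topological_space chart set \<Rightarrow> ('x, 'i) vbundle \<Rightarrow> ('x, 'i) subsheaf \<Rightarrow> bool" where
  "coherent_subsheaf AX E F \<longleftrightarrow>
     is_subsheaf AX E F \<and> sheaf_finite_type AX E F \<and> sheaf_relations_finite_type AX E F"

definition sheaf_basis ::
  "'x::topological_space chart set \<Rightarrow> ('x, 'i) vbundle \<Rightarrow> ('x, 'i) subsheaf \<Rightarrow> 'x set \<Rightarrow>
   ('x, 'i) sect list \<Rightarrow> bool" where
  "sheaf_basis AX E F D bs \<longleftrightarrow> set bs \<subseteq> F D \<and>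
     (\<forall>D' \<subseteq> D. open D' \<longrightarrow>
        (\<forall>\<sigma> \<in> F D'. \<exists>fs. holo_tuple AX D' (length bs) fs \<and> agree E D' \<sigma> (sect_comb fs bs)) \<and>
        (\<forall>fs. is_syzygy AX E bs D' fs \<longrightarrow> (\<forall>f\<in>set fs. \<forall>x\<in>D'. f x = 0)))"

definition locally_free_on ::
  "'x::topological_space chart set \<Rightarrow> ('x, 'i) vbundle \<Rightarrow> ('x, 'i) subsheaf \<Rightarrow> 'x set \<Rightarrow> nat \<Rightarrow> bool"
  where
  "locally_free_on AX E F Y r \<longleftrightarrow>
     (\<forall>x\<in>Y. \<exists>D bs. open D \<and> x \<in> D \<and> length bs = r \<and> sheaf_basis AX E F D bs)"

definition analytic_set :: "'x::topological_space chart set \<Rightarrow> 'x set \<Rightarrow> bool" where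
  "analytic_set AX Z \<longleftrightarrow>
     (\<forall>x. \<exists>D fs. open D \<and> x \<in> D \<and> finite fs \<and> (\<forall>f\<in>fs. holo_fun AX D f) \<and>
        Z \<inter> D = {y \<in> D. \<forall>f\<in>fs. f y = 0})"

text \<open>
  The dimension of \<open>Z\<close> at \<open>x\<close> is the least number of holomorphic functions that cut out
  \<open>x\<close> as an isolated point of their common zero set on \<open>Z\<close>.
\<close>

definition codim_ge_2 :: "nat \<Rightarrow> 'x::topological_space chart set \<Rightarrow> 'x set \<Rightarrow> bool" where
  "codim_ge_2 n AX Z \<longleftrightarrow> Z = {} \<or> 2 \<le> n \<and>
     (\<forall>x\<in>Z. \<exists>D fs. open D \<and> x \<in> D \<and> holo_tuple AX D (n - 2) fs \<and>
        {y \<in> Z \<inter> D. \<forall>f\<in>set fs. f y = 0} = {x})"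

definition sheaf_rank ::
  "'x::topological_space chart set \<Rightarrow> ('x, 'i) vbundle \<Rightarrow> ('x, 'i) subsheaf \<Rightarrow> nat \<Rightarrow> bool" where
  "sheaf_rank AX E F r \<longleftrightarrow>
     (\<exists>Z. analytic_set AX Z \<and> interior Z = {} \<and> locally_free_on AX E F (- Z) r)"

text \<open>
  The line bundle \<open>L\<close> is the determinant, the double dual of the \<open>r\<close>-th exterior power, of the
  torsion free sheaf \<open>F\<close> of rank \<open>r\<close>: outside of an analytic set \<open>Z\<close> of codimension at least two,
  \<open>F\<close> is locally free, and \<open>\<delta> D [\<sigma>\<^sub>1, \<dots>, \<sigma>\<^sub>r]\<close> is the image of \<open>\<sigma>\<^sub>1 \<and> \<dots> \<and> \<sigma>\<^sub>r\<close> under an isomorphism of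
  the \<open>r\<close>-th exterior power with \<open>L\<close>. Since \<open>X\<close> is compact, \<open>L\<close> has a finite trivializing
  cover, so that indices in \<open>nat\<close> suffice.
\<close>

definition is_det_bundle ::
  "nat \<Rightarrow> 'x::t2_space chart set \<Rightarrow> ('x, 'i) vbundle \<Rightarrow> ('x, 'i) subsheaf \<Rightarrow> nat \<Rightarrow>
   ('x, nat) vbundle \<Rightarrow> bool" where
  "is_det_bundle n AX E F r L \<longleftrightarrow> holo_bundle AX L \<and> rk L = 1 \<and>
     (\<exists>Z (\<delta> :: 'x set \<Rightarrow> ('x, 'i) sect list \<Rightarrow> ('x, nat) sect).
        analytic_set AX Z \<and> codim_ge_2 n AX Z \<and> locally_free_on AX E F (- Z) r \<and>
        (\<forall>D. open D \<and> D \<subseteq> - Z \<longrightarrow>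
           (\<forall>bs. set bs \<subseteq> F D \<and> length bs = r \<longrightarrow>
              is_section AX L D (\<delta> D bs) \<and>
              (\<forall>D' \<subseteq> D. open D' \<longrightarrow> agree L D' (\<delta> D' bs) (\<delta> D bs)) \<and>
              (\<forall>bs' (A :: 'x \<Rightarrow> complex mat).
                 set bs' \<subseteq> F D \<and> length bs' = r \<and>
                 (\<forall>x\<in>D. A x \<in> carrier_mat r r) \<and>
                 (\<forall>e<r. \<forall>l<r. holo_fun AX D (\<lambda>x. A x $$ (e, l))) \<and>
                 (\<forall>e<r. agree E D (bs' ! e) (\<lambda>i x p. \<Sum>l<r. A x $$ (e, l) * (bs ! l) i x p))
                 \<longrightarrow> agree L D (\<delta> D bs') (\<lambda>i x p. Determinant.det (A x) * \<delta> D bs i x p)) \<and>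
              (sheaf_basis AX E F D bs \<longrightarrow>
                 (\<forall>i\<in>idx L. \<forall>x \<in> D \<inter> tdom L i. \<delta> D bs i x 0 \<noteq> 0)))))"

definition has_sheaf_degree ::
  "nat \<Rightarrow> 'x::t2_space chart set \<Rightarrow> ('x chart \<Rightarrow> cvec \<Rightarrow> complex mat) \<Rightarrow> ('x, 'i) vbundle \<Rightarrow>
   ('x, 'i) subsheaf \<Rightarrow> real \<Rightarrow> bool" where
  "has_sheaf_degree n AX g E F d \<longleftrightarrow>
     (\<exists>r L. sheaf_rank AX E F r \<and> is_det_bundle n AX E F r L \<and> has_degree n AX g L d)"

definition coherent_quiver_subsheaf ::
  "'x::topological_space chart set \<Rightarrow> ('q, 'a) quiver \<Rightarrow> ('q \<Rightarrow> ('x, 'i) vbundle) \<Rightarrow>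
   ('a \<Rightarrow> 'i \<Rightarrow> 'i \<Rightarrow> 'x \<Rightarrow> complex mat) \<Rightarrow> ('q \<Rightarrow> ('x, 'i) subsheaf) \<Rightarrow> bool" where
  "coherent_quiver_subsheaf AX Q E \<phi> F \<longleftrightarrow>
     (\<forall>v\<in>verts Q. coherent_subsheaf AX (E v) (F v)) \<and>
     (\<forall>a\<in>arrows Q. \<forall>D. open D \<longrightarrow> (\<forall>\<sigma> \<in> F (tail Q a) D. \<forall>\<sigma>'.
        is_section AX (E (head Q a)) D \<sigma>' \<and>
        (\<forall>i \<in> idx (E (tail Q a)). \<forall>j \<in> idx (E (head Q a)).
           \<forall>x \<in> D \<inter> tdom (E (tail Q a)) i \<inter> tdom (E (head Q a)) j. \<forall>p<rk (E (head Q a)).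
             \<sigma>' j x p = (\<Sum>q<rk (E (tail Q a)). \<phi> a i j x $$ (p, q) * \<sigma> i x q))
        \<longrightarrow> \<sigma>' \<in> F (head Q a) D))"

definition stable_quiver_bundle ::
  "nat \<Rightarrow> 'x::t2_space chart set \<Rightarrow> ('x chart \<Rightarrow> cvec \<Rightarrow> complex mat) \<Rightarrow> ('q, 'a) quiver \<Rightarrow>
   ('q \<Rightarrow> nat) \<Rightarrow> ('q \<Rightarrow> real) \<Rightarrow> ('q \<Rightarrow> ('x, 'i) vbundle) \<Rightarrow>
   ('a \<Rightarrow> 'i \<Rightarrow> 'i \<Rightarrow> 'x \<Rightarrow> complex mat) \<Rightarrow> bool" where
  "stable_quiver_bundle n AX g Q m \<tau> E \<phi> \<longleftrightarrow>
     (\<forall>d. (\<forall>v \<in> verts' Q E. has_degree n AX g (E v) (d v)) \<longrightarrow>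
        (\<Sum>v \<in> verts' Q E. real (m v) * d v - \<tau> v * real (rk (E v))) = 0) \<and>
     (\<forall>F r d. coherent_quiver_subsheaf AX Q E \<phi> F \<and>
        (\<forall>v \<in> verts' Q E. sheaf_rank AX (E v) (F v) (r v) \<and> has_sheaf_degree n AX g (E v) (F v) (d v)) \<and>
        0 < (\<Sum>v \<in> verts' Q E. r v) \<and> (\<Sum>v \<in> verts' Q E. r v) < (\<Sum>v \<in> verts' Q E. rk (E v)) \<longrightarrow>
        (\<Sum>v \<in> verts' Q E. real (m v) * d v - \<tau> v * real (r v)) < 0)"


section \<open>Forms on the base\<close>

text \<open>
  Forms and tensors on \<open>S\<close> at \<open>s0\<close> are computed in the ambient coordinates of a chart \<open>c\<close> of
  \<open>S\<close> around \<open>s0\<close>, by means of extensions of the metrics and of the bundle maps. They extend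
  only locally on \<open>X \<times> S\<close>: \<open>X\<close> is covered by finitely many coordinate neighbourhoods, with a
  subordinate partition of unity for the fiber integrals, and on each of them, for frames of the
  family chosen there, \<open>met j v\<close> and \<open>mor j a\<close> are extensions of the matrices of the metrics
  and of the bundle maps to the product of the neighbourhood with the open set \<open>amb\<close>.
  At a regular point of \<open>S\<close>, the coordinates of \<open>c\<close> are coordinates of the manifold \<open>S\<close> near the
  point, and the extensions are the local expressions of the data themselves.
\<close>

record ('x, 'q, 'a, 'i) local_ext =
  pou :: "'x pieces"
  fr :: "nat \<Rightarrow> 'q \<Rightarrow> 'i"
  amb :: "cvec set"
  met :: "nat \<Rightarrow> 'q \<Rightarrow> cvec \<Rightarrow> complex mat"
  mor :: "nat \<Rightarrow> 'a \<Rightarrow> cvec \<Rightarrow> complex mat"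

definition local_extension_at ::
  "nat \<Rightarrow> 'x::t2_space chart set \<Rightarrow> ('q, 'a) quiver \<Rightarrow> ('q \<Rightarrow> ('x \<times> 's, 'i) vbundle) \<Rightarrow>
   ('a \<Rightarrow> 'i \<Rightarrow> 'i \<Rightarrow> 'x \<times> 's \<Rightarrow> complex mat) \<Rightarrow> ('q \<Rightarrow> 'i \<Rightarrow> 'x \<times> 's \<Rightarrow> complex mat) \<Rightarrow>
   's chart \<Rightarrow> 's \<Rightarrow> ('x, 'q, 'a, 'i) local_ext \<Rightarrow> bool" where
  "local_extension_at n AX Q E \<phi> k c s0 \<E> \<longleftrightarrow>
     partition_of_unity AX (pou \<E>) \<and>
     openin (top_of_set (Cn (edim c))) (amb \<E>) \<and> coords c s0 \<in> amb \<E> \<and>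
     (\<forall>j < psize (pou \<E>).
        let cj = pchart (pou \<E>) j; Xj = pnbhd (pou \<E>) j;
            Sj = {s \<in> patch c. coords c s \<in> amb \<E>};
            D = {join n z u | z u. z \<in> coords cj ` Xj \<and> u \<in> amb \<E>}
        in
        (\<forall>v \<in> verts' Q E. fr \<E> j v \<in> idx (E v) \<and> Xj \<times> Sj \<subseteq> tdom (E v) (fr \<E> j v) \<and>
           (\<forall>w\<in>D. herm_pos (rk (E v)) (met \<E> j v w)) \<and>
           (\<forall>p<rk (E v). \<forall>q<rk (E v). smooth_on (n + edim c) D (\<lambda>w. met \<E> j v w $$ (p, q))) \<and>
           (\<forall>x\<in>Xj. \<forall>s\<in>Sj. met \<E> j v (join n (coords cj x) (coords c s)) = k v (fr \<E> j v) (x, s))) \<and>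
        (\<forall>a \<in> arrows' Q E.
           (\<forall>w\<in>D. mor \<E> j a w \<in> carrier_mat (rk (E (head Q a))) (rk (E (tail Q a)))) \<and>
           (\<forall>p<rk (E (head Q a)). \<forall>q<rk (E (tail Q a)).
              holo_on (n + edim c) D (\<lambda>w. mor \<E> j a w $$ (p, q))) \<and>
           (\<forall>x\<in>Xj. \<forall>s\<in>Sj. mor \<E> j a (join n (coords cj x) (coords c s)) =
              \<phi> a (fr \<E> j (tail Q a)) (fr \<E> j (head Q a)) (x, s))))"

definition fiber_part :: "nat \<Rightarrow> cvec \<Rightarrow> cvec" where
  "fiber_part n w = (\<lambda>i. if i < n then w i else 0)"

text \<open>The pull-back of \<open>\<omega>\<^sub>X\<close> to the product, in the coordinates of the \<open>j\<close>-th piece.\<close>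

definition omegaX ::
  "nat \<Rightarrow> ('x chart \<Rightarrow> cvec \<Rightarrow> complex mat) \<Rightarrow> ('x, 'q, 'a, 'i) local_ext \<Rightarrow> nat \<Rightarrow> cvec \<Rightarrow> form" where
  "omegaX n g \<E> j w = kform n g (pchart (pou \<E>) j) (fiber_part n w)"

definition omegaX_pow ::
  "nat \<Rightarrow> ('x chart \<Rightarrow> cvec \<Rightarrow> complex mat) \<Rightarrow> ('x, 'q, 'a, 'i) local_ext \<Rightarrow> nat \<Rightarrow> nat \<Rightarrow> cvec \<Rightarrow> form"
  where
  "omegaX_pow n g \<E> k j w = fscale (1 / fact k) (fpow (omegaX n g \<E> j w) k)"

text \<open>The integral over the fiber of the function \<open>f\<close> with respect to \<open>g dV = \<omega>\<^sub>X\<^sup>n / n!\<close>.\<close>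

definition fiber_int_fun ::
  "nat \<Rightarrow> ('x chart \<Rightarrow> cvec \<Rightarrow> complex mat) \<Rightarrow> ('x, 'q, 'a, 'i) local_ext \<Rightarrow>
   (nat \<Rightarrow> cvec \<Rightarrow> complex) \<Rightarrow> cvec \<Rightarrow> complex" where
  "fiber_int_fun n g \<E> f s = fiber_int n (pou \<E>) (\<lambda>j w. fscale (f j w) (omegaX_pow n g \<E> n j w)) s {}"

text \<open>The entries of the matrix of curvature forms \<open>\<Omega>\<close> for the metric \<open>H\<close>, in \<open>N\<close> coordinates.\<close>

definition Omega :: "nat \<Rightarrow> (cvec \<Rightarrow> complex mat) \<Rightarrow> cvec \<Rightarrow> nat \<Rightarrow> nat \<Rightarrow> form" where
  "Omega N H w p q = form11 N (\<lambda>A B. curv A B H w $$ (p, q))"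

definition tr_Omega :: "nat \<Rightarrow> (cvec \<Rightarrow> complex mat) \<Rightarrow> cvec \<Rightarrow> form" where
  "tr_Omega N H w = (\<lambda>K. \<Sum>p<dim_row (H w). Omega N H w p p K)"

definition tr_Omega_Omega :: "nat \<Rightarrow> (cvec \<Rightarrow> complex mat) \<Rightarrow> cvec \<Rightarrow> form" where
  "tr_Omega_Omega N H w = (\<lambda>K. \<Sum>p<dim_row (H w). \<Sum>q<dim_row (H w).
     wedge (Omega N H w p q) (Omega N H w q p) K)"

definition norm_mor ::
  "('q, 'a) quiver \<Rightarrow> ('x, 'q, 'a, 'i) local_ext \<Rightarrow> 'a \<Rightarrow> nat \<Rightarrow> cvec \<Rightarrow> complex" where
  "norm_mor Q \<E> a j w = mtrace (mor \<E> j a w *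
     hadj (met \<E> j (tail Q a)) (met \<E> j (head Q a)) (mor \<E> j a) w)"

text \<open>The coordinate \<open>s\<^sup>i\<close> of the ambient space of \<open>S\<close> is the coordinate number \<open>n + i\<close> of the product.\<close>

definition G_WP ::
  "nat \<Rightarrow> ('x chart \<Rightarrow> cvec \<Rightarrow> complex mat) \<Rightarrow> ('q, 'a) quiver \<Rightarrow> ('q \<Rightarrow> nat) \<Rightarrow>
   ('q \<Rightarrow> ('x \<times> 's, 'i) vbundle) \<Rightarrow> ('x, 'q, 'a, 'i) local_ext \<Rightarrow> cvec \<Rightarrow> nat \<Rightarrow> nat \<Rightarrow> complex" where
  "G_WP n g Q m E \<E> s i l =
     fiber_int_fun n g \<E> (\<lambda>j w. \<Sum>a \<in> arrows' Q E.
        mtrace (cov_del (n + i) (met \<E> j (tail Q a)) (met \<E> j (head Q a)) (mor \<E> j a) w *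
                cov_delbar_adj (n + l) (met \<E> j (tail Q a)) (met \<E> j (head Q a)) (mor \<E> j a) w)) s
   + fiber_int_fun n g \<E> (\<lambda>j w. \<Sum>v \<in> verts' Q E. of_nat (m v) * (\<Sum>\<alpha><n. \<Sum>\<beta><n.
        ginv g (pchart (pou \<E>) j) (fiber_part n w) \<beta> \<alpha> *
        mtrace (curv (n + i) \<beta> (met \<E> j v) w * curv \<alpha> (n + l) (met \<E> j v) w))) s"

definition omega_WP ::
  "nat \<Rightarrow> ('x chart \<Rightarrow> cvec \<Rightarrow> complex mat) \<Rightarrow> ('q, 'a) quiver \<Rightarrow> ('q \<Rightarrow> nat) \<Rightarrow>
   ('q \<Rightarrow> ('x \<times> 's, 'i) vbundle) \<Rightarrow> nat \<Rightarrow> ('x, 'q, 'a, 'i) local_ext \<Rightarrow> cvec \<Rightarrow> form" where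
  "omega_WP n g Q m E N \<E> s = form11 N (\<lambda>i l. \<i> * G_WP n g Q m E \<E> s i l)"

end

theory Submission
  imports Defs "HOL-Complex_Analysis.Complex_Analysis"
begin

text \<open>
  The identity holds for the integrands over each fiber. Contracting \<open>\<omega>\<^sub>X\<^sup>n\<close> with coordinate vectors shows
  that, with \<open>g\<^sup>\<beta>\<^sup>\<alpha>\<close> the inverse metric, \<open>dz\<^sup>\<alpha> \<and> dz\<^sup>\<beta>\<^sup>b\<^sup>a\<^sup>r \<and> \<omega>\<^sub>X\<^sup>n\<^sup>-\<^sup>1 / (n - 1)!\<close> equals
  \<open>- \<i> g\<^sup>\<beta>\<^sup>\<alpha> \<omega>\<^sub>X\<^sup>n / n!\<close>, and that \<open>\<omega>\<^sub>X\<^sup>n\<^sup>-\<^sup>1\<close> kills \<open>dz\<^sup>\<alpha> \<and> dz\<^sup>\<gamma>\<close> and its conjugates. Hence the first term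
  contributes \<open>\<i> n\<^sub>\<lambda> (tr (g R\<^sub>i\<^sub>\<beta> R\<^sub>\<alpha>\<^sub>j) - tr (R\<^sub>i\<^sub>j g R\<^sub>\<alpha>\<^sub>\<beta>))\<close>. Because the bundle maps are holomorphic,
  \<open>\<partial>\<^sub>i \<partial>\<^sub>j\<^sub>b\<^sub>a\<^sub>r tr (\<phi> \<phi>\<^sup>*) = tr (\<phi>\<^sub>;\<^sub>i \<phi>\<^sup>*\<^sub>;\<^sub>j) + tr (R\<^sub>i\<^sub>j \<phi>\<^sup>* \<phi>) - tr (R\<^sub>i\<^sub>j \<phi> \<phi>\<^sup>*)\<close>, where the curvatures are those of
  the tail and of the head, and the vortex equation, traced against \<open>R\<^sub>i\<^sub>j\<close>, cancels all terms that do
  not belong to the Weil-Petersson form. Derivatives on the base commute with the fiber integral since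
  \<open>X\<close> is compact.
\<close>


section \<open>Exterior algebra\<close>


text \<open>The metrics and bundle maps are only known through extensions to an ambient space of
  \<open>S\<close>, and the vortex equation says nothing about these extensions away from the fiber
  over \<open>s0\<close>. So derivatives in base directions are computed for arbitrary smooth
  metrics and a holomorphic map, and the vortex equation enters only afterwards, at points
  \<open>join n z u\<close> of this fiber. It applies there because the curvature in fiber
  directions is determined by the restriction of the metric to the fiber. The fiber integral of a
  form at \<open>K\<close> is the integral of one coefficient, that of the fiber block
  \<open>{..<2 * n}\<close> joined with the shifted \<open>K\<close>. Contractions with base vectors
  remove the shifted \<open>K\<close> without a sign, because the fiber block has even size;
  contractions of the top power with fiber vectors give a linear system with matrix g, which the
  inverse metric solves. All integrals have one shape, a weight with compact support in a fiber
  chart times a function, so that differentiation under the integral sign is proved once.\<close>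

definition covec :: "nat \<Rightarrow> form" where
  "covec a = (\<lambda>K. if K = {a} then 1 else 0)"

text \<open>Interior product with the coordinate vector dual to \<open>covec a\<close>: the sign
  counts the members of \<open>M\<close> below \<open>a\<close>, which the covector number
  \<open>a\<close> has to pass to reach the front of the monomial.\<close>

definition contr :: "nat \<Rightarrow> form \<Rightarrow> form" where
  "contr a \<alpha> = (\<lambda>M. if a \<in> M then 0 else wsign {a} M * \<alpha> (insert a M))"

text \<open>The sign (-1)^degree, which appears when an odd operation such as contraction is moved
  past a form.\<close>

definition grade_inv :: "form \<Rightarrow> form" where
  "grade_inv \<alpha> = (\<lambda>K. (-1) ^ card K * \<alpha> K)"

lemma dw_covec: "dw A = covec (2 * A)" and dwbar_covec: "dwbar A = covec (2 * A + 1)"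
  by (simp_all add: dw_def dwbar_def covec_def)

section \<open>Inversion signs and the algebra of the wedge product\<close>

lemma finite_inversions [simp]:
  "finite I \<Longrightarrow> finite J \<Longrightarrow> finite {(i :: nat, j :: nat). i \<in> I \<and> j \<in> J \<and> j < i}"
  by (rule finite_subset[of _ "I \<times> J"]) auto

text \<open>Inversions are counted pair by pair, so the count adds over disjoint unions and the sign
  multiplies.\<close>

lemma wsign_Un_left:
  assumes "finite I" "finite I'" "finite J" "I \<inter> I' = {}"
  shows "wsign (I \<union> I') J = wsign I J * wsign I' J"
proof -
  have "{(i, j). i \<in> I \<union> I' \<and> j \<in> J \<and> j < i} =
      {(i, j). i \<in> I \<and> j \<in> J \<and> j < i} \<union> {(i, j). i \<in> I' \<and> j \<in> J \<and> j < i}" by auto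
  moreover have "{(i, j). i \<in> I \<and> j \<in> J \<and> j < i} \<inter> {(i, j). i \<in> I' \<and> j \<in> J \<and> j < i} = {}"
    using assms(4) by auto
  ultimately show ?thesis
    using assms by (simp add: wsign_def card_Un_disjoint power_add)
qed

lemma wsign_Un_right:
  assumes "finite I" "finite J" "finite J'" "J \<inter> J' = {}"
  shows "wsign I (J \<union> J') = wsign I J * wsign I J'"
proof -
  have "{(i, j). i \<in> I \<and> j \<in> J \<union> J' \<and> j < i} =
      {(i, j). i \<in> I \<and> j \<in> J \<and> j < i} \<union> {(i, j). i \<in> I \<and> j \<in> J' \<and> j < i}" by auto
  moreover have "{(i, j). i \<in> I \<and> j \<in> J \<and> j < i} \<inter> {(i, j). i \<in> I \<and> j \<in> J' \<and> j < i} = {}"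
    using assms(4) by auto
  ultimately show ?thesis
    using assms by (simp add: wsign_def card_Un_disjoint power_add)
qed

lemma wsign_empty [simp]: "wsign {} J = 1" "wsign I {} = 1"
  by (simp_all add: wsign_def)

lemma wsign_square [simp]: "wsign I J * wsign I J = 1" "wsign I J * (wsign I J * x) = x"
  by (simp_all add: wsign_def flip: power_add mult_2 mult.assoc)

lemma wsign_sing: "wsign {a} {b} = (if b < a then -1 else 1)"
proof -
  have "{(i, j). i \<in> {a} \<and> j \<in> {b} \<and> j < i} = (if b < a then {(a, b)} else {})" by auto
  then show ?thesis by (simp add: wsign_def)
qed

lemma wsign_insert_left:
  "finite I \<Longrightarrow> finite J \<Longrightarrow> a \<notin> I \<Longrightarrow> wsign (insert a I) J = wsign {a} J * wsign I J"
  using wsign_Un_left[of "{a}" I J] by simp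

lemma wsign_insert_right:
  "finite I \<Longrightarrow> finite J \<Longrightarrow> a \<notin> J \<Longrightarrow> wsign I (insert a J) = wsign I {a} * wsign I J"
  using wsign_Un_right[of I "{a}" J] by simp

text \<open>Each pair in \<open>I \<times> J\<close> is an inversion in exactly one of the two
  orders, as the sets are disjoint; the two counts add up to \<open>card I * card J\<close>.\<close>

lemma wsign_swap:
  assumes "finite I" "finite J" "I \<inter> J = {}"
  shows "wsign I J = (-1) ^ (card I * card J) * wsign J I"
proof -
  have "j < i \<or> i < j" if "i \<in> I" "j \<in> J" for i j
    using that assms(3) by (metis IntI empty_iff linorder_neqE_nat)
  then have "I \<times> J = {(i, j). i \<in> I \<and> j \<in> J \<and> j < i} \<union> {(i, j). i \<in> I \<and> j \<in> J \<and> i < j}"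
    by blast
  moreover have "finite {(i, j). i \<in> I \<and> j \<in> J \<and> i < j}"
    by (rule finite_subset[of _ "I \<times> J"]) (use assms in auto)
  moreover have "{(i, j). i \<in> I \<and> j \<in> J \<and> j < i} \<inter> {(i, j). i \<in> I \<and> j \<in> J \<and> i < j} = {}"
    by auto
  ultimately have "card (I \<times> J) = card {(i, j). i \<in> I \<and> j \<in> J \<and> j < i} + card {(i, j). i \<in> I \<and> j \<in> J \<and> i < j}"
    using assms by (simp add: card_Un_disjoint)
  moreover have "card {(i, j). i \<in> I \<and> j \<in> J \<and> i < j} = card {(j, i). j \<in> J \<and> i \<in> I \<and> i < j}"
    by (rule bij_betw_same_card[of prod.swap]) (auto simp: bij_betw_def inj_on_def prod.swap_def image_iff)
  ultimately have "card I * card J =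
      card {(i, j). i \<in> I \<and> j \<in> J \<and> j < i} + card {(j, i). j \<in> J \<and> i \<in> I \<and> i < j}"
    by (simp add: card_cartesian_product)
  then show ?thesis
    by (simp add: wsign_def power_add flip: mult_2 mult.assoc)
qed

text \<open>The power set of an infinite set is infinite, and sums over infinite sets are 0. This
  default lets identities such as associativity hold at every index set.\<close>

lemma wedge_infinite: "infinite K \<Longrightarrow> wedge \<alpha> \<beta> K = 0"
  by (simp add: wedge_def)

lemma wedge_cong:
  "(\<And>I. I \<subseteq> K \<Longrightarrow> finite I \<Longrightarrow> \<alpha> I = \<alpha>' I) \<Longrightarrow> (\<And>I. I \<subseteq> K \<Longrightarrow> finite I \<Longrightarrow> \<beta> I = \<beta>' I)
    \<Longrightarrow> wedge \<alpha> \<beta> K = wedge \<alpha>' \<beta>' K"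
  unfolding wedge_def by (cases "finite K") (auto intro!: sum.cong simp: finite_subset)

lemma wedge_scale_left: "wedge (\<lambda>K. c * \<alpha> K) \<beta> K = c * wedge \<alpha> \<beta> K"
  and wedge_scale_right: "wedge \<alpha> (\<lambda>K. c * \<beta> K) K = c * wedge \<alpha> \<beta> K"
  and wedge_sum_left: "wedge (\<lambda>K. \<Sum>x\<in>S. f x K) \<beta> K = (\<Sum>x\<in>S. wedge (f x) \<beta> K)"
  and wedge_sum_right: "wedge \<alpha> (\<lambda>K. \<Sum>x\<in>S. f x K) K = (\<Sum>x\<in>S. wedge \<alpha> (f x) K)"
  unfolding wedge_def
  by (simp_all add: algebra_simps sum.distrib sum_distrib_left sum_distrib_right sum.swap[of _ S])

lemma wedge_zero_right: "wedge \<alpha> (\<lambda>K. 0) K = 0" and wedge_zero_left: "wedge (\<lambda>K. 0) \<beta> K = 0"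
  by (simp_all add: wedge_def)

text \<open>Both sides sum over the ordered partitions of \<open>K\<close> into three blocks. As the
  sign is multiplicative, each summand carries the inversions between all three pairs of
  blocks.\<close>

lemma wedge_assoc: "wedge (wedge \<alpha> \<beta>) \<gamma> = wedge \<alpha> (wedge \<beta> \<gamma>)"
proof
  fix K :: "nat set"
  show "wedge (wedge \<alpha> \<beta>) \<gamma> K = wedge \<alpha> (wedge \<beta> \<gamma>) K"
  proof (cases "finite K")
    case True
    then have fin: "\<forall>I\<in>Pow K. finite (Pow I)" by (auto intro: finite_subset)
    have "wedge (wedge \<alpha> \<beta>) \<gamma> K =
        (\<Sum>(I, J)\<in>Sigma (Pow K) Pow. wsign I (K - I) * (wsign J (I - J) * \<alpha> J * \<beta> (I - J)) * \<gamma> (K - I))"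
      using True fin unfolding wedge_def
      by (subst sum.Sigma[symmetric]) (simp_all add: sum_distrib_left sum_distrib_right)
    also have "\<dots> = (\<Sum>(J, M)\<in>Sigma (Pow K) (\<lambda>J. Pow (K - J)).
        wsign J (K - J) * \<alpha> J * (wsign M (K - J - M) * \<beta> M * \<gamma> (K - J - M)))"
    \<comment> \<open>A chain \<open>J \<subseteq> I \<subseteq> K\<close> corresponds to the blocks
      \<open>J\<close>, \<open>I - J\<close> and \<open>K - I\<close>.\<close>
    proof (rule sum.reindex_bij_witness[where i = "\<lambda>(J, M). (J \<union> M, J)" and j = "\<lambda>(I, J). (J, I - J)"],
        goal_cases)
      case (5 x)
      obtain I J where x: "x = (I, J)" by (cases x)
      with 5 have IJ: "I \<subseteq> K" "J \<subseteq> I" by auto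
      have fin: "finite I" "finite J" "finite (K - I)" "finite (I - J)"
        using IJ True by (auto intro: finite_subset)
      have "K - J - (I - J) = K - I" "K - J = (I - J) \<union> (K - I)" "I = J \<union> (I - J)" using IJ by auto
      moreover have "wsign J (K - J) = wsign J (I - J) * wsign J (K - I)"
        unfolding \<open>K - J = (I - J) \<union> (K - I)\<close> using fin by (intro wsign_Un_right) auto
      moreover have "wsign I (K - I) = wsign J (K - I) * wsign (I - J) (K - I)"
        by (subst \<open>I = J \<union> (I - J)\<close>, rule wsign_Un_left) (use fin in auto)
      ultimately show ?case by (simp add: x)
    qed auto
    also have "\<dots> = wedge \<alpha> (wedge \<beta> \<gamma>) K"
      using True unfolding wedge_def
      by (subst sum.Sigma[symmetric]) (simp_all add: sum_distrib_left)
    finally show ?thesis .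
  qed (simp add: wedge_infinite)
qed

text \<open>Exchanging blocks of sizes p and q costs (-1)^(p q), so it is enough that the monomials
  of one factor are even.\<close>

lemma wedge_even_commute:
  assumes "\<And>K. \<alpha> K \<noteq> 0 \<Longrightarrow> even (card K)"
  shows "wedge \<alpha> \<beta> = wedge \<beta> \<alpha>"
proof
  fix K :: "nat set"
  show "wedge \<alpha> \<beta> K = wedge \<beta> \<alpha> K"
  proof (cases "finite K")
    case True
    show ?thesis
      unfolding wedge_def
    proof (rule sum.reindex_bij_witness[where i = "\<lambda>I. K - I" and j = "\<lambda>I. K - I"], goal_cases)
      case (5 I)
      then have "K - (K - I) = I" by auto
      moreover have "\<alpha> I \<noteq> 0 \<Longrightarrow> wsign I (K - I) = wsign (K - I) I"
        using 5 True assms[of I] finite_subset[of I K]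
        by (subst wsign_swap) (auto simp: )
      ultimately show ?case by auto
    qed auto
  qed (simp add: wedge_infinite)
qed

section \<open>Contraction as an antiderivation\<close>

lemma sum_Pow_insert:
  fixes f :: "'b set \<Rightarrow> complex"
  assumes "finite M" "a \<notin> M"
  shows "sum f (Pow (insert a M)) = (\<Sum>I\<in>Pow M. f (insert a I)) + sum f (Pow M)"
proof -
  have "inj_on (insert a) (Pow M)" using assms by (auto simp: inj_on_def)
  moreover have "Pow M \<inter> insert a ` Pow M = {}" using assms by auto
  ultimately show ?thesis
    using assms by (simp add: Pow_insert sum.union_disjoint sum.reindex)
qed

text \<open>For \<open>a\<close> outside \<open>M\<close>, the splittings of
  \<open>insert a M\<close> either give \<open>a\<close> to the first factor or to the second, which
  yields the two terms of the antiderivation rule; \<open>grade_inv\<close> accounts for moving past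
  the first factor.\<close>

lemma contr_wedge: "contr a (wedge \<alpha> \<beta>) M = wedge (contr a \<alpha>) \<beta> M + wedge (grade_inv \<alpha>) (contr a \<beta>) M"
proof (cases "finite M")
  case fin: True
  show ?thesis
  proof (cases "a \<in> M")
    case False
    have 1: "wsign {a} M * (wsign (insert a I) (M - I) * \<alpha> (insert a I) * \<beta> (M - I)) = wsign I (M - I) * contr a \<alpha> I * \<beta> (M - I)" if "I \<subseteq> M" for I
    proof -
      have f: "finite I" "finite (M - I)" and a: "a \<notin> I" using that fin False by (auto intro: finite_subset)
      have "wsign {a} M = wsign {a} I * wsign {a} (M - I)"
        using wsign_Un_right[of "{a}" I "M - I"] f that by (simp add: Un_absorb1)
      then show ?thesis using a f by (simp add: contr_def wsign_insert_left[OF f a] mult_ac)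
    qed
    have 2: "wsign {a} M * (wsign I (insert a M - I) * \<alpha> I * \<beta> (insert a M - I)) =
        wsign I (M - I) * grade_inv \<alpha> I * contr a \<beta> (M - I)" if "I \<subseteq> M" for I
    proof -
      have f: "finite I" "finite (M - I)" and a: "a \<notin> I" using that fin False by (auto intro: finite_subset)
      have "wsign {a} M = wsign {a} I * wsign {a} (M - I)"
        using wsign_Un_right[of "{a}" I "M - I"] f that by (simp add: Un_absorb1)
      moreover have "insert a M - I = insert a (M - I)" using a by auto
      moreover have "wsign I {a} = (-1) ^ card I * wsign {a} I"
        using wsign_swap[of I "{a}"] f a by simp
      ultimately show ?thesis
        using a f False by (simp add: contr_def wsign_insert_right[of I "M - I" a] grade_inv_def mult_ac)
    qed
    show ?thesis
      unfolding contr_def[of a "wedge \<alpha> \<beta>"] using fin False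
      by (simp add: wedge_def sum_Pow_insert distrib_left sum_distrib_left 1 2)
  next
    case True
    define M' where "M' = M - {a}"
    have M: "M = insert a M'" "a \<notin> M'" "finite M'" using True fin by (auto simp: M'_def)
    \<comment> \<open>If \<open>a\<close> is in \<open>M\<close>, the left side is 0 and the right
      side cancels in pairs: both terms are
      \<open>\<alpha> (insert a I) * \<beta> (insert a (M' - I))\<close> up to sign, with opposite
      signs.\<close>
    have 1: "wsign I (M - I) * contr a \<alpha> I * \<beta> (M - I) +
        wsign (insert a I) (M - insert a I) * grade_inv \<alpha> (insert a I) * contr a \<beta> (M - insert a I) = 0"
      if "I \<subseteq> M'" for I
    proof -
      have f: "finite I" "finite (M' - I)" and a: "a \<notin> I" using that M by (auto intro: finite_subset)
      have "M - insert a I = M' - I" "M - I = insert a (M' - I)" using M a by auto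
      moreover have "wsign I {a} = (-1) ^ card I * wsign {a} I"
        using wsign_swap[of I "{a}"] f a by simp
      ultimately show ?thesis
        using a f M(2)
        by (simp add: contr_def wsign_insert_right[of I "M' - I" a] wsign_insert_left[of I "M' - I" a]
            grade_inv_def mult_ac)
    qed
    have S: "sum f (Pow M) = (\<Sum>I\<in>Pow M'. f (insert a I)) + sum f (Pow M')" for f :: "nat set \<Rightarrow> complex"
      using sum_Pow_insert[OF M(3,2)] M(1) by simp
    have 2: "contr a \<alpha> (insert a I) = 0" for I by (simp add: contr_def)
    have 3: "contr a \<beta> (M - I) = 0" if "I \<subseteq> M'" for I using that M by (auto simp: contr_def)
    have "wedge (contr a \<alpha>) \<beta> M = (\<Sum>I\<in>Pow M'. wsign I (M - I) * contr a \<alpha> I * \<beta> (M - I))"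
      unfolding wedge_def S by (simp add: 2)
    moreover have "wedge (grade_inv \<alpha>) (contr a \<beta>) M = (\<Sum>I\<in>Pow M'. wsign (insert a I) (M - insert a I) *
        grade_inv \<alpha> (insert a I) * contr a \<beta> (M - insert a I))"
      unfolding wedge_def S by (simp add: 3)
    ultimately show ?thesis using True 1 by (simp add: contr_def flip: sum.distrib)
  qed
qed (simp add: contr_def wedge_infinite)


section \<open>Homogeneous forms and forms of type (1,1)\<close>

definition homog :: "nat \<Rightarrow> form \<Rightarrow> bool" where
  "homog d \<alpha> \<longleftrightarrow> (\<forall>K. \<alpha> K \<noteq> 0 \<longrightarrow> finite K \<and> card K = d)"

lemma wedge_nonzeroD:
  assumes "wedge \<alpha> \<beta> K \<noteq> 0"
  obtains I where "finite K" "I \<subseteq> K" "\<alpha> I \<noteq> 0" "\<beta> (K - I) \<noteq> 0"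
proof -
  have "finite K" using assms wedge_infinite by blast
  moreover from assms obtain I where "I \<in> Pow K" "wsign I (K - I) * \<alpha> I * \<beta> (K - I) \<noteq> 0"
    unfolding wedge_def by (rule sum.not_neutral_contains_not_neutral)
  ultimately show thesis using that by auto
qed

lemma homog_wedge: "homog d \<alpha> \<Longrightarrow> homog e \<beta> \<Longrightarrow> homog (d + e) (wedge \<alpha> \<beta>)"
  unfolding homog_def
proof (intro allI impI)
  fix K
  assume \<alpha>: "\<forall>K. \<alpha> K \<noteq> 0 \<longrightarrow> finite K \<and> card K = d"
    and \<beta>: "\<forall>K. \<beta> K \<noteq> 0 \<longrightarrow> finite K \<and> card K = e" and "wedge \<alpha> \<beta> K \<noteq> 0"
  then obtain I where I: "finite K" "I \<subseteq> K" "card I = d" "card (K - I) = e"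
    by (metis wedge_nonzeroD)
  then have "card K = card I + card (K - I)"
    by (metis card_Diff_subset card_mono finite_subset le_add_diff_inverse)
  with I show "finite K \<and> card K = d + e" by simp
qed

lemma homog_sum: "(\<And>x. x \<in> S \<Longrightarrow> homog d (f x)) \<Longrightarrow> homog d (\<lambda>K. \<Sum>x\<in>S. f x K)"
  unfolding homog_def by (intro allI impI, erule sum.not_neutral_contains_not_neutral) blast

lemma homog_scale: "homog d \<alpha> \<Longrightarrow> homog d (\<lambda>K. c * \<alpha> K)"
  unfolding homog_def by auto

lemma homog_covec: "homog 1 (covec a)"
  by (auto simp: homog_def covec_def split: if_splits)

lemma homog_fconst: "homog 0 (fconst c)"
  by (auto simp: homog_def fconst_def split: if_splits)

lemma homog_form11: "homog 2 (form11 N c)"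
proof -
  have "homog 2 (wedge (covec a) (covec b))" for a b
    using homog_wedge[OF homog_covec homog_covec] by (simp add: numeral_2_eq_2)
  then show ?thesis
    unfolding form11_def dw_covec dwbar_covec by (intro homog_sum homog_scale)
qed

lemma homog_fpow: "homog 2 \<omega> \<Longrightarrow> homog (2 * k) (fpow \<omega> k)"
proof (induction k)
  case (Suc k)
  have "homog (2 + 2 * k) (wedge \<omega> (fpow \<omega> k))" by (rule homog_wedge[OF Suc.prems Suc.IH[OF Suc.prems]])
  then show ?case by simp
qed (simp add: homog_fconst)

lemma form11_even_card: "form11 N c K \<noteq> 0 \<Longrightarrow> even (card K)"
  using homog_form11[of N c] by (auto simp: homog_def)

text \<open>Used for powers of the pulled-back Kaehler form: they contain no base covectors, so
  contractions in base directions annihilate them.\<close>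

lemma fpow_form11_support: "fpow (form11 N c) k K \<noteq> 0 \<Longrightarrow> K \<subseteq> {..<2 * N}"
proof (induction k arbitrary: K)
  case (Suc k)
  then obtain I where I: "I \<subseteq> K" "form11 N c I \<noteq> 0" "fpow (form11 N c) k (K - I) \<noteq> 0"
    by (auto elim: wedge_nonzeroD)
  then obtain A B where AB: "A < N" "B < N" "wedge (dw A) (dwbar B) I \<noteq> 0"
    unfolding form11_def by (metis (no_types, lifting) lessThan_iff mult_eq_0_iff sum.neutral)
  from AB(3) have "I = {2 * A, 2 * B + 1}"
    by (elim wedge_nonzeroD) (auto simp: dw_def dwbar_def split: if_splits)
  with AB have "I \<subseteq> {..<2 * N}" by auto
  with Suc.IH[OF I(3)] show ?case by auto
qed (auto simp: fconst_def split: if_splits)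

lemma wedge_fconst_left: "finite K \<Longrightarrow> wedge (fconst c) \<beta> K = c * \<beta> K"
proof -
  assume "finite K"
  then have "wedge (fconst c) \<beta> K = (\<Sum>I\<in>{{}}. wsign I (K - I) * fconst c I * \<beta> (K - I))"
    unfolding wedge_def by (intro sum.mono_neutral_right) (auto simp: fconst_def)
  then show ?thesis by (simp add: fconst_def)
qed

lemma wedge_fconst_right: "finite K \<Longrightarrow> wedge \<alpha> (fconst c) K = c * \<alpha> K"
proof -
  assume "finite K"
  then have "wedge \<alpha> (fconst c) K = (\<Sum>I\<in>{K}. wsign I (K - I) * \<alpha> I * fconst c (K - I))"
    unfolding wedge_def by (intro sum.mono_neutral_right) (auto simp: fconst_def)
  then show ?thesis by (simp add: fconst_def)
qed

lemma covec_wedge: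
  assumes "finite K"
  shows "wedge (covec b) \<eta> K = (if b \<in> K then wsign {b} (K - {b}) * \<eta> (K - {b}) else 0)"
proof -
  have "wedge (covec b) \<eta> K = (\<Sum>I\<in>Pow K \<inter> {{b}}. wsign I (K - I) * covec b I * \<eta> (K - I))"
    unfolding wedge_def using assms by (intro sum.mono_neutral_right) (auto simp: covec_def)
  also have "Pow K \<inter> {{b}} = (if b \<in> K then {{b}} else {})" by auto
  finally show ?thesis by (simp add: covec_def)
qed

lemma covec_wedge_covec:
  "wedge (covec a) (covec b) K = (if K = {a, b} \<and> a \<noteq> b then if b < a then -1 else 1 else 0)"
proof (cases "finite K")
  case True
  have "K - {a} = {b} \<and> a \<in> K \<longleftrightarrow> K = {a, b} \<and> a \<noteq> b" by auto
  moreover have "wedge (covec a) (covec b) K = (if K - {a} = {b} \<and> a \<in> K then wsign {a} {b} else 0)"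
    unfolding covec_wedge[OF True] covec_def[of b] by simp
  ultimately show ?thesis by (simp only: wsign_sing)
qed (auto simp: wedge_infinite)

lemma contr_sum: "contr a (\<lambda>K. \<Sum>x\<in>S. f x K) = (\<lambda>M. \<Sum>x\<in>S. contr a (f x) M)"
  by (auto simp: contr_def sum_distrib_left)

lemma contr_scale: "contr a (\<lambda>K. c * \<alpha> K) = (\<lambda>M. c * contr a \<alpha> M)"
  by (auto simp: contr_def)

lemma contr_covec: "contr a (covec b) = fconst (if a = b then 1 else 0)"
proof
  fix M
  have "a \<notin> M \<and> insert a M = {b} \<longleftrightarrow> a = b \<and> M = {}" by auto
  then show "contr a (covec b) M = fconst (if a = b then 1 else 0) M"
    by (auto simp: contr_def covec_def fconst_def)
qed

lemma contr_fconst: "contr a (fconst c) = (\<lambda>M. 0)"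
  by (auto simp: contr_def fconst_def)

lemma grade_inv_covec: "grade_inv (covec b) = (\<lambda>K. (-1) * covec b K)"
  by (auto simp: grade_inv_def covec_def)

lemma contr_covec_wedge_covec:
  "contr a (wedge (covec x) (covec y)) M =
    (if a = x then covec y M else 0) - (if a = y then covec x M else 0)"
proof (cases "finite M")
  case True
  then show ?thesis
    by (auto simp: contr_wedge contr_covec grade_inv_covec wedge_scale_left wedge_fconst_left wedge_fconst_right
             simp del: mult_minus1)
next
  case False
  then show ?thesis by (auto simp: contr_def wedge_infinite covec_def)
qed

lemma contr_form11: "contr a (form11 N c) = (\<lambda>M. \<Sum>A<N. \<Sum>B<N. c A B *
    ((if a = 2 * A then covec (2 * B + 1) M else 0) - (if a = 2 * B + 1 then covec (2 * A) M else 0)))"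
  unfolding form11_def dw_covec dwbar_covec contr_sum contr_scale contr_covec_wedge_covec ..

lemma contr_form11_even:
  assumes "A < N"
  shows "contr (2 * A) (form11 N c) = (\<lambda>M. \<Sum>B<N. c A B * covec (2 * B + 1) M)"
proof -
  have ne: "2 * A \<noteq> 2 * B + 1" for B :: nat by presburger
  have "contr (2 * A) (form11 N c) =
      (\<lambda>M. \<Sum>A'<N. if A' = A then \<Sum>B<N. c A B * covec (2 * B + 1) M else 0)"
    unfolding contr_form11 by (intro ext sum.cong refl) (use ne in auto)
  then show ?thesis using assms by simp
qed

lemma contr_form11_odd:
  assumes "B < N"
  shows "contr (2 * B + 1) (form11 N c) = (\<lambda>M. \<Sum>A<N. - c A B * covec (2 * A) M)"
proof -
  have ne: "2 * B + 1 \<noteq> 2 * A" for A :: nat by presburger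
  have "contr (2 * B + 1) (form11 N c) =
      (\<lambda>M. \<Sum>A<N. \<Sum>B'<N. if B' = B then - c A B * covec (2 * A) M else 0)"
    unfolding contr_form11 by (intro ext sum.cong refl) (use ne in auto)
  then show ?thesis using assms by simp
qed

lemma grade_inv_form11: "grade_inv (form11 N c) = form11 N c"
proof
  show "grade_inv (form11 N c) K = form11 N c K" for K
    using form11_even_card[of N c K] by (cases "form11 N c K = 0") (auto simp: grade_inv_def)
qed

text \<open>On forms of even degree contraction is a derivation, and even forms commute, so this is
  the power rule. Its factor is the source of the \<open>of_nat n\<close> in the statements that
  follow.\<close>

lemma contr_fpow:
  "contr a (fpow (form11 N c) (Suc k)) =
    (\<lambda>M. of_nat (Suc k) * wedge (contr a (form11 N c)) (fpow (form11 N c) k) M)"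
proof (induction k)
  case 0
  show ?case
    by (rule ext) (simp add: contr_wedge contr_fconst wedge_zero_right)
next
  case (Suc k)
  let ?w = "form11 N c"
  have "wedge ?w (wedge (contr a ?w) (fpow ?w k)) = wedge (contr a ?w) (fpow ?w (Suc k))"
    by (simp add: wedge_even_commute[of ?w "contr a ?w"] form11_even_card flip: wedge_assoc)
  then have "wedge ?w (contr a (fpow ?w (Suc k))) M =
      of_nat (Suc k) * wedge (contr a ?w) (fpow ?w (Suc k)) M" for M
    unfolding Suc.IH wedge_scale_right by simp
  then show ?case
    by (subst fpow.simps(2), intro ext)
       (simp only: contr_wedge grade_inv_form11 of_nat_Suc[of "Suc k"] distrib_right mult_1_left)
qed

text \<open>
  Wedging with \<open>covec b\<close> and then reading off the top coefficient undoes the contraction with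
  \<open>a = b\<close>, while a form contracted with \<open>a \<noteq> b\<close> has no monomial that misses \<open>b\<close> only.
\<close>

lemma covec_wedge_contr_fpow:
  fixes n :: nat and c :: "nat \<Rightarrow> nat \<Rightarrow> complex"
  assumes "a < 2 * n"
  defines "\<omega> \<equiv> form11 n c"
  shows "of_nat n * wedge (covec b) (wedge (contr a \<omega>) (fpow \<omega> (n - 1))) {..<2 * n} =
    (if a = b then fpow \<omega> n {..<2 * n} else 0)"
proof -
  obtain m where n: "n = Suc m" using assms(1) by (cases n) auto
  let ?T = "{..<2 * n}"
  have "of_nat n * wedge (covec b) (wedge (contr a \<omega>) (fpow \<omega> m)) ?T =
      wedge (covec b) (contr a (fpow \<omega> n)) ?T"
    unfolding n \<omega>_def contr_fpow wedge_scale_right ..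
  also have "\<dots> = (if a = b then fpow \<omega> n ?T else 0)"
    using assms(1) by (auto simp: covec_wedge contr_def insert_absorb simp del: fpow.simps)
  finally show ?thesis by (simp add: n)
qed


section \<open>Coefficients of (1,1)-forms and double contractions in base directions\<close>

lemma wedge_linear_left:
  "wedge (\<lambda>K. \<Sum>x\<in>S. f x K) \<beta> = (\<lambda>K. \<Sum>x\<in>S. wedge (f x) \<beta> K)"
  "wedge (\<lambda>K. c * \<alpha> K) \<beta> = (\<lambda>K. c * wedge \<alpha> \<beta> K)"
  by (rule ext, rule wedge_sum_left wedge_scale_left)+

lemma wedge_linear_right:
  "wedge \<alpha> (\<lambda>K. \<Sum>x\<in>S. f x K) = (\<lambda>K. \<Sum>x\<in>S. wedge \<alpha> (f x) K)"
  "wedge \<alpha> (\<lambda>K. c * \<beta> K) = (\<lambda>K. c * wedge \<alpha> \<beta> K)"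
  by (rule ext, rule wedge_sum_right wedge_scale_right)+

lemma homog_contr: "homog (Suc d) \<alpha> \<Longrightarrow> homog d (contr a \<alpha>)"
  unfolding homog_def
proof (intro allI impI)
  fix K
  assume \<alpha>: "\<forall>K. \<alpha> K \<noteq> 0 \<longrightarrow> finite K \<and> card K = Suc d" and "contr a \<alpha> K \<noteq> 0"
  then have "a \<notin> K" "\<alpha> (insert a K) \<noteq> 0" by (auto simp: contr_def split: if_splits)
  from \<alpha>[rule_format, OF this(2)] have "finite (insert a K)" "card (insert a K) = Suc d" by auto
  with \<open>a \<notin> K\<close> show "finite K \<and> card K = d" by simp
qed

lemma grade_inv_contr_form11: "grade_inv (contr a (form11 N c)) = (\<lambda>K. (-1) * contr a (form11 N c) K)"
proof
  have "homog (Suc 1) (form11 N c)" using homog_form11 by (simp add: numeral_2_eq_2)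
  then have "homog 1 (contr a (form11 N c))" by (rule homog_contr)
  then show "grade_inv (contr a (form11 N c)) K = (-1) * contr a (form11 N c) K" for K
    unfolding homog_def grade_inv_def by (cases "contr a (form11 N c) K = 0") auto
qed

lemma form11_covec: "form11 N c = (\<lambda>K. \<Sum>A<N. \<Sum>B<N. c A B * wedge (covec (2 * A)) (covec (2 * B + 1)) K)"
  unfolding form11_def dw_covec dwbar_covec ..

text \<open>The monomial of a set is the increasing product, whereas \<open>form11\<close> writes
  the holomorphic covector first; hence the sign when 2 l + 1 < 2 i.\<close>

lemma form11_at:
  assumes "i < N" "l < N"
  shows "form11 N c {2 * i, 2 * l + 1} = (if l < i then - c i l else c i l)"
proof -
  have eq: "{2 * i, 2 * l + 1} = {2 * A, 2 * B + 1} \<longleftrightarrow> A = i \<and> B = l" for A B :: nat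
    by (auto simp: doubleton_eq_iff; presburger)
  have "form11 N c {2 * i, 2 * l + 1} =
      (\<Sum>A<N. \<Sum>B<N. if B = l then if A = i then if l < i then - c i l else c i l else 0 else 0)"
    unfolding form11_covec covec_wedge_covec eq by (intro sum.cong refl) auto
  then show ?thesis using assms by simp
qed

lemma form11_at_zero:
  assumes "\<And>i l. i < N \<Longrightarrow> l < N \<Longrightarrow> K \<noteq> {2 * i, 2 * l + 1}"
  shows "form11 N c K = 0"
  unfolding form11_covec covec_wedge_covec using assms by (intro sum.neutral ballI) auto

text \<open>Both orders occur, as the vector with the smaller number will be contracted
  first.\<close>

lemma contr_contr_form11:
  assumes "i < N" "l < N"
  shows "contr (2 * l + 1) (contr (2 * i) (form11 N c)) = fconst (c i l)"
    and "contr (2 * i) (contr (2 * l + 1) (form11 N c)) = fconst (- c i l)"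
proof -
  have "contr (2 * l + 1) (contr (2 * i) (form11 N c)) =
      (\<lambda>M. \<Sum>B<N. if B = l then fconst (c i l) M else 0)"
    unfolding contr_form11_even[OF assms(1)] contr_sum contr_scale contr_covec
    by (intro ext sum.cong refl) (auto simp: fconst_def)
  then show "contr (2 * l + 1) (contr (2 * i) (form11 N c)) = fconst (c i l)"
    using assms by simp
  have "contr (2 * i) (contr (2 * l + 1) (form11 N c)) =
      (\<lambda>M. \<Sum>A<N. if A = i then fconst (- c i l) M else 0)"
    unfolding contr_form11_odd[OF assms(2)] contr_sum contr_scale contr_covec
    by (intro ext sum.cong refl) (auto simp: fconst_def)
  then show "contr (2 * i) (contr (2 * l + 1) (form11 N c)) = fconst (- c i l)"
    using assms by simp
qed

lemma contr_contr_form11_zero: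
  assumes "i < N" "l < N"
  shows "contr (2 * l) (contr (2 * i) (form11 N c)) = fconst 0"
    and "contr (2 * l + 1) (contr (2 * i + 1) (form11 N c)) = fconst 0"
proof -
  have ne: "2 * j \<noteq> Suc (2 * k)" "Suc (2 * k) \<noteq> 2 * j" for j k :: nat by presburger+
  show "contr (2 * l) (contr (2 * i) (form11 N c)) = fconst 0"
    unfolding contr_form11_even[OF assms(1)] contr_sum contr_scale contr_covec
    by (rule ext) (simp add: fconst_def ne)
  show "contr (2 * l + 1) (contr (2 * i + 1) (form11 N c)) = fconst 0"
    unfolding contr_form11_odd[OF assms(1)] contr_sum contr_scale contr_covec
    by (rule ext) (simp add: fconst_def ne)
qed

lemma wsign_initial_segment: "m \<le> y \<Longrightarrow> wsign {y} {..<m} = (-1) ^ m"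
proof -
  assume "m \<le> y"
  then have "{(i, j). i \<in> {y} \<and> j \<in> {..<m} \<and> j < i} = {y} \<times> {..<m}" by auto
  then show ?thesis by (simp add: wsign_def card_cartesian_product)
qed

text \<open>Turns a coefficient at the fiber block plus two base covectors into the coefficient of a
  contracted form at the fiber block alone. The block has even size, so moving past it costs no
  sign.\<close>

lemma contr_contr_at:
  fixes m x y :: nat
  assumes "even m" "m \<le> x" "x < y"
  shows "contr y (contr x \<eta>) {..<m} = \<eta> (insert x (insert y {..<m}))"
proof -
  have "wsign {x} (insert y {..<m}) = 1"
    using assms by (subst wsign_insert_right) (auto simp: wsign_sing wsign_initial_segment)
  then show ?thesis using assms by (simp add: contr_def wsign_initial_segment)
qed

text \<open>\<open>W\<close> has no covectors from \<open>m\<close> on, so both contractions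
  annihilate it and are distributed over \<open>\<Omega>\<close> and \<open>\<Omega>'\<close> by the
  antiderivation rule. The minus sign comes from moving the second contraction past the one-form
  \<open>contr x \<Omega>\<close>.\<close>

lemma contr_contr_wedge:
  fixes W :: form and M :: nat and c c' :: "nat \<Rightarrow> nat \<Rightarrow> complex"
  assumes W: "\<And>K. W K \<noteq> 0 \<Longrightarrow> K \<subseteq> {..<m}" and x: "m \<le> x" and y: "m \<le> y"
  defines "\<Omega> \<equiv> form11 M c" and "\<Omega>' \<equiv> form11 M c'"
  shows "contr y (contr x (wedge (wedge \<Omega> \<Omega>') W)) T =
    wedge (contr y (contr x \<Omega>)) (wedge \<Omega>' W) T - wedge (contr x \<Omega>) (wedge (contr y \<Omega>') W) T
    + wedge (contr y \<Omega>) (wedge (contr x \<Omega>') W) T + wedge \<Omega> (wedge (contr y (contr x \<Omega>')) W) T"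
proof -
  have W0: "contr a W = (\<lambda>M. 0)" if "m \<le> a" for a
    using W[of "insert a K" for K] that by (auto simp: contr_def fun_eq_iff)
  have g: "grade_inv \<Omega> = \<Omega>" "grade_inv \<Omega>' = \<Omega>'"
    "grade_inv (contr x \<Omega>) = (\<lambda>K. (-1) * contr x \<Omega> K)" "grade_inv (contr x \<Omega>') = (\<lambda>K. (-1) * contr x \<Omega>' K)"
    unfolding \<Omega>_def \<Omega>'_def by (rule grade_inv_form11 grade_inv_contr_form11)+
  have c1: "contr a (wedge \<Omega>' W) = wedge (contr a \<Omega>') W" if "m \<le> a" for a
    by (rule ext) (simp add: contr_wedge g W0[OF that] wedge_zero_right)
  have c2: "contr y (wedge (contr x \<Omega>') W) = wedge (contr y (contr x \<Omega>')) W"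
    by (rule ext) (simp add: contr_wedge W0[OF y] wedge_zero_right)
  have "contr x (wedge (wedge \<Omega> \<Omega>') W) = (\<lambda>T. wedge (contr x \<Omega>) (wedge \<Omega>' W) T + wedge \<Omega> (wedge (contr x \<Omega>') W) T)"
    by (rule ext) (simp only: wedge_assoc contr_wedge[of x \<Omega>] c1[OF x] g)
  moreover have "contr y (\<lambda>T. \<alpha> T + \<beta> T) T = contr y \<alpha> T + contr y \<beta> T" for \<alpha> \<beta>
    by (simp add: contr_def algebra_simps)
  ultimately show ?thesis
    by (simp add: contr_wedge[of y "contr x \<Omega>"] contr_wedge[of y \<Omega> "wedge (contr x \<Omega>') W"]
        c1[OF y] c2 g wedge_scale_left[of "-1", simplified])
qed

section \<open>Wedge products with powers of the Kaehler form\<close>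

context
  fixes n :: nat and g G :: "nat \<Rightarrow> nat \<Rightarrow> complex" and \<omega> :: form and V :: complex and L :: "nat \<Rightarrow> nat \<Rightarrow> complex"
  assumes n: "1 \<le> n"
    and Gg: "\<And>\<beta> \<beta>'. \<beta> < n \<Longrightarrow> \<beta>' < n \<Longrightarrow> (\<Sum>\<alpha><n. G \<beta> \<alpha> * g \<alpha> \<beta>') = (if \<beta> = \<beta>' then 1 else 0)"
    and gG: "\<And>\<alpha> \<alpha>'. \<alpha> < n \<Longrightarrow> \<alpha>' < n \<Longrightarrow> (\<Sum>\<beta><n. g \<alpha> \<beta> * G \<beta> \<alpha>') = (if \<alpha> = \<alpha>' then 1 else 0)"
  defines "\<omega> \<equiv> form11 n (\<lambda>\<alpha> \<beta>. \<i> * g \<alpha> \<beta>)" and "V \<equiv> fpow \<omega> n {..<2 * n}"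
    and "L \<equiv> \<lambda>b b'. wedge (covec b) (wedge (covec b') (fpow \<omega> (n - 1))) {..<2 * n}"
begin

text \<open>\<open>L b b'\<close> is the top coefficient of two covectors wedged with omega^(n-1).
  Contracting omega^n with the holomorphic vectors gives a linear system with matrix i g for the
  numbers \<open>L b (2 * B + 1)\<close>, which is solved by applying
  \<open>- \<i> * G\<close>.\<close>

lemma L_odd:
  assumes \<beta>: "\<beta> < n"
  shows "of_nat n * L b (2 * \<beta> + 1) = (\<Sum>\<alpha><n. if b = 2 * \<alpha> then - \<i> * G \<beta> \<alpha> * V else 0)"
proof -
  have eq: "of_nat n * (\<Sum>B<n. \<i> * g \<alpha> B * L b (2 * B + 1)) = (if b = 2 * \<alpha> then V else 0)"
    if "\<alpha> < n" for \<alpha>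
  proof -
    have "wedge (covec b) (wedge (contr (2 * \<alpha>) \<omega>) (fpow \<omega> (n - 1))) {..<2 * n} =
        (\<Sum>B<n. \<i> * g \<alpha> B * L b (2 * B + 1))"
      unfolding L_def \<omega>_def contr_form11_even[OF that]
      by (simp only: wedge_linear_left wedge_linear_right)
    then show ?thesis
      using covec_wedge_contr_fpow[of "2 * \<alpha>" n b "\<lambda>\<alpha> \<beta>. \<i> * g \<alpha> \<beta>"] that
      unfolding V_def \<omega>_def by auto
  qed
  have "(\<Sum>B<n. (\<Sum>\<alpha><n. G \<beta> \<alpha> * g \<alpha> B) * (of_nat n * L b (2 * B + 1))) =
      (\<Sum>B<n. if \<beta> = B then of_nat n * L b (2 * B + 1) else 0)"
    using \<beta> by (intro sum.cong refl) (simp add: Gg)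
  then have "of_nat n * L b (2 * \<beta> + 1) =
      (\<Sum>B<n. (\<Sum>\<alpha><n. G \<beta> \<alpha> * g \<alpha> B) * (of_nat n * L b (2 * B + 1)))"
    using \<beta> by simp
  also have "\<dots> = (\<Sum>\<alpha><n. \<Sum>B<n. G \<beta> \<alpha> * g \<alpha> B * (of_nat n * L b (2 * B + 1)))"
    unfolding sum_distrib_right by (rule sum.swap)
  also have "\<dots> = (\<Sum>\<alpha><n. - \<i> * G \<beta> \<alpha> * (of_nat n * (\<Sum>B<n. \<i> * g \<alpha> B * L b (2 * B + 1))))"
    unfolding sum_distrib_left by (intro sum.cong refl) (simp add: mult_ac)
  also have "\<dots> = (\<Sum>\<alpha><n. if b = 2 * \<alpha> then - \<i> * G \<beta> \<alpha> * V else 0)"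
    by (intro sum.cong refl) (subst eq, auto)
  finally show ?thesis .
qed

text \<open>The same with the conjugate vectors: their contractions with omega carry the transposed
  coefficients and a minus sign, so \<open>G\<close> is used as inverse from the other side and
  \<open>\<i>\<close> replaces \<open>- \<i>\<close>.\<close>

lemma L_even:
  assumes \<alpha>: "\<alpha> < n"
  shows "of_nat n * L b (2 * \<alpha>) = (\<Sum>\<beta><n. if b = 2 * \<beta> + 1 then \<i> * G \<beta> \<alpha> * V else 0)"
proof -
  have eq: "of_nat n * (\<Sum>A<n. - (\<i> * g A \<beta>) * L b (2 * A)) = (if b = 2 * \<beta> + 1 then V else 0)"
    if "\<beta> < n" for \<beta>
  proof -
    have "wedge (covec b) (wedge (contr (2 * \<beta> + 1) \<omega>) (fpow \<omega> (n - 1))) {..<2 * n} =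
        (\<Sum>A<n. - (\<i> * g A \<beta>) * L b (2 * A))"
      unfolding L_def \<omega>_def contr_form11_odd[OF that]
      by (simp only: wedge_linear_left wedge_linear_right)
    then show ?thesis
      using covec_wedge_contr_fpow[of "2 * \<beta> + 1" n b "\<lambda>\<alpha> \<beta>. \<i> * g \<alpha> \<beta>"] that
      unfolding V_def \<omega>_def by auto
  qed
  have "(\<Sum>A<n. (\<Sum>\<beta><n. g A \<beta> * G \<beta> \<alpha>) * (of_nat n * L b (2 * A))) =
      (\<Sum>A<n. if A = \<alpha> then of_nat n * L b (2 * A) else 0)"
    using \<alpha> by (intro sum.cong refl) (simp add: gG)
  then have "of_nat n * L b (2 * \<alpha>) =
      (\<Sum>A<n. (\<Sum>\<beta><n. g A \<beta> * G \<beta> \<alpha>) * (of_nat n * L b (2 * A)))"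
    using \<alpha> by simp
  also have "\<dots> = (\<Sum>\<beta><n. \<Sum>A<n. g A \<beta> * G \<beta> \<alpha> * (of_nat n * L b (2 * A)))"
    unfolding sum_distrib_right by (rule sum.swap)
  also have "\<dots> = (\<Sum>\<beta><n. \<i> * G \<beta> \<alpha> * (of_nat n * (\<Sum>A<n. - (\<i> * g A \<beta>) * L b (2 * A))))"
    unfolding sum_distrib_left by (intro sum.cong refl) (simp add: mult_ac)
  also have "\<dots> = (\<Sum>\<beta><n. if b = 2 * \<beta> + 1 then \<i> * G \<beta> \<alpha> * V else 0)"
    by (intro sum.cong refl) (subst eq, auto)
  finally show ?thesis .
qed

lemma L_outside: "2 * n \<le> b' \<Longrightarrow> L b b' = 0"
  unfolding L_def by (simp add: covec_wedge)

text \<open>A base covector cannot be part of the fiber block, so of the \<open>M\<close>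
  coordinates of the product only the fiber indices below \<open>n\<close> survive.\<close>

lemma sum_L_odd:
  assumes "n \<le> M"
  shows "of_nat n * (\<Sum>B<M. f B * L b (2 * B + 1)) = (\<Sum>\<beta><n. \<Sum>\<alpha><n. if b = 2 * \<alpha> then - \<i> * V * (G \<beta> \<alpha> * f \<beta>) else 0)"
proof -
  have "(\<Sum>B<M. f B * L b (2 * B + 1)) = (\<Sum>B<n. f B * L b (2 * B + 1))"
    using assms by (intro sum.mono_neutral_right) (auto simp: L_outside)
  also have "of_nat n * \<dots> = (\<Sum>B<n. f B * (of_nat n * L b (2 * B + 1)))"
    by (simp add: sum_distrib_left mult_ac)
  also have "\<dots> = (\<Sum>\<beta><n. \<Sum>\<alpha><n. if b = 2 * \<alpha> then - \<i> * V * (G \<beta> \<alpha> * f \<beta>) else 0)"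
    by (intro sum.cong refl, subst L_odd) (auto simp: sum_distrib_left mult_ac intro!: sum.cong)
  finally show ?thesis .
qed

lemma sum_L_even:
  assumes "n \<le> M"
  shows "of_nat n * (\<Sum>A<M. f A * L b (2 * A)) = (\<Sum>\<alpha><n. \<Sum>\<beta><n. if b = 2 * \<beta> + 1 then \<i> * V * (G \<beta> \<alpha> * f \<alpha>) else 0)"
proof -
  have "(\<Sum>A<M. f A * L b (2 * A)) = (\<Sum>A<n. f A * L b (2 * A))"
    using assms by (intro sum.mono_neutral_right) (auto simp: L_outside)
  also have "of_nat n * \<dots> = (\<Sum>A<n. f A * (of_nat n * L b (2 * A)))"
    by (simp add: sum_distrib_left mult_ac)
  also have "\<dots> = (\<Sum>\<alpha><n. \<Sum>\<beta><n. if b = 2 * \<beta> + 1 then \<i> * V * (G \<beta> \<alpha> * f \<alpha>) else 0)"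
    by (intro sum.cong refl, subst L_even) (auto simp: sum_distrib_left mult_ac intro!: sum.cong)
  finally show ?thesis .
qed

text \<open>Two covectors wedged with omega^(n-1) reach the top degree only if one is holomorphic
  and the other antiholomorphic: the mixed parities yield contractions with \<open>G\<close>, of
  opposite signs, and the pure ones vanish.\<close>

lemma sum_sum_L:
  assumes "n \<le> M"
  shows "of_nat n * (\<Sum>A<M. \<Sum>B<M. h A B * L (2 * A) (2 * B + 1)) = - \<i> * V * (\<Sum>\<alpha><n. \<Sum>\<beta><n. G \<beta> \<alpha> * h \<alpha> \<beta>)"
    and "of_nat n * (\<Sum>B<M. \<Sum>A<M. h A B * L (2 * B + 1) (2 * A)) = \<i> * V * (\<Sum>\<alpha><n. \<Sum>\<beta><n. G \<beta> \<alpha> * h \<alpha> \<beta>)"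
    and "of_nat n * (\<Sum>A<M. \<Sum>B<M. h A B * L (2 * A) (2 * B)) = 0"
    and "of_nat n * (\<Sum>A<M. \<Sum>B<M. h A B * L (2 * A + 1) (2 * B + 1)) = 0"
proof -
  have sub: "{..<n} \<subseteq> {..<M}" using assms by auto
  have eq: "2 * A = 2 * B \<longleftrightarrow> B = A" "2 * A + 1 = 2 * B + 1 \<longleftrightarrow> B = A" for A B :: nat by auto
  have ne: "2 * j \<noteq> Suc (2 * k)" "Suc (2 * k) \<noteq> 2 * j" for j k :: nat by presburger+
  have ext: "(\<Sum>A<M. \<Sum>x<n. \<Sum>y<n. if y = A then F x y else 0) = (\<Sum>y<n. \<Sum>x<n. F x y)"
    for F :: "nat \<Rightarrow> nat \<Rightarrow> complex"
  proof -
    have "(\<Sum>A<M. \<Sum>x<n. \<Sum>y<n. if y = A then F x y else 0) = (\<Sum>x<n. \<Sum>y<n. \<Sum>A<M. if y = A then F x y else 0)"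
      by (subst sum.swap) (intro sum.cong refl sum.swap)
    also have "\<dots> = (\<Sum>x<n. \<Sum>y<n. F x y)"
      using assms by (intro sum.cong refl) auto
    finally show ?thesis by (subst sum.swap)
  qed
  show "of_nat n * (\<Sum>A<M. \<Sum>B<M. h A B * L (2 * A) (2 * B + 1)) = - \<i> * V * (\<Sum>\<alpha><n. \<Sum>\<beta><n. G \<beta> \<alpha> * h \<alpha> \<beta>)"
  proof -
    have "of_nat n * (\<Sum>A<M. \<Sum>B<M. h A B * L (2 * A) (2 * B + 1)) =
        (\<Sum>A<M. \<Sum>\<beta><n. \<Sum>\<alpha><n. if \<alpha> = A then - \<i> * V * (G \<beta> \<alpha> * h \<alpha> \<beta>) else 0)"
      by (subst sum_distrib_left, intro sum.cong refl, subst sum_L_odd[OF assms], intro sum.cong refl) (auto simp: eq)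
    then show ?thesis unfolding ext by (simp add: sum_distrib_left)
  qed
  show "of_nat n * (\<Sum>B<M. \<Sum>A<M. h A B * L (2 * B + 1) (2 * A)) = \<i> * V * (\<Sum>\<alpha><n. \<Sum>\<beta><n. G \<beta> \<alpha> * h \<alpha> \<beta>)"
  proof -
    have "of_nat n * (\<Sum>B<M. \<Sum>A<M. h A B * L (2 * B + 1) (2 * A)) =
        (\<Sum>B<M. \<Sum>\<alpha><n. \<Sum>\<beta><n. if \<beta> = B then \<i> * V * (G \<beta> \<alpha> * h \<alpha> \<beta>) else 0)"
      by (subst sum_distrib_left, intro sum.cong refl, subst sum_L_even[OF assms], intro sum.cong refl) (auto simp: eq)
    then show ?thesis unfolding ext by (subst sum.swap) (simp add: sum_distrib_left)
  qed
  show "of_nat n * (\<Sum>A<M. \<Sum>B<M. h A B * L (2 * A) (2 * B)) = 0"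
    by (subst sum_distrib_left, subst sum_L_even[OF assms]) (simp add: ne)
  show "of_nat n * (\<Sum>A<M. \<Sum>B<M. h A B * L (2 * A + 1) (2 * B + 1)) = 0"
    by (subst sum_distrib_left, subst sum_L_odd[OF assms]) (simp add: ne)
qed

lemma wedge_form11_fpow:
  assumes "n \<le> M"
  shows "of_nat n * wedge (form11 M c) (fpow \<omega> (n - 1)) {..<2 * n} = - \<i> * V * (\<Sum>\<alpha><n. \<Sum>\<beta><n. G \<beta> \<alpha> * c \<alpha> \<beta>)"
  unfolding sum_sum_L(1)[OF assms, symmetric] form11_covec L_def
  by (simp only: wedge_linear_left wedge_assoc)

text \<open>Contracting a (1,1)-form with a base vector leaves a one-form whose components are the
  coefficients with that base index. The parities of the two contracted vectors decide which case of
  \<open>sum_sum_L\<close> applies.\<close>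

lemma wedge_contr_contr_fpow:
  assumes "n \<le> M" and "i < M" "l < M"
  shows "of_nat n * wedge (contr (2 * i) (form11 M c)) (wedge (contr (2 * l + 1) (form11 M c')) (fpow \<omega> (n - 1)))
      {..<2 * n} = - \<i> * V * (\<Sum>\<alpha><n. \<Sum>\<beta><n. G \<beta> \<alpha> * (c i \<beta> * c' \<alpha> l))"
    and "of_nat n * wedge (contr (2 * l + 1) (form11 M c)) (wedge (contr (2 * i) (form11 M c')) (fpow \<omega> (n - 1)))
      {..<2 * n} = \<i> * V * (\<Sum>\<alpha><n. \<Sum>\<beta><n. G \<beta> \<alpha> * (c \<alpha> l * c' i \<beta>))"
    and "of_nat n * wedge (contr (2 * i) (form11 M c)) (wedge (contr (2 * l) (form11 M c')) (fpow \<omega> (n - 1)))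
      {..<2 * n} = 0"
    and "of_nat n * wedge (contr (2 * i + 1) (form11 M c)) (wedge (contr (2 * l + 1) (form11 M c')) (fpow \<omega> (n - 1)))
      {..<2 * n} = 0"
proof -
  note lin = wedge_linear_left wedge_linear_right sum_distrib_left
  have "wedge (contr (2 * i) (form11 M c)) (wedge (contr (2 * l + 1) (form11 M c')) (fpow \<omega> (n - 1))) {..<2 * n}
      = (\<Sum>B<M. \<Sum>A<M. - (c i B * c' A l) * L (2 * B + 1) (2 * A))"
    unfolding contr_form11_even[OF assms(2)] contr_form11_odd[OF assms(3)] L_def lin
    by (intro sum.cong refl) simp
  then show "of_nat n * wedge (contr (2 * i) (form11 M c)) (wedge (contr (2 * l + 1) (form11 M c')) (fpow \<omega> (n - 1)))
      {..<2 * n} = - \<i> * V * (\<Sum>\<alpha><n. \<Sum>\<beta><n. G \<beta> \<alpha> * (c i \<beta> * c' \<alpha> l))"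
    by (simp only: sum_sum_L(2)[OF assms(1)]) (simp add: sum_negf)
  have "wedge (contr (2 * l + 1) (form11 M c)) (wedge (contr (2 * i) (form11 M c')) (fpow \<omega> (n - 1))) {..<2 * n}
      = (\<Sum>A<M. \<Sum>B<M. - (c A l * c' i B) * L (2 * A) (2 * B + 1))"
    unfolding contr_form11_even[OF assms(2)] contr_form11_odd[OF assms(3)] L_def lin
    by (intro sum.cong refl) simp
  then show "of_nat n * wedge (contr (2 * l + 1) (form11 M c)) (wedge (contr (2 * i) (form11 M c')) (fpow \<omega> (n - 1)))
      {..<2 * n} = \<i> * V * (\<Sum>\<alpha><n. \<Sum>\<beta><n. G \<beta> \<alpha> * (c \<alpha> l * c' i \<beta>))"
    by (simp only: sum_sum_L(1)[OF assms(1)]) (simp add: sum_negf)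
  have "wedge (contr (2 * i) (form11 M c)) (wedge (contr (2 * l) (form11 M c')) (fpow \<omega> (n - 1))) {..<2 * n}
      = (\<Sum>A<M. \<Sum>B<M. (c i A * c' l B) * L (2 * A + 1) (2 * B + 1))"
    unfolding contr_form11_even[OF assms(2)] contr_form11_even[OF assms(3)] L_def lin
    by (intro sum.cong refl) simp
  then show "of_nat n * wedge (contr (2 * i) (form11 M c)) (wedge (contr (2 * l) (form11 M c')) (fpow \<omega> (n - 1)))
      {..<2 * n} = 0"
    by (simp only: sum_sum_L(4)[OF assms(1)])
  have "wedge (contr (2 * i + 1) (form11 M c)) (wedge (contr (2 * l + 1) (form11 M c')) (fpow \<omega> (n - 1))) {..<2 * n}
      = (\<Sum>A<M. \<Sum>B<M. (c A i * c' B l) * L (2 * A) (2 * B))"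
    unfolding contr_form11_odd[OF assms(2)] contr_form11_odd[OF assms(3)] L_def lin
    by (intro sum.cong refl) simp
  then show "of_nat n * wedge (contr (2 * i + 1) (form11 M c)) (wedge (contr (2 * l + 1) (form11 M c')) (fpow \<omega> (n - 1)))
      {..<2 * n} = 0"
    by (simp only: sum_sum_L(3)[OF assms(1)])
qed

text \<open>The two base vectors are contracted either into different factors, which gives the
  products with one base index in each, or into the same factor, which leaves a scalar with both
  base indices times the trace of the other factor with respect to \<open>G\<close>.\<close>

lemma wedge_form11_form11_fpow:
  fixes N :: nat and c c' :: "nat \<Rightarrow> nat \<Rightarrow> complex"
  assumes "K \<subseteq> {..<2 * N}"
  defines "D \<equiv> \<lambda>i l. \<Sum>\<alpha><n. \<Sum>\<beta><n. G \<beta> \<alpha> * (c (n + i) \<beta> * c' \<alpha> (n + l) + c \<alpha> (n + l) * c' (n + i) \<beta>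
    - c (n + i) (n + l) * c' \<alpha> \<beta> - c \<alpha> \<beta> * c' (n + i) (n + l))"
  shows "of_nat n * wedge (wedge (form11 (n + N) c) (form11 (n + N) c')) (fpow \<omega> (n - 1))
      ({..<2 * n} \<union> (+) (2 * n) ` K) = \<i> * V * form11 N D K"
proof -
  let ?M = "n + N" and ?W = "fpow \<omega> (n - 1)" and ?T = "{..<2 * n}"
  let ?O = "form11 ?M c" and ?O' = "form11 ?M c'"
  let ?F = "wedge (wedge ?O ?O') ?W"
  have finK: "finite K" using assms(1) finite_subset by blast
  have hF: "homog (2 * n + 2) ?F"
  proof -
    have "homog (2 + 2 + 2 * (n - 1)) ?F"
      unfolding \<omega>_def by (intro homog_wedge homog_form11 homog_fpow)
    moreover have "2 + 2 + 2 * (n - 1) = 2 * n + 2" using n by simp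
    ultimately show ?thesis by (simp only:)
  qed
  have W: "?W I \<noteq> 0 \<Longrightarrow> I \<subseteq> ?T" for I
    unfolding \<omega>_def by (rule fpow_form11_support)
  have D: "D i l = (\<Sum>\<alpha><n. \<Sum>\<beta><n. G \<beta> \<alpha> * (c (n + i) \<beta> * c' \<alpha> (n + l)))
      + (\<Sum>\<alpha><n. \<Sum>\<beta><n. G \<beta> \<alpha> * (c \<alpha> (n + l) * c' (n + i) \<beta>))
      - c (n + i) (n + l) * (\<Sum>\<alpha><n. \<Sum>\<beta><n. G \<beta> \<alpha> * c' \<alpha> \<beta>)
      - c' (n + i) (n + l) * (\<Sum>\<alpha><n. \<Sum>\<beta><n. G \<beta> \<alpha> * c \<alpha> \<beta>)" for i l
    unfolding D_def by (simp add: sum_distrib_left sum_subtractf sum.distrib algebra_simps)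
  have pair: "of_nat n * ?F (insert x (insert y ?T)) =
      of_nat n * wedge (contr y (contr x ?O)) (wedge ?O' ?W) ?T
      - of_nat n * wedge (contr x ?O) (wedge (contr y ?O') ?W) ?T
      + of_nat n * wedge (contr y ?O) (wedge (contr x ?O') ?W) ?T
      + of_nat n * wedge ?O (wedge (contr y (contr x ?O')) ?W) ?T"
    if "2 * n \<le> x" "x < y" for x y
  proof -
    have "?F (insert x (insert y ?T)) = contr y (contr x ?F) ?T"
      using that by (subst contr_contr_at) auto
    also have "\<dots> = wedge (contr y (contr x ?O)) (wedge ?O' ?W) ?T
      - wedge (contr x ?O) (wedge (contr y ?O') ?W) ?T
      + wedge (contr y ?O) (wedge (contr x ?O') ?W) ?T
      + wedge ?O (wedge (contr y (contr x ?O')) ?W) ?T"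
      using that by (intro contr_contr_wedge[OF W]) auto
    finally show ?thesis by (simp only: ring_distribs)
  qed
  have const: "of_nat n * wedge (fconst b) (wedge ?O' ?W) ?T = - \<i> * V * (b * (\<Sum>\<alpha><n. \<Sum>\<beta><n. G \<beta> \<alpha> * c' \<alpha> \<beta>))"
    "of_nat n * wedge ?O (wedge (fconst b) ?W) ?T = - \<i> * V * (b * (\<Sum>\<alpha><n. \<Sum>\<beta><n. G \<beta> \<alpha> * c \<alpha> \<beta>))" for b
  proof -
    have "wedge (fconst b) (wedge ?O' ?W) ?T = b * wedge ?O' ?W ?T" by (simp add: wedge_fconst_left)
    then show "of_nat n * wedge (fconst b) (wedge ?O' ?W) ?T = - \<i> * V * (b * (\<Sum>\<alpha><n. \<Sum>\<beta><n. G \<beta> \<alpha> * c' \<alpha> \<beta>))"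
      using wedge_form11_fpow[of ?M c'] by (simp add: mult.left_commute[of _ b])
    have "wedge ?O (wedge (fconst b) ?W) ?T = wedge ?O (\<lambda>K. b * ?W K) ?T"
      by (intro wedge_cong) (simp_all add: wedge_fconst_left)
    then have "wedge ?O (wedge (fconst b) ?W) ?T = b * wedge ?O ?W ?T" by (simp only: wedge_scale_right)
    then show "of_nat n * wedge ?O (wedge (fconst b) ?W) ?T = - \<i> * V * (b * (\<Sum>\<alpha><n. \<Sum>\<beta><n. G \<beta> \<alpha> * c \<alpha> \<beta>))"
      using wedge_form11_fpow[of ?M c] by (simp add: mult.left_commute[of _ b])
  qed
  show ?thesis
  proof (cases "card K = 2")
    \<comment> \<open>Both sides vanish for reasons of degree: the product has degree 2 n + 2, and
      the fiber block takes up 2 n of it.\<close>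
    case False
    then have "form11 N D K = 0" using homog_form11[of N D] by (auto simp: homog_def)
    moreover have "?F (?T \<union> (+) (2 * n) ` K) = 0"
    proof (rule ccontr)
      assume "?F (?T \<union> (+) (2 * n) ` K) \<noteq> 0"
      then have "card (?T \<union> (+) (2 * n) ` K) = 2 * n + 2" using hF by (auto simp: homog_def)
      moreover have "card (?T \<union> (+) (2 * n) ` K) = card ?T + card ((+) (2 * n) ` K)"
        using finK by (intro card_Un_disjoint) auto
      moreover have "card ((+) (2 * n) ` K) = card K" by (intro card_image) auto
      ultimately show False using False by simp
    qed
    ultimately show ?thesis by simp
  next
    case True
    then obtain k1 k2 where K: "K = {k1, k2}" "k1 < k2"
      by (metis card_2_iff doubleton_eq_iff linorder_neqE_nat)
    have T: "?T \<union> (+) (2 * n) ` K = insert (2 * n + k1) (insert (2 * n + k2) ?T)" by (auto simp: K)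
    have ne: "2 * a \<noteq> Suc (2 * b)" "Suc (2 * b) \<noteq> 2 * a" for a b :: nat by presburger+
    note P = pair[of "2 * n + k1" "2 * n + k2", OF _ add_strict_left_mono[OF K(2)], simplified]
    \<comment> \<open>Even numbers are holomorphic covectors and odd ones antiholomorphic. The first
      two cases are type (1,1) in both orders; in the last two both sides vanish.\<close>
    consider i l where "k1 = 2 * i" "k2 = 2 * l + 1" | i l where "k1 = 2 * l + 1" "k2 = 2 * i"
      | i l where "k1 = 2 * i" "k2 = 2 * l" | i l where "k1 = 2 * i + 1" "k2 = 2 * l + 1"
      by (metis oddE evenE)
    then show ?thesis
    proof cases
      case 1
      then have il: "i < N" "l < N" "\<not> l < i" "n + i < ?M" "n + l < ?M" using K assms(1) by auto
      have xy: "2 * n + k1 = 2 * (n + i)" "2 * n + k2 = 2 * (n + l) + 1" using 1 by auto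
      have "form11 N D K = D i l" using il 1 K form11_at[of i N l D] by simp
      moreover have "of_nat n * ?F (?T \<union> (+) (2 * n) ` K) = \<i> * V * D i l"
        unfolding T xy
        by (subst pair) (use il K in \<open>simp_all only: contr_contr_form11[OF il(4,5)] const
            wedge_contr_contr_fpow[OF _ il(4,5)] le_add1 D\<close>, auto simp: algebra_simps 1)
      ultimately show ?thesis by simp
    next
      case 2
      then have il: "i < N" "l < N" "l < i" "n + i < ?M" "n + l < ?M" using K assms(1) by auto
      have xy: "2 * n + k1 = 2 * (n + l) + 1" "2 * n + k2 = 2 * (n + i)" using 2 by auto
      have "form11 N D K = - D i l" using il 2 K form11_at[of i N l D] by (simp add: insert_commute)
      moreover have "of_nat n * ?F (?T \<union> (+) (2 * n) ` K) = - (\<i> * V * D i l)"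
        unfolding T xy
        by (subst pair) (use il K in \<open>simp_all only: contr_contr_form11[OF il(4,5)] const
            wedge_contr_contr_fpow[OF _ il(4,5)] le_add1 D\<close>, auto simp: algebra_simps 2)
      ultimately show ?thesis by simp
    next
      case 3
      then have il: "i < N" "l < N" "i < l" "n + i < ?M" "n + l < ?M" using K assms(1) by auto
      have xy: "2 * n + k1 = 2 * (n + i)" "2 * n + k2 = 2 * (n + l)" using 3 by auto
      have "form11 N D K = 0" using 3 K ne by (intro form11_at_zero) (auto simp: doubleton_eq_iff)
      moreover have "of_nat n * ?F (?T \<union> (+) (2 * n) ` K) = 0"
        unfolding T xy
        by (subst pair) (use il K in \<open>simp_all only: contr_contr_form11_zero[OF il(4,5)] const
            wedge_contr_contr_fpow[OF _ il(4,5)] wedge_contr_contr_fpow[OF _ il(5,4)] le_add1\<close>, auto simp: 3)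
      ultimately show ?thesis by simp
    next
      case 4
      then have il: "i < N" "l < N" "i < l" "n + i < ?M" "n + l < ?M" using K assms(1) by auto
      have xy: "2 * n + k1 = 2 * (n + i) + 1" "2 * n + k2 = 2 * (n + l) + 1" using 4 by auto
      have "form11 N D K = 0" using 4 K ne by (intro form11_at_zero) (auto simp: doubleton_eq_iff)
      moreover have "of_nat n * ?F (?T \<union> (+) (2 * n) ` K) = 0"
        unfolding T xy
        by (subst pair) (use il K in \<open>simp_all only: contr_contr_form11_zero[OF il(4,5)] const
            wedge_contr_contr_fpow[OF _ il(4,5)] wedge_contr_contr_fpow[OF _ il(5,4)] le_add1\<close>, auto simp: 4)
      ultimately show ?thesis by simp
    qed
  qed
qed

end

text \<open>By degree and support, the n-th power has the single monomial \<open>{..<2 * n}\<close>.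
  The other factor can therefore only contribute its part with base covectors alone, and crossing a
  block of even size costs no sign.\<close>

lemma wedge_form11_fpow_top:
  assumes "K \<subseteq> {..<2 * N}"
  shows "wedge (form11 (n + N) c) (fpow (form11 n h) n) ({..<2 * n} \<union> (+) (2 * n) ` K) =
    form11 N (\<lambda>i l. c (n + i) (n + l)) K * fpow (form11 n h) n {..<2 * n}"
proof -
  let ?W = "fpow (form11 n h) n" and ?T = "{..<2 * n}" and ?K = "(+) (2 * n) ` K"
  have finK: "finite K" using assms(1) finite_subset by blast
  have W: "?W I = 0" if "I \<noteq> ?T" for I
  proof (rule ccontr)
    assume "?W I \<noteq> 0"
    then have "I \<subseteq> ?T" "card I = 2 * n"
      using fpow_form11_support homog_fpow[OF homog_form11, of n n h] by (auto simp: homog_def)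
    then show False using that by (metis card_lessThan card_subset_eq finite_lessThan)
  qed
  have sub: "?T \<union> ?K - (?T \<union> ?K - ?T) = ?T" "?T \<union> ?K - ?T = ?K" by auto
  have "wedge (form11 (n + N) c) ?W (?T \<union> ?K) =
      (\<Sum>I\<in>{?K}. wsign I (?T \<union> ?K - I) * form11 (n + N) c I * ?W (?T \<union> ?K - I))"
    unfolding wedge_def
  proof (rule sum.mono_neutral_right)
    show "\<forall>I\<in>Pow (?T \<union> ?K) - {?K}. wsign I (?T \<union> ?K - I) * form11 (n + N) c I * ?W (?T \<union> ?K - I) = 0"
    proof
      fix I assume I: "I \<in> Pow (?T \<union> ?K) - {?K}"
      have "?T \<union> ?K - I \<noteq> ?T"
      proof
        assume "?T \<union> ?K - I = ?T"
        then have "I = ?T \<union> ?K - ?T" using I by auto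
        then show False using I sub(2) by auto
      qed
      then show "wsign I (?T \<union> ?K - I) * form11 (n + N) c I * ?W (?T \<union> ?K - I) = 0" using W by simp
    qed
  qed (use finK in auto)
  also have "\<dots> = wsign ?K ?T * form11 (n + N) c ?K * ?W ?T" using sub by simp
  also have "wsign ?K ?T = 1"
  proof -
    have "{(i, j). i \<in> ?K \<and> j \<in> ?T \<and> j < i} = ?K \<times> ?T" by auto
    then show ?thesis
      by (simp add: wsign_def card_cartesian_product mult.left_commute[of _ 2])
  qed
  also have "form11 (n + N) c ?K = form11 N (\<lambda>i l. c (n + i) (n + l)) K"
  proof (cases "\<exists>i l. i < N \<and> l < N \<and> K = {2 * i, 2 * l + 1}")
    case True
    then obtain i l where K: "i < N" "l < N" "K = {2 * i, 2 * l + 1}" by auto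
    then have "?K = {2 * (n + i), 2 * (n + l) + 1}" by auto
    with K show ?thesis by (simp only: form11_at add_less_cancel_left)
  next
    case False
    then have "form11 N (\<lambda>i l. c (n + i) (n + l)) K = 0" by (intro form11_at_zero) auto
    moreover have "form11 (n + N) c ?K = 0"
    proof (rule form11_at_zero, rule notI)
      fix i l assume il: "i < n + N" "l < n + N" "?K = {2 * i, 2 * l + 1}"
      then have "2 * i \<in> ?K" "2 * l + 1 \<in> ?K" by auto
      then have "n \<le> i" "n \<le> l" by auto
      then obtain i' l' where "i = n + i'" "l = n + l'" by (metis le_add_diff_inverse)
      then have "?K = (+) (2 * n) ` {2 * i', 2 * l' + 1}" "i' < N" "l' < N" using il by auto
      then have "K = {2 * i', 2 * l' + 1}" by (metis inj_image_eq_iff inj_on_add)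
      with False \<open>i' < N\<close> \<open>l' < N\<close> show False by blast
    qed
    ultimately show ?thesis by simp
  qed
  finally show ?thesis by simp
qed


section \<open>Differential calculus\<close>


abbreviation rel_open :: "nat \<Rightarrow> cvec set \<Rightarrow> bool" where
  "rel_open N D \<equiv> openin (top_of_set (Cn N)) D"

lemma Cn_upd: "w \<in> Cn N \<Longrightarrow> A < N \<Longrightarrow> w(A := x) \<in> Cn N"
  by (auto simp: Cn_def)

lemma rel_open_subset: "rel_open N D \<Longrightarrow> D \<subseteq> Cn N"
  by (auto simp: openin_subtopology)

text \<open>Members of \<open>Cn N\<close> vanish from index \<open>N\<close> on, so only the first
  \<open>N\<close> conditions of a product neighbourhood matter and their radii have a minimum; the
  inserted 1 covers \<open>N = 0\<close>.\<close>

lemma rel_open_polydisc: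
  assumes "rel_open N D" "w \<in> D"
  obtains r where "r > 0" "\<And>w'. w' \<in> Cn N \<Longrightarrow> (\<And>i. i < N \<Longrightarrow> norm (w' i - w i) < r) \<Longrightarrow> w' \<in> D"
proof -
  obtain T where T: "open T" "D = Cn N \<inter> T"
    using assms(1) by (auto simp: openin_open)
  have w: "w \<in> Cn N" "w \<in> T" using assms(2) T by auto
  have "openin (product_topology (\<lambda>i. euclidean) UNIV) T"
    using T(1) by (simp add: euclidean_product_topology)
  from product_topology_open_contains_basis[OF this w(2)] obtain X where
    X: "w \<in> (\<Pi>\<^sub>E i\<in>UNIV. X i)" "\<And>i. open (X i)" "(\<Pi>\<^sub>E i\<in>UNIV. X i) \<subseteq> T" by auto
  have "\<exists>r>0. \<forall>y. norm (y - w i) < r \<longrightarrow> y \<in> X i" for i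
  proof -
    have "w i \<in> X i" using X(1) by auto
    then obtain r where "r > 0" "ball (w i) r \<subseteq> X i" using X(2) openE by blast
    then show ?thesis by (auto simp: subset_eq dist_norm norm_minus_commute)
  qed
  then obtain r where r: "\<And>i. r i > 0" "\<And>i y. norm (y - w i) < r i \<Longrightarrow> y \<in> X i" by metis
  show thesis
  proof
    let ?r = "Min (insert 1 (r ` {..<N}))"
    show "?r > 0" using r(1) by auto
    fix w' assume w': "w' \<in> Cn N" "\<And>i. i < N \<Longrightarrow> norm (w' i - w i) < ?r"
    have "w' i \<in> X i" for i
    proof (cases "i < N")
      case True
      then have "?r \<le> r i" by (intro Min_le) auto
      with w'(2)[OF True] show ?thesis by (intro r(2)) linarith
    next
      case False
      then have "w' i = w i" using w(1) w'(1) by (auto simp: Cn_def)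
      then show ?thesis using X(1) by auto
    qed
    then have "w' \<in> T" using X(3) by auto
    then show "w' \<in> D" using w'(1) T by auto
  qed
qed

lemma polydisc_rel_open:
  assumes "w0 \<in> Cn N"
  shows "rel_open N {w \<in> Cn N. \<forall>i<N. norm (w i - w0 i) < r}"
proof -
  have "open (\<Inter>i<N. {w :: cvec. norm (w i - w0 i) < r})"
    by (intro open_INT ballI open_Collect_less continuous_intros continuous_on_product_coordinates) auto
  then have "rel_open N (Cn N \<inter> (\<Inter>i<N. {w. norm (w i - w0 i) < r}))" by (rule openin_open_Int)
  also have "Cn N \<inter> (\<Inter>i<N. {w. norm (w i - w0 i) < r}) = {w \<in> Cn N. \<forall>i<N. norm (w i - w0 i) < r}"
    by auto
  finally show ?thesis .
qed

text \<open>The increments are added rather than substituted, so that \<open>A = B\<close> is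
  allowed and the mixed derivatives along 1 and \<open>\<i>\<close> in one coordinate are
  covered.\<close>

definition shift2 :: "nat \<Rightarrow> complex \<Rightarrow> nat \<Rightarrow> complex \<Rightarrow> cvec \<Rightarrow> real \<Rightarrow> real \<Rightarrow> cvec" where
  "shift2 A c B d w s t = (\<lambda>i. w i + (if i = A then of_real s * c else 0) + (if i = B then of_real t * d else 0))"

lemma shift2_simps:
  "shift2 A c B d w 0 0 = w"
  "(shift2 A c B d w s t)(A := shift2 A c B d w s t A + of_real h * c) = shift2 A c B d w (s + h) t"
  "(shift2 A c B d w s t)(B := shift2 A c B d w s t B + of_real h * d) = shift2 A c B d w s (t + h)"
  by (auto simp: shift2_def fun_eq_iff algebra_simps)

lemma continuous_on_shift2: "continuous_on S (\<lambda>p. shift2 A c B d w (fst p) (snd p))"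
proof (rule continuous_on_coordinatewise_then_product)
  show "continuous_on S (\<lambda>p. shift2 A c B d w (fst p) (snd p) i)" for i
    unfolding shift2_def by (cases "i = A"; cases "i = B"; simp) (auto intro!: continuous_intros)
qed

lemma shift2_in:
  assumes "rel_open N D" "w \<in> D" "A < N" "B < N" "c \<in> {1, \<i>}" "d \<in> {1, \<i>}"
  obtains r where "r > 0" "\<And>s t. \<bar>s\<bar> < r \<Longrightarrow> \<bar>t\<bar> < r \<Longrightarrow> shift2 A c B d w s t \<in> D"
proof -
  obtain r where r: "r > 0" "\<And>w'. w' \<in> Cn N \<Longrightarrow> (\<And>i. i < N \<Longrightarrow> norm (w' i - w i) < r) \<Longrightarrow> w' \<in> D"
    using rel_open_polydisc[OF assms(1,2)] by metis
  have w: "w \<in> Cn N" using assms rel_open_subset by auto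
  have n: "norm c = 1" "norm d = 1" using assms(5,6) by auto
  show thesis
  proof
    show "r / 2 > 0" using r by simp
    fix s t :: real assume st: "\<bar>s\<bar> < r / 2" "\<bar>t\<bar> < r / 2"
    show "shift2 A c B d w s t \<in> D"
    proof (rule r(2))
      show "shift2 A c B d w s t \<in> Cn N" using w assms(3,4) by (auto simp: shift2_def Cn_def)
      fix i
      have "norm (shift2 A c B d w s t i - w i) \<le>
          norm (if i = A then of_real s * c else 0) + norm (if i = B then of_real t * d else 0)"
        unfolding shift2_def by (metis (no_types, lifting) add.assoc add_diff_cancel_left' norm_triangle_ineq)
      also have "\<dots> < r" using st r(1) n by (auto simp: norm_mult)
      finally show "norm (shift2 A c B d w s t i - w i) < r" .
    qed
  qed
qed

lemma pline_shift2:
  "pline A c f (shift2 A c B d w s t) = (\<lambda>h. f (shift2 A c B d w (s + h) t))"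
  "pline B d f (shift2 A c B d w s t) = (\<lambda>h. f (shift2 A c B d w s (t + h)))"
  by (simp_all add: pline_def shift2_simps)

lemma eventually_pline:
  assumes "rel_open N D" "w \<in> D" "A < N" "c \<in> {1, \<i>}"
  shows "eventually (\<lambda>t. w(A := w A + of_real t * c) \<in> D) (nhds 0)"
proof -
  obtain r where r: "r > 0" "\<And>s t. \<bar>s\<bar> < r \<Longrightarrow> \<bar>t\<bar> < r \<Longrightarrow> shift2 A c A c w s t \<in> D"
    using shift2_in[OF assms(1,2,3,3,4,4)] by metis
  have "w(A := w A + of_real t * c) \<in> D" if "\<bar>t\<bar> < r" for t
    using r(2)[of t 0] r(1) that shift2_simps(2)[of A c A c w 0 0 t] by (simp add: shift2_simps(1))
  then show ?thesis
    unfolding eventually_nhds_metric using r(1) by (intro exI[of _ r]) auto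
qed

lemma pline_transform:
  assumes "rel_open N D" "w \<in> D" "A < N" "c \<in> {1, \<i>}" "\<And>w. w \<in> D \<Longrightarrow> f w = g w"
  shows "(pline A c f w has_vector_derivative d) (at 0) \<longleftrightarrow> (pline A c g w has_vector_derivative d) (at 0)"
proof -
  have "eventually (\<lambda>t. pline A c f w t = pline A c g w t) (nhds 0)"
    using eventually_pline[OF assms(1-4)] by eventually_elim (simp add: pline_def assms(5))
  then show ?thesis
    by (intro has_vector_derivative_cong_ev) (auto dest: eventually_nhds_x_imp_x elim: eventually_mono)
qed

lemma pdir_eqI: "(pline A c f w has_vector_derivative d) (at 0) \<Longrightarrow> pdir A c f w = d"
  unfolding pdir_def by (rule vector_derivative_at)

lemma pdir_works:
  "pline A c f w differentiable (at 0) \<Longrightarrow> (pline A c f w has_vector_derivative pdir A c f w) (at 0)"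
  unfolding pdir_def by (simp add: vector_derivative_works)

lemma pline_differentiable_cong:
  assumes "rel_open N D" "w \<in> D" "A < N" "c \<in> {1, \<i>}" "\<And>w. w \<in> D \<Longrightarrow> f w = g w"
  shows "pline A c f w differentiable (at 0) \<longleftrightarrow> pline A c g w differentiable (at 0)"
    and "pdir A c f w = pdir A c g w"
proof -
  have "(\<exists>d. (pline A c f w has_vector_derivative d) (at 0)) \<longleftrightarrow>
      (\<exists>d. (pline A c g w has_vector_derivative d) (at 0))"
    using pline_transform[OF assms] by simp
  then show "pline A c f w differentiable (at 0) \<longleftrightarrow> pline A c g w differentiable (at 0)"
    by (metis differentiableI_vector vector_derivative_works)
  show "pdir A c f w = pdir A c g w"
    unfolding pdir_def vector_derivative_def using pline_transform[OF assms] by simp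
qed

text \<open>\<open>D\<close> is open along every coordinate line through its points, so derivatives
  of any order on \<open>D\<close> do not see values outside \<open>D\<close>.\<close>

lemma Ck_on_cong:
  assumes "rel_open N D" "\<And>w. w \<in> D \<Longrightarrow> f w = g w"
  shows "Ck_on k N D f \<longleftrightarrow> Ck_on k N D g"
  using assms(2)
proof (induction k arbitrary: f g)
  case 0
  then show ?case by (auto intro: continuous_on_cong)
next
  case (Suc k)
  have "continuous_on D f \<longleftrightarrow> continuous_on D g"
    using Suc.prems by (intro continuous_on_cong) auto
  moreover have "pline A c f w differentiable (at 0) \<longleftrightarrow> pline A c g w differentiable (at 0)"
    if "A < N" "c \<in> {1, \<i>}" "w \<in> D" for A c w
    using pline_differentiable_cong(1)[OF assms(1) that(3,1,2)] Suc.prems by blast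
  moreover have "Ck_on k N D (pdir A c f) \<longleftrightarrow> Ck_on k N D (pdir A c g)" if "A < N" "c \<in> {1, \<i>}" for A c
    using pline_differentiable_cong(2)[OF assms(1) _ that] Suc.prems by (intro Suc.IH) blast
  ultimately show ?case by (simp cong: ball_cong conj_cong)
qed

text \<open>\<open>Ck_on (Suc k)\<close> does not literally contain \<open>Ck_on k\<close>; the
  regularity of the derivatives has to be lowered by induction.\<close>

lemma Ck_on_SucD: "Ck_on (Suc k) N D f \<Longrightarrow> Ck_on k N D f"
proof (induction k arbitrary: f)
  case (Suc k)
  then show ?case by (subst Ck_on.simps(2)) (auto simp del: Ck_on.simps(2) dest: Ck_on.simps(2)[THEN iffD1])
qed simp

text \<open>Lets the derivatives be given by formulas valid on \<open>D\<close> instead of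
  \<open>pdir\<close>, so that closure rules can be applied to these formulas.\<close>

lemma Ck_on_SucI:
  assumes "rel_open N D" "continuous_on D f"
    and "\<And>A c w. A < N \<Longrightarrow> c \<in> {1, \<i>} \<Longrightarrow> w \<in> D \<Longrightarrow> (pline A c f w has_vector_derivative f' A c w) (at 0)"
    and "\<And>A c. A < N \<Longrightarrow> c \<in> {1, \<i>} \<Longrightarrow> Ck_on k N D (f' A c)"
  shows "Ck_on (Suc k) N D f"
proof -
  have "pline A c f w differentiable (at 0)" if "A < N" "c \<in> {1, \<i>}" "w \<in> D" for A c w
    using assms(3)[OF that] by (rule differentiableI_vector)
  moreover have "Ck_on k N D (pdir A c f)" if "A < N" "c \<in> {1, \<i>}" for A c
    using Ck_on_cong[OF assms(1), of "pdir A c f" "f' A c"] pdir_eqI[OF assms(3)[OF that]] assms(4)[OF that]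
    by auto
  ultimately show ?thesis using assms(2) unfolding Ck_on.simps by blast
qed

lemma Ck_on_SucE:
  assumes "Ck_on (Suc k) N D f" "A < N" "c \<in> {1, \<i>}"
  shows "w \<in> D \<Longrightarrow> (pline A c f w has_vector_derivative pdir A c f w) (at 0)" "Ck_on k N D (pdir A c f)"
  using assms by (auto intro: pdir_works)

lemma Ck_on_const: "rel_open N D \<Longrightarrow> Ck_on k N D (\<lambda>w. a)"
proof (induction k arbitrary: a)
  case (Suc k)
  then show ?case by (intro Ck_on_SucI[where f' = "\<lambda>_ _ _. 0"]) (auto simp: pline_def intro!: derivative_intros)
qed auto

lemma Ck_on_add:
  assumes "rel_open N D"
  shows "Ck_on k N D f \<Longrightarrow> Ck_on k N D g \<Longrightarrow> Ck_on k N D (\<lambda>w. f w + g w)"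
proof (induction k arbitrary: f g)
  case (Suc k)
  note f = Ck_on_SucE[OF Suc.prems(1)] and g = Ck_on_SucE[OF Suc.prems(2)]
  show ?case
  proof (rule Ck_on_SucI[OF assms, where f' = "\<lambda>A c w. pdir A c f w + pdir A c g w"])
    show "continuous_on D (\<lambda>w. f w + g w)"
      using Suc.prems by (auto intro!: continuous_intros)
    show "(pline A c (\<lambda>w. f w + g w) w has_vector_derivative pdir A c f w + pdir A c g w) (at 0)"
      if "A < N" "c \<in> {1, \<i>}" "w \<in> D" for A c w
      using has_vector_derivative_add[OF f(1)[OF that] g(1)[OF that]] by (simp add: pline_def)
  qed (auto intro!: Suc.IH f(2) g(2))
qed (auto intro!: continuous_intros)

lemma pline_at_0: "pline A c f w 0 = f w"
  by (simp add: pline_def)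

lemma Ck_on_mult:
  assumes "rel_open N D"
  shows "Ck_on k N D f \<Longrightarrow> Ck_on k N D g \<Longrightarrow> Ck_on k N D (\<lambda>w. f w * g w)"
proof (induction k arbitrary: f g)
  case (Suc k)
  note f = Ck_on_SucE[OF Suc.prems(1)] and g = Ck_on_SucE[OF Suc.prems(2)]
  show ?case
  proof (rule Ck_on_SucI[OF assms, where f' = "\<lambda>A c w. f w * pdir A c g w + pdir A c f w * g w"])
    show "continuous_on D (\<lambda>w. f w * g w)"
      using Suc.prems by (auto intro!: continuous_intros)
    show "(pline A c (\<lambda>w. f w * g w) w has_vector_derivative f w * pdir A c g w + pdir A c f w * g w) (at 0)"
      if "A < N" "c \<in> {1, \<i>}" "w \<in> D" for A c w
      using has_vector_derivative_mult[OF f(1)[OF that] g(1)[OF that]] by (simp add: pline_def)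
  qed (auto intro!: Suc.IH Ck_on_add[OF assms] f(2) g(2) Ck_on_SucD[OF Suc.prems(1)] Ck_on_SucD[OF Suc.prems(2)])
qed (auto intro!: continuous_intros)

lemma Ck_on_cnj:
  assumes "rel_open N D"
  shows "Ck_on k N D f \<Longrightarrow> Ck_on k N D (\<lambda>w. cnj (f w))"
proof (induction k arbitrary: f)
  case (Suc k)
  note f = Ck_on_SucE[OF Suc.prems(1)]
  show ?case
  proof (rule Ck_on_SucI[OF assms, where f' = "\<lambda>A c w. cnj (pdir A c f w)"])
    show "continuous_on D (\<lambda>w. cnj (f w))"
      using Suc.prems by (auto intro!: continuous_intros)
    show "(pline A c (\<lambda>w. cnj (f w)) w has_vector_derivative cnj (pdir A c f w)) (at 0)"
      if "A < N" "c \<in> {1, \<i>}" "w \<in> D" for A c w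
      using has_vector_derivative_cnj[OF f(1)[OF that]] by (simp add: pline_def)
  qed (auto intro!: Suc.IH f(2))
qed (auto intro!: continuous_intros)

text \<open>The derivative is written as a product that contains \<open>inverse (f w)\<close> twice,
  to which the induction hypothesis and the product rule apply.\<close>

lemma Ck_on_inverse:
  assumes "rel_open N D" "\<And>w. w \<in> D \<Longrightarrow> f w \<noteq> 0"
  shows "Ck_on k N D f \<Longrightarrow> Ck_on k N D (\<lambda>w. inverse (f w))"
proof (induction k)
  case (Suc k)
  note f = Ck_on_SucE[OF Suc.prems(1)] and IH = Suc.IH[OF Ck_on_SucD[OF Suc.prems(1)]]
  show ?case
  proof (rule Ck_on_SucI[OF assms(1), where f' = "\<lambda>A c w. (-1) * (pdir A c f w * (inverse (f w) * inverse (f w)))"])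
    show "continuous_on D (\<lambda>w. inverse (f w))"
      using Suc.prems assms(2) by (auto intro!: continuous_intros)
    show "(pline A c (\<lambda>w. inverse (f w)) w has_vector_derivative
        (-1) * (pdir A c f w * (inverse (f w) * inverse (f w)))) (at 0)"
      if "A < N" "c \<in> {1, \<i>}" "w \<in> D" for A c w
    proof -
      have "(inverse has_field_derivative - (inverse (f w) * inverse (f w))) (at (pline A c f w 0))"
        unfolding pline_at_0 by (rule DERIV_inverse'[OF DERIV_ident, simplified]) (use assms(2) that in auto)
      from field_vector_diff_chain_at[OF f(1)[OF that] this] show ?thesis
        by (simp add: pline_def o_def mult_ac)
    qed
  qed (intro Ck_on_mult[OF assms(1)] Ck_on_const[OF assms(1)] f(2) IH; assumption)
qed (auto intro!: continuous_intros assms(2))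


section \<open>Smooth functions and their Wirtinger derivatives\<close>

lemma smooth_on_Ck: "smooth_on N D f \<Longrightarrow> Ck_on k N D f"
  by (simp add: smooth_on_def)

lemma smooth_on_continuous: "smooth_on N D f \<Longrightarrow> continuous_on D f"
  using smooth_on_Ck[of N D f 0] by simp

lemma smooth_on_pline:
  assumes "smooth_on N D f" "A < N" "c \<in> {1, \<i>}"
  shows "w \<in> D \<Longrightarrow> (pline A c f w has_vector_derivative pdir A c f w) (at 0)"
    and "smooth_on N D (pdir A c f)"
  using Ck_on_SucE[OF smooth_on_Ck[OF assms(1)] assms(2,3)] by (auto simp: smooth_on_def)

lemma smooth_on_cong:
  "rel_open N D \<Longrightarrow> (\<And>w. w \<in> D \<Longrightarrow> f w = g w) \<Longrightarrow> smooth_on N D f \<longleftrightarrow> smooth_on N D g"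
  unfolding smooth_on_def using Ck_on_cong by blast

context
  fixes N :: nat and D :: "cvec set"
  assumes D: "rel_open N D"
begin

lemma smooth_on_const: "smooth_on N D (\<lambda>w. a)"
  by (simp add: smooth_on_def Ck_on_const[OF D])

lemma smooth_on_add: "smooth_on N D f \<Longrightarrow> smooth_on N D g \<Longrightarrow> smooth_on N D (\<lambda>w. f w + g w)"
  by (simp add: smooth_on_def Ck_on_add[OF D])

lemma smooth_on_mult: "smooth_on N D f \<Longrightarrow> smooth_on N D g \<Longrightarrow> smooth_on N D (\<lambda>w. f w * g w)"
  by (simp add: smooth_on_def Ck_on_mult[OF D])

lemma smooth_on_cnj: "smooth_on N D f \<Longrightarrow> smooth_on N D (\<lambda>w. cnj (f w))"
  by (simp add: smooth_on_def Ck_on_cnj[OF D])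

lemma smooth_on_inverse:
  "smooth_on N D f \<Longrightarrow> (\<And>w. w \<in> D \<Longrightarrow> f w \<noteq> 0) \<Longrightarrow> smooth_on N D (\<lambda>w. inverse (f w))"
  by (simp add: smooth_on_def Ck_on_inverse[OF D])

lemma smooth_on_minus: "smooth_on N D f \<Longrightarrow> smooth_on N D (\<lambda>w. - f w)"
  using smooth_on_mult[OF smooth_on_const[of "-1"]] by simp

lemma smooth_on_diff: "smooth_on N D f \<Longrightarrow> smooth_on N D g \<Longrightarrow> smooth_on N D (\<lambda>w. f w - g w)"
  using smooth_on_add[OF _ smooth_on_minus] by simp

lemma smooth_on_sum:
  "(\<And>x. x \<in> S \<Longrightarrow> smooth_on N D (f x)) \<Longrightarrow> smooth_on N D (\<lambda>w. \<Sum>x\<in>S. f x w)"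
  by (induction S rule: infinite_finite_induct) (auto intro: smooth_on_const smooth_on_add)

lemma smooth_on_prod:
  "(\<And>x. x \<in> S \<Longrightarrow> smooth_on N D (f x)) \<Longrightarrow> smooth_on N D (\<lambda>w. \<Prod>x\<in>S. f x w)"
  by (induction S rule: infinite_finite_induct) (auto intro: smooth_on_const smooth_on_mult)

lemma smooth_on_wdel: "smooth_on N D f \<Longrightarrow> A < N \<Longrightarrow> smooth_on N D (wdel A f)"
  and smooth_on_wdelbar: "smooth_on N D f \<Longrightarrow> A < N \<Longrightarrow> smooth_on N D (wdelbar A f)"
  unfolding wdel_def[abs_def] wdelbar_def[abs_def] divide_inverse
  by (intro smooth_on_mult smooth_on_add smooth_on_diff smooth_on_const smooth_on_pline(2); simp)+

lemma pdir_rules: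
  assumes f: "smooth_on N D f" and g: "smooth_on N D g" and A: "A < N" "c \<in> {1, \<i>}" and w: "w \<in> D"
  shows "pdir A c (\<lambda>w. f w + g w) w = pdir A c f w + pdir A c g w"
    and "pdir A c (\<lambda>w. f w * g w) w = f w * pdir A c g w + pdir A c f w * g w"
    and "pdir A c (\<lambda>w. cnj (f w)) w = cnj (pdir A c f w)"
proof -
  note f' = smooth_on_pline(1)[OF f A w] and g' = smooth_on_pline(1)[OF g A w]
  show "pdir A c (\<lambda>w. f w + g w) w = pdir A c f w + pdir A c g w"
    using has_vector_derivative_add[OF f' g'] by (intro pdir_eqI) (simp add: pline_def)
  show "pdir A c (\<lambda>w. f w * g w) w = f w * pdir A c g w + pdir A c f w * g w"
    using has_vector_derivative_mult[OF f' g'] by (intro pdir_eqI) (simp add: pline_def)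
  show "pdir A c (\<lambda>w. cnj (f w)) w = cnj (pdir A c f w)"
    using has_vector_derivative_cnj[OF f'] by (intro pdir_eqI) (simp add: pline_def)
qed

lemma pdir_const: "pdir A c (\<lambda>w. a) w = 0"
  by (rule pdir_eqI) (simp add: pline_def)

lemma wdel_cong:
  assumes "A < N" "w \<in> D" "\<And>w. w \<in> D \<Longrightarrow> f w = g w"
  shows "wdel A f w = wdel A g w" "wdelbar A f w = wdelbar A g w"
  unfolding wdel_def wdelbar_def
  using pline_differentiable_cong(2)[OF D assms(2,1) _ assms(3)] by simp_all

lemma wdel_const: "wdel A (\<lambda>w. a) w = 0" "wdelbar A (\<lambda>w. a) w = 0"
  by (simp_all add: wdel_def wdelbar_def pdir_const)

lemma wdel_add:
  assumes "smooth_on N D f" "smooth_on N D g" "A < N" "w \<in> D"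
  shows "wdel A (\<lambda>w. f w + g w) w = wdel A f w + wdel A g w"
    and "wdelbar A (\<lambda>w. f w + g w) w = wdelbar A f w + wdelbar A g w"
  using assms by (simp_all add: wdel_def wdelbar_def pdir_rules add_divide_distrib diff_divide_distrib algebra_simps)

lemma wdel_mult:
  assumes "smooth_on N D f" "smooth_on N D g" "A < N" "w \<in> D"
  shows "wdel A (\<lambda>w. f w * g w) w = wdel A f w * g w + f w * wdel A g w"
    and "wdelbar A (\<lambda>w. f w * g w) w = wdelbar A f w * g w + f w * wdelbar A g w"
  using assms by (simp_all add: wdel_def wdelbar_def pdir_rules add_divide_distrib diff_divide_distrib algebra_simps)

lemma wdel_cnj:
  assumes "smooth_on N D f" "A < N" "w \<in> D"
  shows "wdel A (\<lambda>w. cnj (f w)) w = cnj (wdelbar A f w)"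
  using assms by (simp add: wdel_def wdelbar_def pdir_rules(3)[OF assms(1,1)])

lemma wdel_sum:
  assumes "\<And>x. x \<in> S \<Longrightarrow> smooth_on N D (f x)" "A < N" "w \<in> D"
  shows "wdel A (\<lambda>w. \<Sum>x\<in>S. f x w) w = (\<Sum>x\<in>S. wdel A (f x) w)"
    and "wdelbar A (\<lambda>w. \<Sum>x\<in>S. f x w) w = (\<Sum>x\<in>S. wdelbar A (f x) w)"
proof -
  have "wdel A (\<lambda>w. \<Sum>x\<in>S. f x w) w = (\<Sum>x\<in>S. wdel A (f x) w) \<and>
      wdelbar A (\<lambda>w. \<Sum>x\<in>S. f x w) w = (\<Sum>x\<in>S. wdelbar A (f x) w)"
    using assms(1)
  proof (induction S rule: infinite_finite_induct)
    case (insert x S)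
    then show ?case
      using wdel_add[of "f x" "\<lambda>w. \<Sum>x\<in>S. f x w" A w] assms(2,3) by (simp add: smooth_on_sum)
  qed (simp_all add: wdel_const)
  then show "wdel A (\<lambda>w. \<Sum>x\<in>S. f x w) w = (\<Sum>x\<in>S. wdel A (f x) w)"
    and "wdelbar A (\<lambda>w. \<Sum>x\<in>S. f x w) w = (\<Sum>x\<in>S. wdelbar A (f x) w)" by auto
qed

text \<open>
  The second derivatives of \<open>h(s, t)\<close> commute because \<open>h(s, t) - h(0, t)\<close> is the integral of
  \<open>\<partial>h/\<partial>s\<close>, which can be differentiated in \<open>t\<close> under the integral sign.
\<close>

lemma pdir_commute:
  assumes f: "smooth_on N D f" and A: "A < N" "c \<in> {1, \<i>}" and B: "B < N" "d \<in> {1, \<i>}" and w: "w \<in> D"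
  shows "pdir A c (pdir B d f) w = pdir B d (pdir A c f) w"
proof -
  obtain r where r: "r > 0" "\<And>s t. \<bar>s\<bar> < r \<Longrightarrow> \<bar>t\<bar> < r \<Longrightarrow> shift2 A c B d w s t \<in> D"
    using shift2_in[OF D w A(1) B(1) A(2) B(2)] by metis
  define u where "u = shift2 A c B d w"
  define I where "I = {- (r / 2)..r / 2}"
  \<comment> \<open>One-sided, because the integrals over \<open>{0..s}\<close> call for
    \<open>s \<ge> 0\<close>; a derivative within \<open>J\<close> at its endpoint 0 is still
    unique.\<close>
  define J where "J = {0..r / 2}"
  have uD: "u s t \<in> D" if "s \<in> I" "t \<in> I" for s t
    using that r(1) unfolding u_def by (intro r(2)) (auto simp: I_def)
  have I0: "0 \<in> I" "J \<subseteq> I" "0 \<in> J" using r(1) by (auto simp: I_def J_def)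
  have s_deriv: "((\<lambda>s. h (u s t)) has_vector_derivative pdir A c h (u s t)) (at s within S)"
    and t_deriv: "((\<lambda>t. h (u s t)) has_vector_derivative pdir B d h (u s t)) (at t within S)"
    if h: "smooth_on N D h" and st: "s \<in> I" "t \<in> I" for h s t S
  proof -
    have "((\<lambda>x. h (u (s + x) t)) has_vector_derivative pdir A c h (u s t)) (at (s - s))"
      using smooth_on_pline(1)[OF h A uD[OF st]] unfolding u_def pline_shift2 by simp
    then have "((\<lambda>x. h (u (s + (x - s)) t)) has_vector_derivative pdir A c h (u s t)) (at s)"
      using vector_diff_chain_at[of "\<lambda>x. x - s" 1 s "\<lambda>x. h (u (s + x) t)" "pdir A c h (u s t)"]
      has_vector_derivative_diff[OF has_vector_derivative_id[of "at s"] has_vector_derivative_const[of s]]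
      by (auto simp: o_def)
    then show "((\<lambda>s. h (u s t)) has_vector_derivative pdir A c h (u s t)) (at s within S)"
      by (simp add: has_vector_derivative_at_within)
    have "((\<lambda>x. h (u s (t + x))) has_vector_derivative pdir B d h (u s t)) (at (t - t))"
      using smooth_on_pline(1)[OF h B uD[OF st]] unfolding u_def pline_shift2 by simp
    then have "((\<lambda>x. h (u s (t + (x - t)))) has_vector_derivative pdir B d h (u s t)) (at t)"
      using vector_diff_chain_at[of "\<lambda>x. x - t" 1 t "\<lambda>x. h (u s (t + x))" "pdir B d h (u s t)"]
      has_vector_derivative_diff[OF has_vector_derivative_id[of "at t"] has_vector_derivative_const[of t]]
      by (auto simp: o_def)
    then show "((\<lambda>t. h (u s t)) has_vector_derivative pdir B d h (u s t)) (at t within S)"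
      by (simp add: has_vector_derivative_at_within)
  qed
  have cont: "continuous_on (I \<times> I) (\<lambda>p. h (u (fst p) (snd p)))" if "smooth_on N D h" for h
    by (rule continuous_on_compose2[OF smooth_on_continuous[OF that]])
       (use uD in \<open>auto simp: u_def intro!: continuous_on_shift2\<close>)
  have cont': "continuous_on I (\<lambda>s. h (u s t))" if "smooth_on N D h" "t \<in> I" for h t
    by (rule continuous_on_compose2[OF cont[OF that(1)], of I "\<lambda>s. (s, t)", simplified])
       (use that in \<open>auto intro!: continuous_intros\<close>)
  let ?fs = "pdir A c f" and ?ft = "pdir B d f"
  have fs: "smooth_on N D ?fs" and ft: "smooth_on N D ?ft" and fst: "smooth_on N D (pdir B d ?fs)"
    using smooth_on_pline(2) f A B by blast+
  have ftc: "integral {0..s} (\<lambda>\<sigma>. ?fs (u \<sigma> t)) = f (u s t) - f (u 0 t)" if "s \<in> J" "t \<in> I" for s t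
    by (rule integral_unique, rule fundamental_theorem_of_calculus)
       (use that I0 r(1) in \<open>auto intro!: s_deriv[OF f] simp: I_def J_def\<close>)
  have eq: "?ft (u s 0) - ?ft (u 0 0) = integral {0..s} (\<lambda>\<sigma>. pdir B d ?fs (u \<sigma> 0))" if s: "s \<in> J" for s
  proof -
    have sub: "cbox 0 s \<subseteq> I" using s I0 by (auto simp: I_def J_def)
    \<comment> \<open>The t-derivative of this integral is computed twice, under the integral sign
      here and from \<open>ftc\<close> afterwards.\<close>
    have "((\<lambda>t. integral (cbox 0 s) (\<lambda>\<sigma>. ?fs (u \<sigma> t))) has_vector_derivative
        integral (cbox 0 s) (\<lambda>\<sigma>. pdir B d ?fs (u \<sigma> 0))) (at 0 within I)"
    proof (rule leibniz_rule_vector_derivative)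
      show "((\<lambda>t. ?fs (u \<sigma> t)) has_vector_derivative pdir B d ?fs (u \<sigma> t)) (at t within I)"
        if "t \<in> I" "\<sigma> \<in> cbox 0 s" for t \<sigma>
        using that sub by (intro t_deriv[OF fs]) auto
      show "(\<lambda>\<sigma>. ?fs (u \<sigma> t)) integrable_on cbox 0 s" if "t \<in> I" for t
        by (intro integrable_continuous continuous_on_subset[OF cont'[OF fs that] sub])
      show "continuous_on (I \<times> cbox 0 s) (\<lambda>(t, \<sigma>). pdir B d ?fs (u \<sigma> t))"
        unfolding case_prod_beta
        by (rule continuous_on_compose2[OF cont[OF fst], of _ "\<lambda>p. (snd p, fst p)", simplified])
           (use sub in \<open>auto intro!: continuous_intros\<close>)
    qed (use I0 in \<open>auto simp: I_def\<close>)
    moreover have "((\<lambda>t. integral (cbox 0 s) (\<lambda>\<sigma>. ?fs (u \<sigma> t))) has_vector_derivative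
        ?ft (u s 0) - ?ft (u 0 0)) (at 0 within I)"
    proof (rule has_vector_derivative_transform[of 0 I _ "\<lambda>t. f (u s t) - f (u 0 t)"])
      show "integral (cbox 0 s) (\<lambda>\<sigma>. ?fs (u \<sigma> t)) = f (u s t) - f (u 0 t)" if "t \<in> I" for t
        using ftc[OF s that] by simp
      show "((\<lambda>t. f (u s t) - f (u 0 t)) has_vector_derivative ?ft (u s 0) - ?ft (u 0 0)) (at 0 within I)"
        using s I0 by (intro has_vector_derivative_diff t_deriv[OF f]) auto
    qed (use I0 in auto)
    ultimately show ?thesis
      using r(1) unfolding I_def
      by (intro vector_derivative_unique_within_closed_interval[of "- (r / 2)" "r / 2" 0, unfolded box_real]) auto
  qed
  have "((\<lambda>s. integral {0..s} (\<lambda>\<sigma>. pdir B d ?fs (u \<sigma> 0))) has_vector_derivative pdir B d ?fs (u 0 0)) (at 0 within J)"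
    unfolding J_def
    by (rule integral_has_vector_derivative)
       (use I0 r(1) in \<open>auto intro!: continuous_on_subset[OF cont'[OF fst]] simp: J_def I_def\<close>)
  then have "((\<lambda>s. ?ft (u s 0) - ?ft (u 0 0)) has_vector_derivative pdir B d ?fs (u 0 0)) (at 0 within J)"
    by (rule has_vector_derivative_transform[OF I0(3), rotated]) (use eq in auto)
  moreover have "((\<lambda>s. ?ft (u s 0) - ?ft (u 0 0)) has_vector_derivative pdir A c ?ft (u 0 0) - 0) (at 0 within J)"
    by (intro has_vector_derivative_diff s_deriv[OF ft] has_vector_derivative_const I0)
  ultimately have "pdir B d ?fs (u 0 0) = pdir A c ?ft (u 0 0) - 0"
    using r(1) unfolding J_def
    by (intro vector_derivative_unique_within_closed_interval[of 0 "r / 2" 0, unfolded box_real]) auto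
  then show ?thesis by (simp add: u_def shift2_simps)
qed

lemma wdel_wdelbar_commute:
  assumes f: "smooth_on N D f" and A: "A < N" and B: "B < N" and w: "w \<in> D"
  shows "wdel A (wdelbar B f) w = wdelbar B (wdel A f) w"
proof -
  have s: "smooth_on N D (pdir A c f)" "smooth_on N D (pdir B c f)" if "c \<in> {1, \<i>}" for c
    using smooth_on_pline(2)[OF f] A B that by auto
  have lin: "pdir C c (\<lambda>w. h w * a + k w * b) w = pdir C c h w * a + pdir C c k w * b"
    if "smooth_on N D h" "smooth_on N D k" "C < N" "c \<in> {1, \<i>}" for h k a b C c
    using that w by (simp add: pdir_rules pdir_const smooth_on_const smooth_on_mult)
  have dbar: "wdelbar B f = (\<lambda>w. pdir B 1 f w * (1 / 2) + pdir B \<i> f w * (\<i> / 2))"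
    and del: "wdel A f = (\<lambda>w. pdir A 1 f w * (1 / 2) + pdir A \<i> f w * (- \<i> / 2))"
    by (simp_all add: wdelbar_def wdel_def fun_eq_iff add_divide_distrib diff_divide_distrib)
  let ?g = "\<lambda>w. pdir B 1 f w * (1 / 2) + pdir B \<i> f w * (\<i> / 2)"
    and ?h = "\<lambda>w. pdir A 1 f w * (1 / 2) + pdir A \<i> f w * (- \<i> / 2)"
  have "wdel A (wdelbar B f) w = (pdir A 1 ?g w - \<i> * pdir A \<i> ?g w) / 2"
    unfolding dbar wdel_def ..
  moreover have "wdelbar B (wdel A f) w = (pdir B 1 ?h w + \<i> * pdir B \<i> ?h w) / 2"
    unfolding del wdelbar_def ..
  moreover have "pdir A c ?g w = pdir B 1 (pdir A c f) w * (1 / 2) + pdir B \<i> (pdir A c f) w * (\<i> / 2)"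
    if c: "c \<in> {1, \<i>}" for c
  proof -
    have "pdir A c ?g w = pdir A c (pdir B 1 f) w * (1 / 2) + pdir A c (pdir B \<i> f) w * (\<i> / 2)"
      by (rule lin) (use s A c in auto)
    moreover have "pdir A c (pdir B d f) w = pdir B d (pdir A c f) w" if "d \<in> {1, \<i>}" for d
      by (rule pdir_commute[OF f A c B that w])
    ultimately show ?thesis by simp
  qed
  moreover have "pdir B c ?h w = pdir B c (pdir A 1 f) w * (1 / 2) + pdir B c (pdir A \<i> f) w * (- \<i> / 2)"
    if "c \<in> {1, \<i>}" for c
    by (rule lin) (use s B that in auto)
  ultimately show ?thesis
    by (simp only: insert_iff simp_thms) (simp add: field_simps)
qed

end


section \<open>Holomorphic functions are smooth\<close>

lemma continuous_on_locally:
  fixes f :: "'a::t2_space \<Rightarrow> 'b::topological_space"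
  assumes "\<And>w. w \<in> D \<Longrightarrow> \<exists>T. open T \<and> w \<in> T \<and> continuous_on (D \<inter> T) f"
  shows "continuous_on D f"
  unfolding continuous_on_eq_continuous_within
proof
  fix w assume w: "w \<in> D"
  then obtain T where T: "open T" "w \<in> T" "continuous_on (D \<inter> T) f" using assms by blast
  then have "at w within D = at w within (D \<inter> T)" by (intro at_within_nhd[of w T]) auto
  then show "continuous (at w within D) f"
    using T w by (simp add: continuous_on_eq_continuous_within)
qed

lemma holo_on_continuous: "holo_on N D f \<Longrightarrow> continuous_on D f"
  by (simp add: holo_on_def)

definition cderiv :: "nat \<Rightarrow> (cvec \<Rightarrow> complex) \<Rightarrow> cvec \<Rightarrow> complex" where
  "cderiv A f w = deriv (\<lambda>t. f (w(A := t))) (w A)"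

lemma holo_on_DERIV:
  assumes "holo_on N D f" "A < N" "w \<in> D"
  shows "((\<lambda>t. f (w(A := t))) has_field_derivative cderiv A f w) (at (w A))"
  using assms unfolding holo_on_def cderiv_def by (simp add: DERIV_deriv_iff_field_differentiable)

lemma holo_on_line:
  assumes "holo_on N D f" "A < N" "\<And>t. t \<in> T \<Longrightarrow> w(A := t) \<in> D"
  shows "(\<lambda>t. f (w(A := t))) holomorphic_on T"
  unfolding holomorphic_on_def
proof
  fix t assume "t \<in> T"
  then have "(\<lambda>s. f ((w(A := t))(A := s))) field_differentiable (at ((w(A := t)) A))"
    using assms unfolding holo_on_def by blast
  then show "(\<lambda>t. f (w(A := t))) field_differentiable at t within T"
    by (simp add: field_differentiable_at_within)
qed

text \<open>Taylor's formula of first order, with the second derivative bounded by Cauchy's estimate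
  on discs of radius r/2, whence the constant 2! M / (r/2)^2 = 8 M / r^2. The bound depends on
  \<open>u\<close> only through \<open>M\<close> and \<open>r\<close>, so it is uniform over the
  lines through a polydisc.\<close>

lemma difference_quotient_bound:
  fixes u :: "complex \<Rightarrow> complex"
  assumes u: "u holomorphic_on ball a (2 * r)" and M: "\<And>z. z \<in> ball a (2 * r) \<Longrightarrow> norm (u z) \<le> M"
    and h: "norm h < r / 2" "h \<noteq> 0"
  shows "norm ((u (a + h) - u a) / h - deriv u a) \<le> 8 * M / r\<^sup>2 * norm h"
proof -
  have r: "r > 0" using h norm_ge_zero[of h] by linarith
  let ?S = "ball a (r / 2)"
  have hol: "(deriv ^^ i) u holomorphic_on ball a (2 * r)" for i
    using u by (rule holomorphic_higher_deriv) auto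
  have der: "((deriv ^^ i) u has_field_derivative (deriv ^^ Suc i) u z) (at z within ?S)" if "z \<in> ?S" for i z
  proof -
    have "z \<in> ball a (2 * r)" using that r by auto
    then have "((deriv ^^ i) u has_field_derivative deriv ((deriv ^^ i) u) z) (at z)"
      using holomorphic_derivI[OF hol[of i] open_ball] by auto
    then show ?thesis by (simp add: has_field_derivative_at_within)
  qed
  have bound: "norm ((deriv ^^ Suc 1) u z) \<le> 8 * M / r\<^sup>2" if "z \<in> ?S" for z
  proof -
    have sub: "cball z (r / 2) \<subseteq> ball a (2 * r)"
    proof
      fix x assume "x \<in> cball z (r / 2)"
      then have "dist a x \<le> dist a z + dist z x" "dist z x \<le> r / 2" by (auto intro: dist_triangle)
      then show "x \<in> ball a (2 * r)" using that r by auto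
    qed
    have "norm ((deriv ^^ 2) u z) \<le> fact 2 * M / (r / 2) ^ 2"
    proof (rule Cauchy_inequality)
      show "u holomorphic_on ball z (r / 2)"
        using sub ball_subset_cball by (meson holomorphic_on_subset order_trans u)
      show "continuous_on (cball z (r / 2)) u"
        using sub u holomorphic_on_imp_continuous_on continuous_on_subset by blast
      fix x assume "norm (z - x) = r / 2"
      then show "norm (u x) \<le> M" using sub by (intro M) (auto simp: dist_norm subset_eq)
    qed (use r in auto)
    then show ?thesis by (simp add: numeral_2_eq_2 power2_eq_square field_simps)
  qed
  have "norm ((deriv ^^ 0) u (a + h) - (\<Sum>i\<le>1. (deriv ^^ i) u a * (a + h - a) ^ i / fact i)) \<le>
      8 * M / r\<^sup>2 * norm (a + h - a) ^ Suc 1 / fact 1"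
    using r h by (intro complex_Taylor[of ?S]) (use der bound in \<open>auto simp: dist_norm\<close>)
  then have "norm (u (a + h) - u a - deriv u a * h) \<le> 8 * M / r\<^sup>2 * (norm h * norm h)"
    by (simp add: algebra_simps)
  then have "norm (u (a + h) - u a - deriv u a * h) / norm h \<le> 8 * M / r\<^sup>2 * norm h"
    using h(2) by (simp add: field_simps)
  moreover have "(u (a + h) - u a) / h - deriv u a = (u (a + h) - u a - deriv u a * h) / h"
    using h(2) by (simp add: field_simps)
  ultimately show ?thesis by (simp add: norm_divide)
qed

text \<open>
  By Cauchy's estimate for the second derivative, the difference quotients converge locally
  uniformly, so that continuity and holomorphy pass to the limit.
\<close>

lemma holo_on_cderiv:
  assumes D: "rel_open N D" and f: "holo_on N D f" and A: "A < N"
  shows "holo_on N D (cderiv A f)"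
proof -
  have local: "\<exists>P. rel_open N P \<and> w0 \<in> P \<and> P \<subseteq> D \<and> holo_on N P (cderiv A f)" if w0: "w0 \<in> D" for w0
  proof -
    have w0C: "w0 \<in> Cn N" using w0 D rel_open_subset by auto
    have "continuous_on D f" using f by (rule holo_on_continuous)
    then have "rel_open N (D \<inter> f -` ball (f w0) 1)"
      by (intro openin_trans[OF continuous_openin_preimage_gen D] open_ball)
    then obtain R where R: "R > 0"
      "\<And>w. w \<in> Cn N \<Longrightarrow> (\<And>i. i < N \<Longrightarrow> norm (w i - w0 i) < R) \<Longrightarrow> w \<in> D \<inter> f -` ball (f w0) 1"
      using rel_open_polydisc[of N "D \<inter> f -` ball (f w0) 1" w0] w0 by auto
    \<comment> \<open>For \<open>w\<close> within \<open>r\<close> of \<open>w0\<close>, the disc of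
      radius \<open>2 * r\<close> around \<open>w A\<close> then stays within \<open>R\<close> of
      \<open>w0 A\<close>, where \<open>f\<close> is bounded by \<open>M\<close>.\<close>
    define r where "r = R / 3"
    define M where "M = norm (f w0) + 1"
    have r: "r > 0" using R by (simp add: r_def)
    define P where "P = {w \<in> Cn N. \<forall>i<N. norm (w i - w0 i) < r}"
    have P: "rel_open N P" "w0 \<in> P" unfolding P_def using polydisc_rel_open[OF w0C] w0C r by auto
    have big: "w(A := t) \<in> D" "norm (f (w(A := t))) \<le> M" if "w \<in> P" "norm (t - w A) < 2 * r" for w t
    proof -
      have "w(A := t) \<in> D \<inter> f -` ball (f w0) 1"
      proof (rule R(2))
        show "w(A := t) \<in> Cn N" using that A by (auto simp: P_def intro: Cn_upd)
        fix i assume i: "i < N"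
        have w: "norm (w i - w0 i) < r" using that i by (auto simp: P_def)
        have "norm (t - w0 A) \<le> norm (t - w A) + norm (w A - w0 A)"
          using norm_triangle_ineq[of "t - w A" "w A - w0 A"] by simp
        then show "norm ((w(A := t)) i - w0 i) < R" using w that r by (auto simp: r_def)
      qed
      then show "w(A := t) \<in> D" "norm (f (w(A := t))) \<le> M"
        using norm_triangle_ineq2[of "f (w(A := t))" "f w0"]
        by (auto simp: M_def dist_norm norm_minus_commute)
    qed
    have PD: "P \<subseteq> D"
    proof
      fix w assume "w \<in> P"
      then show "w \<in> D" using big(1)[of w "w A"] r by simp
    qed
    \<comment> \<open>Nonzero steps below \<open>r / 2\<close> that tend to 0, so that
      \<open>difference_quotient_bound\<close> covers all of them.\<close>
    define h where "h m = complex_of_real (r / (2 * (real m + 2)))" for m :: nat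
    have h: "norm (h m) < r / 2" "h m \<noteq> 0" for m
      unfolding h_def norm_of_real of_real_eq_0_iff using r by (auto simp: field_simps intro!: add_pos_nonneg)
    define q where "q m w = (f (w(A := w A + h m)) - f w) / h m" for m w
    have q_bound: "norm (q m w - cderiv A f w) \<le> 8 * M / r\<^sup>2 * norm (h m)" if "w \<in> P" for m w
    proof -
      have "norm ((f (w(A := w A + h m)) - f (w(A := w A))) / h m - deriv (\<lambda>t. f (w(A := t))) (w A))
          \<le> 8 * M / r\<^sup>2 * norm (h m)"
        using big[OF that]
        by (intro difference_quotient_bound[where u = "\<lambda>t. f (w(A := t))"] holo_on_line[OF f A] h)
           (auto simp: dist_norm norm_minus_commute)
      then show ?thesis by (simp add: q_def cderiv_def)
    qed
    have h0: "(\<lambda>m. 8 * M / r\<^sup>2 * norm (h m)) \<longlonglongrightarrow> 0"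
    proof -
      have "(\<lambda>m. r / (2 * (real m + 2))) \<longlonglongrightarrow> 0" by real_asymp
      from tendsto_of_real[OF this] have "h \<longlonglongrightarrow> 0" by (simp only: h_def[abs_def] of_real_0)
      then show ?thesis by (intro tendsto_mult_right_zero tendsto_norm_zero)
    qed
    have unif: "uniform_limit P q (cderiv A f) sequentially"
    proof (rule uniform_limitI)
      fix e :: real assume "e > 0"
      with h0 have "eventually (\<lambda>m. 8 * M / r\<^sup>2 * norm (h m) < e) sequentially"
        by (rule order_tendstoD(2))
      then show "\<forall>\<^sub>F m in sequentially. \<forall>w\<in>P. dist (q m w) (cderiv A f w) < e"
        by eventually_elim (auto simp: dist_norm intro: le_less_trans[OF q_bound])
    qed
    have inD: "w(A := w A + h m) \<in> D" if "w \<in> P" for w m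
      using big(1)[OF that, of "w A + h m"] h(1)[of m] r by simp
    have q_cont: "continuous_on P (q m)" for m
    proof -
      have "continuous_on P (\<lambda>w. w(A := w A + h m))"
      proof (rule continuous_on_coordinatewise_then_product)
        show "continuous_on P (\<lambda>w. (w(A := w A + h m)) i)" for i
          using continuous_on_product_then_coordinatewise[OF continuous_on_id]
          by (cases "i = A") (auto intro!: continuous_intros)
      qed
      then have "continuous_on P (\<lambda>w. f (w(A := w A + h m)))"
        by (rule continuous_on_compose2[OF holo_on_continuous[OF f]]) (use inD in auto)
      then show ?thesis
        unfolding q_def using h(2) PD continuous_on_subset[OF holo_on_continuous[OF f]]
        by (auto intro!: continuous_intros)
    qed
    have "continuous_on P (cderiv A f)"
      by (rule uniform_limit_theorem[OF _ unif]) (use q_cont in auto)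
    moreover have "(\<lambda>t. cderiv A f (w(B := t))) field_differentiable (at (w B))" if B: "B < N" and w: "w \<in> P" for B w
    proof -
      obtain \<rho> where \<rho>: "\<rho> > 0" "\<And>w'. w' \<in> Cn N \<Longrightarrow> (\<And>i. i < N \<Longrightarrow> norm (w' i - w i) < \<rho>) \<Longrightarrow> w' \<in> P"
        using rel_open_polydisc[OF P(1) w] by metis
      have wC: "w \<in> Cn N" using w by (auto simp: P_def)
      have inP: "w(B := t) \<in> P" if "t \<in> cball (w B) (\<rho> / 2)" for t
        using that \<rho>(1) B wC by (intro \<rho>(2)) (auto simp: dist_norm norm_minus_commute intro!: Cn_upd)
      have q_hol: "(\<lambda>t. q m (w(B := t))) holomorphic_on cball (w B) (\<rho> / 2)" for m
      proof -
        have 1: "(\<lambda>t. f (w(B := t))) holomorphic_on cball (w B) (\<rho> / 2)"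
          using inP PD by (intro holo_on_line[OF f B]) auto
        have 2: "(\<lambda>t. f ((w(B := t))(A := (w(B := t)) A + h m))) holomorphic_on cball (w B) (\<rho> / 2)"
        \<comment> \<open>If \<open>A \<noteq> B\<close>, the step \<open>h m\<close> and the
          variable \<open>t\<close> sit in different coordinates; if \<open>A = B\<close>, the step
          becomes a translation of \<open>t\<close>.\<close>
        proof (cases "A = B")
          case False
          have "(\<lambda>t. f ((w(A := w A + h m))(B := t))) holomorphic_on cball (w B) (\<rho> / 2)"
          proof (rule holo_on_line[OF f B])
            fix t assume "t \<in> cball (w B) (\<rho> / 2)"
            from inD[OF inP[OF this], of m] False show "(w(A := w A + h m))(B := t) \<in> D"
              by (simp add: fun_upd_twist)
          qed
          then show ?thesis using False by (simp add: fun_upd_twist)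
        next
          case True
          have "(\<lambda>t. f (w(B := t))) holomorphic_on ((\<lambda>t. t + h m) ` cball (w B) (\<rho> / 2))"
          proof (rule holo_on_line[OF f B])
            fix t assume "t \<in> (\<lambda>t. t + h m) ` cball (w B) (\<rho> / 2)"
            then obtain s where s: "s \<in> cball (w B) (\<rho> / 2)" "t = s + h m" by auto
            from inD[OF inP[OF s(1)], of m] True s(2) show "w(B := t) \<in> D" by simp
          qed
          then have "((\<lambda>t. f (w(B := t))) \<circ> (\<lambda>t. t + h m)) holomorphic_on cball (w B) (\<rho> / 2)"
            by (intro holomorphic_on_compose holomorphic_intros)
          then show ?thesis using True by (simp add: o_def)
        qed
        show ?thesis unfolding q_def using 1 2 h(2) by (intro holomorphic_intros) auto
      qed
      have ulim: "uniform_limit (cball (w B) (\<rho> / 2)) (\<lambda>m t. q m (w(B := t))) (\<lambda>t. cderiv A f (w(B := t))) sequentially"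
        using unif inP unfolding uniform_limit_iff by (auto elim!: eventually_mono)
      have cont: "\<forall>\<^sub>F m in sequentially. continuous_on (cball (w B) (\<rho> / 2)) (\<lambda>t. q m (w(B := t))) \<and>
          (\<lambda>t. q m (w(B := t))) holomorphic_on ball (w B) (\<rho> / 2)"
        using q_hol by (intro always_eventually allI conjI)
          (auto intro: holomorphic_on_imp_continuous_on holomorphic_on_subset[OF _ ball_subset_cball])
      have "(\<lambda>t. cderiv A f (w(B := t))) holomorphic_on ball (w B) (\<rho> / 2)"
        by (rule holomorphic_uniform_limit[OF cont ulim sequentially_bot])
      then show ?thesis
        using \<rho>(1) by (auto simp: holomorphic_on_open field_differentiable_def)
    qed
    ultimately have "holo_on N P (cderiv A f)" by (simp add: holo_on_def)
    with P PD show ?thesis by auto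
  qed
  have "continuous_on D (cderiv A f)"
  proof (rule continuous_on_locally)
    fix w assume "w \<in> D"
    from local[OF this] obtain P where P: "rel_open N P" "w \<in> P" "P \<subseteq> D" "continuous_on P (cderiv A f)"
      by (auto simp: holo_on_def)
    from P(1) obtain T where T: "open T" "P = Cn N \<inter> T" by (auto simp: openin_open)
    then have "D \<inter> T = P" using P(3) rel_open_subset[OF D] by auto
    with T P(2,4) show "\<exists>T. open T \<and> w \<in> T \<and> continuous_on (D \<inter> T) (cderiv A f)" by auto
  qed
  then show ?thesis using local unfolding holo_on_def by blast
qed

lemma holo_on_pline:
  assumes "holo_on N D f" "A < N" "w \<in> D"
  shows "(pline A c f w has_vector_derivative c * cderiv A f w) (at 0)"
proof -
  have "((\<lambda>t. w A + of_real t * c) has_vector_derivative c) (at 0)"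
    by (auto intro!: derivative_eq_intros)
  then show ?thesis
    using field_vector_diff_chain_at[of "\<lambda>t. w A + of_real t * c" c 0 "\<lambda>t. f (w(A := t))" "cderiv A f w"]
      holo_on_DERIV[OF assms] by (simp add: pline_def o_def)
qed

text \<open>The real derivative in direction \<open>c\<close> is \<open>c * cderiv A f\<close>, and
  \<open>cderiv A f\<close> is holomorphic again, so all orders follow by induction.\<close>

lemma holo_on_smooth:
  assumes D: "rel_open N D" and f: "holo_on N D f"
  shows "smooth_on N D f"
proof -
  have "Ck_on k N D f" for k
    using f
  proof (induction k arbitrary: f)
    case (Suc k)
    show ?case
    proof (rule Ck_on_SucI[OF D, where f' = "\<lambda>A c w. c * cderiv A f w"])
      show "continuous_on D f" using Suc.prems by (rule holo_on_continuous)
      show "(pline A c f w has_vector_derivative c * cderiv A f w) (at 0)" if "A < N" "w \<in> D" for A c w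
        using Suc.prems that by (rule holo_on_pline)
      show "Ck_on k N D (\<lambda>w. c * cderiv A f w)" if "A < N" for A c
        by (intro Ck_on_mult[OF D] Ck_on_const[OF D] Suc.IH holo_on_cderiv[OF D Suc.prems that])
    qed
  qed (simp add: holo_on_continuous)
  then show ?thesis by (simp add: smooth_on_def)
qed

text \<open>The Cauchy-Riemann equations: the derivatives along 1 and \<open>\<i>\<close> are f' and
  \<open>\<i>\<close> f', which cancel in \<open>wdelbar\<close>.\<close>

lemma holo_on_wdelbar:
  assumes "holo_on N D f" "A < N" "w \<in> D"
  shows "wdelbar A f w = 0"
  using pdir_eqI[OF holo_on_pline[OF assms]] by (simp add: wdelbar_def mult.assoc[symmetric])


section \<open>Matrix-valued functions\<close>


lemma mat_adjoint_carrier: "A \<in> carrier_mat r c \<Longrightarrow> mat_adjoint A \<in> carrier_mat c r"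
  by (auto simp: mat_adjoint_def)

lemma mat_adjoint_index:
  "A \<in> carrier_mat r c \<Longrightarrow> i < c \<Longrightarrow> j < r \<Longrightarrow> mat_adjoint A $$ (i, j) = cnj (A $$ (j, i))"
  by (auto simp: mat_adjoint_def mat_of_rows_def conjugate_complex_def)

lemma mult_mat_index:
  assumes "A \<in> carrier_mat r s" "B \<in> carrier_mat s t" "p < r" "q < t"
  shows "(A * B) $$ (p, q) = (\<Sum>k<s. A $$ (p, k) * B $$ (k, q))"
  using assms by (simp add: scalar_prod_def lessThan_atLeast0)

lemma add_mat_index:
    "A \<in> carrier_mat r s \<Longrightarrow> B \<in> carrier_mat r s \<Longrightarrow> p < r \<Longrightarrow> q < s \<Longrightarrow> (A + B) $$ (p, q) = A $$ (p, q) + B $$ (p, q)"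
  and diff_mat_index:
    "A \<in> carrier_mat r s \<Longrightarrow> B \<in> carrier_mat r s \<Longrightarrow> p < r \<Longrightarrow> q < s \<Longrightarrow> (A - B) $$ (p, q) = A $$ (p, q) - B $$ (p, q)"
  and uminus_mat_index:
    "A \<in> carrier_mat r s \<Longrightarrow> p < r \<Longrightarrow> q < s \<Longrightarrow> (- A) $$ (p, q) = - A $$ (p, q)"
  by auto

lemma mtrace_mult:
  assumes "A \<in> carrier_mat r s" "B \<in> carrier_mat s r"
  shows "mtrace (A * B) = (\<Sum>p<r. \<Sum>q<s. A $$ (p, q) * B $$ (q, p))"
  using assms by (simp add: mtrace_def mult_mat_index[OF assms] del: index_mult_mat(1))

lemma mtrace_mult_comm:
  assumes "A \<in> carrier_mat r s" "B \<in> carrier_mat s r"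
  shows "mtrace (A * B) = mtrace (B * A)"
  unfolding mtrace_mult[OF assms] mtrace_mult[OF assms(2,1)] by (subst sum.swap) (simp add: mult.commute)

lemma mtrace_add: "A \<in> carrier_mat r r \<Longrightarrow> B \<in> carrier_mat r r \<Longrightarrow> mtrace (A + B) = mtrace A + mtrace B"
  and mtrace_minus: "A \<in> carrier_mat r r \<Longrightarrow> B \<in> carrier_mat r r \<Longrightarrow> mtrace (A - B) = mtrace A - mtrace B"
  by (auto simp: mtrace_def sum.distrib sum_subtractf sum_negf)

lemma minv_unique:
  assumes A: "(A :: complex mat) \<in> carrier_mat n n" and B: "B \<in> carrier_mat n n" "A * B = 1\<^sub>m n" "B * A = 1\<^sub>m n"
  shows "minv A = B"
  unfolding minv_def
proof (rule the_equality)
  show "B \<in> carrier_mat (dim_row A) (dim_row A) \<and> inverts_mat A B \<and> inverts_mat B A"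
    using A B by (auto simp: inverts_mat_def)
  fix C assume "C \<in> carrier_mat (dim_row A) (dim_row A) \<and> inverts_mat A C \<and> inverts_mat C A"
  then have C: "C \<in> carrier_mat n n" "A * C = 1\<^sub>m n" using A by (auto simp: inverts_mat_def)
  have "C = (B * A) * C" using B C by simp
  also have "\<dots> = B * (A * C)" using A B C by (intro assoc_mult_mat) auto
  finally show "C = B" using B C by simp
qed

lemma smult_smult_mat: "a \<cdot>\<^sub>m (b \<cdot>\<^sub>m A) = (a * b :: complex) \<cdot>\<^sub>m A"
  and one_smult_mat: "1 \<cdot>\<^sub>m A = (A :: complex mat)"
  by (rule eq_matI; simp)+

text \<open>Replaces the definite description in \<open>minv\<close> by determinants in the entries,
  from which smoothness can be seen.\<close>

lemma minv_adj_mat: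
  assumes A: "(A :: complex mat) \<in> carrier_mat n n" and d: "Determinant.det A \<noteq> 0"
  shows "minv A = inverse (Determinant.det A) \<cdot>\<^sub>m adj_mat A"
  using adj_mat[OF A] d
  by (intro minv_unique[OF A]) (auto simp: mult_smult_distrib[OF A] mult_smult_assoc_mat[OF _ A] smult_smult_mat one_smult_mat)

lemma minv_inverse:
  assumes A: "(A :: complex mat) \<in> carrier_mat n n" and d: "Determinant.det A \<noteq> 0"
  shows "minv A \<in> carrier_mat n n" "A * minv A = 1\<^sub>m n" "minv A * A = 1\<^sub>m n"
  using adj_mat[OF A] d unfolding minv_adj_mat[OF assms]
  by (auto simp: mult_smult_distrib[OF A] mult_smult_assoc_mat[OF _ A] smult_smult_mat one_smult_mat)

text \<open>A nonzero vector in the kernel would be one on which the positive form vanishes.\<close>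

lemma herm_pos_det:
  assumes "herm_pos r H"
  shows "Determinant.det H \<noteq> 0"
proof
  have H: "H \<in> carrier_mat r r"
    and pos: "\<And>v :: nat \<Rightarrow> complex. \<exists>p<r. v p \<noteq> 0 \<Longrightarrow> 0 < Re (\<Sum>p<r. \<Sum>q<r. cnj (v p) * H $$ (p, q) * v q)"
    using assms by (auto simp: herm_pos_def)
  assume "Determinant.det H = 0"
  then obtain v where v: "v \<in> carrier_vec r" "v \<noteq> 0\<^sub>v r" "H *\<^sub>v v = 0\<^sub>v r"
    using det_0_iff_vec_prod_zero_field[OF H] by blast
  have ex: "\<exists>p<r. vec_index v p \<noteq> 0"
  proof (rule ccontr)
    assume "\<not> (\<exists>p<r. vec_index v p \<noteq> 0)"
    then have "v = 0\<^sub>v r" using v(1) by (intro eq_vecI) auto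
    with v(2) show False by simp
  qed
  have "(\<Sum>q<r. H $$ (p, q) * vec_index v q) = 0" if "p < r" for p
  proof -
    have "(\<Sum>q<r. H $$ (p, q) * vec_index v q) = vec_index (H *\<^sub>v v) p"
      using that H v(1) by (simp add: scalar_prod_def lessThan_atLeast0)
    then show ?thesis using v(3) that by simp
  qed
  then have "(\<Sum>p<r. \<Sum>q<r. cnj (vec_index v p) * H $$ (p, q) * vec_index v q) = 0"
    by (simp add: sum_distrib_left[symmetric] mult.assoc)
  with pos[OF ex] show False by simp
qed

section \<open>Smooth matrix-valued functions and their derivatives\<close>

definition smooth_mat :: "nat \<Rightarrow> cvec set \<Rightarrow> nat \<Rightarrow> nat \<Rightarrow> (cvec \<Rightarrow> complex mat) \<Rightarrow> bool" where
  "smooth_mat N D r c F \<longleftrightarrow> (\<forall>w\<in>D. F w \<in> carrier_mat r c) \<and>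
     (\<forall>p<r. \<forall>q<c. smooth_on N D (\<lambda>w. F w $$ (p, q)))"

lemma smooth_mat_carrier: "smooth_mat N D r c F \<Longrightarrow> w \<in> D \<Longrightarrow> F w \<in> carrier_mat r c"
  and smooth_mat_entry: "smooth_mat N D r c F \<Longrightarrow> p < r \<Longrightarrow> q < c \<Longrightarrow> smooth_on N D (\<lambda>w. F w $$ (p, q))"
  by (auto simp: smooth_mat_def)

text \<open>Either of the two kinds of Wirtinger derivatives, so that the product rules are proved once.\<close>

definition wirtinger :: "nat \<Rightarrow> ((cvec \<Rightarrow> complex) \<Rightarrow> cvec \<Rightarrow> complex) \<Rightarrow> bool" where
  "wirtinger N \<delta> \<longleftrightarrow> (\<exists>A<N. \<delta> = wdel A \<or> \<delta> = wdelbar A)"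

lemma wirtinger_wdel: "A < N \<Longrightarrow> wirtinger N (wdel A)"
  and wirtinger_wdelbar: "A < N \<Longrightarrow> wirtinger N (wdelbar A)"
  by (auto simp: wirtinger_def)

context
  fixes N :: nat and D :: "cvec set"
  assumes D: "rel_open N D"
begin

lemma smooth_on_transform: "smooth_on N D g \<Longrightarrow> (\<And>w. w \<in> D \<Longrightarrow> f w = g w) \<Longrightarrow> smooth_on N D f"
  using smooth_on_cong[OF D] by blast

lemma wirtinger_rules:
  assumes \<delta>: "wirtinger N \<delta>" and w: "w \<in> D"
  shows "(\<And>w. w \<in> D \<Longrightarrow> f w = g w) \<Longrightarrow> \<delta> f w = \<delta> g w"
    and "\<delta> (\<lambda>w. a) w = 0"
    and "smooth_on N D f \<Longrightarrow> smooth_on N D g \<Longrightarrow> \<delta> (\<lambda>w. f w + g w) w = \<delta> f w + \<delta> g w"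
    and "smooth_on N D f \<Longrightarrow> smooth_on N D g \<Longrightarrow> \<delta> (\<lambda>w. f w * g w) w = \<delta> f w * g w + f w * \<delta> g w"
    and "(\<And>x. x \<in> S \<Longrightarrow> smooth_on N D (h x)) \<Longrightarrow> \<delta> (\<lambda>w. \<Sum>x\<in>S. h x w) w = (\<Sum>x\<in>S. \<delta> (h x) w)"
proof -
  obtain A where A: "A < N" "\<delta> = wdel A \<or> \<delta> = wdelbar A" using \<delta> by (auto simp: wirtinger_def)
  show "\<delta> f w = \<delta> g w" if "\<And>w. w \<in> D \<Longrightarrow> f w = g w"
    using A(2) wdel_cong[OF D A(1) w that] by auto
  show "\<delta> (\<lambda>w. a) w = 0" using A(2) wdel_const[OF D, of A a w] by auto
  show "\<delta> (\<lambda>w. f w + g w) w = \<delta> f w + \<delta> g w" if "smooth_on N D f" "smooth_on N D g"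
    using A(2) wdel_add[OF D that A(1) w] by auto
  show "\<delta> (\<lambda>w. f w * g w) w = \<delta> f w * g w + f w * \<delta> g w" if "smooth_on N D f" "smooth_on N D g"
    using A(2) wdel_mult[OF D that A(1) w] by auto
  show "\<delta> (\<lambda>w. \<Sum>x\<in>S. h x w) w = (\<Sum>x\<in>S. \<delta> (h x) w)" if "\<And>x. x \<in> S \<Longrightarrow> smooth_on N D (h x)"
    using A(2) wdel_sum[OF D that A(1) w] by auto
qed

lemma wirtinger_smooth: "wirtinger N \<delta> \<Longrightarrow> smooth_on N D f \<Longrightarrow> smooth_on N D (\<delta> f)"
  unfolding wirtinger_def by (auto intro: smooth_on_wdel[OF D] smooth_on_wdelbar[OF D])

lemma wirtinger_diff:
  assumes "wirtinger N \<delta>" "w \<in> D" "smooth_on N D f" "smooth_on N D g"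
  shows "\<delta> (\<lambda>w. f w - g w) w = \<delta> f w - \<delta> g w"
proof -
  note c = smooth_on_const[OF D, of "-1"]
  have "\<delta> (\<lambda>w. f w + (-1) * g w) w = \<delta> f w + \<delta> (\<lambda>w. (-1) * g w) w"
    by (rule wirtinger_rules(3)[OF assms(1-3) smooth_on_mult[OF D c assms(4)]])
  also have "\<delta> (\<lambda>w. (-1) * g w) w = \<delta> (\<lambda>w. -1) w * g w + (-1) * \<delta> g w"
    by (rule wirtinger_rules(4)[OF assms(1,2) c assms(4)])
  also have "\<delta> (\<lambda>w. -1) w = 0"
    by (rule wirtinger_rules(2)[OF assms(1,2)])
  finally show ?thesis by simp
qed

lemma smooth_matI:
  assumes "\<And>w. w \<in> D \<Longrightarrow> F w \<in> carrier_mat r s"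
    and "\<And>p q. p < r \<Longrightarrow> q < s \<Longrightarrow> smooth_on N D (f p q)"
    and "\<And>p q w. p < r \<Longrightarrow> q < s \<Longrightarrow> w \<in> D \<Longrightarrow> F w $$ (p, q) = f p q w"
  shows "smooth_mat N D r s F"
  unfolding smooth_mat_def using assms(1) by (auto intro: smooth_on_transform[OF assms(2)] assms(3))

lemma smooth_mat_mult:
  assumes F: "smooth_mat N D r s F" and G: "smooth_mat N D s t G"
  shows "smooth_mat N D r t (\<lambda>w. F w * G w)"
proof (rule smooth_matI)
  show "F w * G w \<in> carrier_mat r t" if "w \<in> D" for w
    using smooth_mat_carrier[OF F that] smooth_mat_carrier[OF G that] by simp
  show "(F w * G w) $$ (p, q) = (\<Sum>k<s. F w $$ (p, k) * G w $$ (k, q))" if "p < r" "q < t" "w \<in> D" for p q w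
    by (rule mult_mat_index[OF smooth_mat_carrier[OF F that(3)] smooth_mat_carrier[OF G that(3)] that(1,2)])
qed (auto intro!: smooth_on_sum[OF D] smooth_on_mult[OF D] smooth_mat_entry[OF F] smooth_mat_entry[OF G])

lemma smooth_mat_add:
  assumes F: "smooth_mat N D r s F" and G: "smooth_mat N D r s G"
  shows "smooth_mat N D r s (\<lambda>w. F w + G w)"
  by (rule smooth_matI[where f = "\<lambda>p q w. F w $$ (p, q) + G w $$ (p, q)"])
     (rule add_carrier_mat smooth_on_add[OF D] add_mat_index smooth_mat_carrier[OF F] smooth_mat_carrier[OF G]
        smooth_mat_entry[OF F] smooth_mat_entry[OF G] | assumption)+

lemma smooth_mat_diff:
  assumes F: "smooth_mat N D r s F" and G: "smooth_mat N D r s G"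
  shows "smooth_mat N D r s (\<lambda>w. F w - G w)"
  by (rule smooth_matI[where f = "\<lambda>p q w. F w $$ (p, q) - G w $$ (p, q)"])
     (rule minus_carrier_mat smooth_on_diff[OF D] diff_mat_index smooth_mat_carrier[OF F] smooth_mat_carrier[OF G]
        smooth_mat_entry[OF F] smooth_mat_entry[OF G] | assumption)+

lemma smooth_mat_uminus:
  assumes F: "smooth_mat N D r s F"
  shows "smooth_mat N D r s (\<lambda>w. - F w)"
  by (rule smooth_matI[where f = "\<lambda>p q w. - F w $$ (p, q)"])
     (rule uminus_carrier_iff_mat[THEN iffD2] smooth_on_minus[OF D] uminus_mat_index smooth_mat_carrier[OF F]
        smooth_mat_entry[OF F] | assumption)+

lemma smooth_mat_adjoint:
  assumes F: "smooth_mat N D r s F"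
  shows "smooth_mat N D s r (\<lambda>w. mat_adjoint (F w))"
  by (rule smooth_matI[where f = "\<lambda>p q w. cnj (F w $$ (q, p))"])
     (rule mat_adjoint_carrier smooth_on_cnj[OF D] mat_adjoint_index smooth_mat_carrier[OF F] smooth_mat_entry[OF F] | assumption)+

lemma dmat_carrier: "smooth_mat N D r s F \<Longrightarrow> w \<in> D \<Longrightarrow> dmat \<delta> F w \<in> carrier_mat r s"
  by (drule (1) smooth_mat_carrier) (simp add: dmat_def)

lemma dmat_index:
  "smooth_mat N D r s F \<Longrightarrow> w \<in> D \<Longrightarrow> p < r \<Longrightarrow> q < s \<Longrightarrow> dmat \<delta> F w $$ (p, q) = \<delta> (\<lambda>w. F w $$ (p, q)) w"
  by (drule (1) smooth_mat_carrier) (simp add: dmat_def)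

text \<open>Reduces derivatives of matrices to entries. The formulas \<open>f p q\<close> have to
  hold on all of \<open>D\<close>, since they are differentiated.\<close>

lemma dmat_eqI:
  assumes F: "smooth_mat N D r s F" and w: "w \<in> D" and \<delta>: "wirtinger N \<delta>" and M: "M \<in> carrier_mat r s"
    and f: "\<And>p q w. p < r \<Longrightarrow> q < s \<Longrightarrow> w \<in> D \<Longrightarrow> F w $$ (p, q) = f p q w"
      "\<And>p q. p < r \<Longrightarrow> q < s \<Longrightarrow> \<delta> (f p q) w = M $$ (p, q)"
  shows "dmat \<delta> F w = M"
proof (rule eq_matI)
  fix p q assume "p < dim_row M" "q < dim_col M"
  then have pq: "p < r" "q < s" using M by auto
  have "\<delta> (\<lambda>w. F w $$ (p, q)) w = \<delta> (f p q) w" by (rule wirtinger_rules(1)[OF \<delta> w f(1)[OF pq]])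
  then show "dmat \<delta> F w $$ (p, q) = M $$ (p, q)" by (simp add: dmat_index[OF F w pq] f(2)[OF pq])
qed (use dmat_carrier[OF F w, of \<delta>] M in auto)

lemma smooth_mat_dmat:
  assumes \<delta>: "wirtinger N \<delta>" and F: "smooth_mat N D r s F"
  shows "smooth_mat N D r s (dmat \<delta> F)"
  by (rule smooth_matI[where f = "\<lambda>p q. \<delta> (\<lambda>w. F w $$ (p, q))"])
     (rule dmat_carrier[OF F] wirtinger_smooth[OF \<delta> smooth_mat_entry[OF F]] dmat_index[OF F] | assumption)+

lemma dmat_cong:
  assumes \<delta>: "wirtinger N \<delta>" and F: "smooth_mat N D r s F" and eq: "\<And>w. w \<in> D \<Longrightarrow> F w = G w" and w: "w \<in> D"
  shows "dmat \<delta> F w = dmat \<delta> G w"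
  unfolding dmat_def eq[OF w]
  by (intro cong_mat) (auto intro!: wirtinger_rules(1)[OF \<delta> w] simp: eq)

lemma dmat_mult:
  assumes \<delta>: "wirtinger N \<delta>" and F: "smooth_mat N D r s F" and G: "smooth_mat N D s t G" and w: "w \<in> D"
  shows "dmat \<delta> (\<lambda>w. F w * G w) w = dmat \<delta> F w * G w + F w * dmat \<delta> G w"
proof (rule dmat_eqI[OF smooth_mat_mult[OF F G] w \<delta>])
  note c = smooth_mat_carrier[OF F w] smooth_mat_carrier[OF G w] dmat_carrier[OF F w, of \<delta>]
    dmat_carrier[OF G w, of \<delta>]
  show "dmat \<delta> F w * G w + F w * dmat \<delta> G w \<in> carrier_mat r t" using c by auto
  fix p q assume pq: "p < r" "q < t"
  show "(F w * G w) $$ (p, q) = (\<Sum>k<s. F w $$ (p, k) * G w $$ (k, q))" if "w \<in> D" for w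
    by (rule mult_mat_index[OF smooth_mat_carrier[OF F that] smooth_mat_carrier[OF G that] pq])
  have "\<delta> (\<lambda>w. \<Sum>k<s. F w $$ (p, k) * G w $$ (k, q)) w = (\<Sum>k<s. \<delta> (\<lambda>w. F w $$ (p, k) * G w $$ (k, q)) w)"
    using pq by (intro wirtinger_rules(5)[OF \<delta> w] smooth_on_mult[OF D] smooth_mat_entry[OF F] smooth_mat_entry[OF G]) auto
  also have "\<dots> = (\<Sum>k<s. dmat \<delta> F w $$ (p, k) * G w $$ (k, q) + F w $$ (p, k) * dmat \<delta> G w $$ (k, q))"
    using pq by (intro sum.cong refl)
      (simp add: wirtinger_rules(4)[OF \<delta> w] smooth_mat_entry[OF F] smooth_mat_entry[OF G] dmat_index[OF F w] dmat_index[OF G w])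
  also have "\<dots> = (dmat \<delta> F w * G w + F w * dmat \<delta> G w) $$ (p, q)"
    using pq c by (subst index_add_mat)
      (auto simp: mult_mat_index[OF c(3,2)] mult_mat_index[OF c(1,4)] sum.distrib simp del: index_mult_mat(1))
  finally show "\<delta> (\<lambda>w. \<Sum>k<s. F w $$ (p, k) * G w $$ (k, q)) w = (dmat \<delta> F w * G w + F w * dmat \<delta> G w) $$ (p, q)" .
qed

lemma dmat_add:
  assumes \<delta>: "wirtinger N \<delta>" and F: "smooth_mat N D r s F" and G: "smooth_mat N D r s G" and w: "w \<in> D"
  shows "dmat \<delta> (\<lambda>w. F w + G w) w = dmat \<delta> F w + dmat \<delta> G w"
  by (rule dmat_eqI[OF smooth_mat_add[OF F G] w \<delta> add_carrier_mat[OF dmat_carrier[OF G w]]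
        add_mat_index[OF smooth_mat_carrier[OF F] smooth_mat_carrier[OF G]]])
     (simp_all add: wirtinger_rules(3)[OF \<delta> w] smooth_mat_entry[OF F] smooth_mat_entry[OF G]
        dmat_index[OF F w] dmat_index[OF G w] add_mat_index[OF dmat_carrier[OF F w] dmat_carrier[OF G w]])

lemma dmat_diff:
  assumes \<delta>: "wirtinger N \<delta>" and F: "smooth_mat N D r s F" and G: "smooth_mat N D r s G" and w: "w \<in> D"
  shows "dmat \<delta> (\<lambda>w. F w - G w) w = dmat \<delta> F w - dmat \<delta> G w"
  by (rule dmat_eqI[OF smooth_mat_diff[OF F G] w \<delta> minus_carrier_mat[OF dmat_carrier[OF G w]]
        diff_mat_index[OF smooth_mat_carrier[OF F] smooth_mat_carrier[OF G]]])
     (simp_all add: wirtinger_diff[OF \<delta> w] smooth_mat_entry[OF F] smooth_mat_entry[OF G]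
        dmat_index[OF F w] dmat_index[OF G w] diff_mat_index[OF dmat_carrier[OF F w] dmat_carrier[OF G w]])

lemma smooth_on_det:
  assumes F: "smooth_mat N D r r F"
  shows "smooth_on N D (\<lambda>w. Determinant.det (F w))"
proof -
  have "smooth_on N D (\<lambda>w. \<Sum>p\<in>{p. p permutes {0..<r}}. signof p * (\<Prod>i=0..<r. F w $$ (i, p i)))"
    by (intro smooth_on_sum[OF D] smooth_on_mult[OF D] smooth_on_const[OF D] smooth_on_prod[OF D] smooth_mat_entry[OF F])
       (auto dest: permutes_in_image)
  then show ?thesis
    by (rule smooth_on_transform) (rule det_def'[OF smooth_mat_carrier[OF F]])
qed

text \<open>Cramer's rule: an entry of the inverse is a signed minor, a polynomial in the entries,
  times the inverse of a nonvanishing determinant.\<close>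

lemma smooth_mat_minv:
  assumes F: "smooth_mat N D r r F" and det: "\<And>w. w \<in> D \<Longrightarrow> Determinant.det (F w) \<noteq> 0"
  shows "smooth_mat N D r r (\<lambda>w. minv (F w))"
proof (rule smooth_matI[where f = "\<lambda>p q w.
      inverse (Determinant.det (F w)) * ((-1) ^ (q + p) * Determinant.det (mat_delete (F w) q p))"])
  show "minv (F w) \<in> carrier_mat r r" if "w \<in> D" for w
    by (rule minv_inverse(1)[OF smooth_mat_carrier[OF F that] det[OF that]])
  fix p q assume pq: "p < r" "q < r"
  have del: "smooth_mat N D (r - 1) (r - 1) (\<lambda>w. mat_delete (F w) q p)"
  proof (rule smooth_matI[where f = "\<lambda>i j w. F w $$ (if i < q then i else Suc i, if j < p then j else Suc j)"])
    show "mat_delete (F w) q p \<in> carrier_mat (r - 1) (r - 1)" if "w \<in> D" for w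
      by (rule mat_delete_carrier[OF smooth_mat_carrier[OF F that]])
    fix i j assume ij: "i < r - 1" "j < r - 1"
    show "smooth_on N D (\<lambda>w. F w $$ (if i < q then i else Suc i, if j < p then j else Suc j))"
      using ij by (intro smooth_mat_entry[OF F]) auto
    show "mat_delete (F w) q p $$ (i, j) = F w $$ (if i < q then i else Suc i, if j < p then j else Suc j)"
      if "w \<in> D" for w
      using ij smooth_mat_carrier[OF F that] by (auto simp: mat_delete_def)
  qed
  show "smooth_on N D (\<lambda>w. inverse (Determinant.det (F w)) * ((-1) ^ (q + p) * Determinant.det (mat_delete (F w) q p)))"
    by (intro smooth_on_mult[OF D] smooth_on_const[OF D] smooth_on_inverse[OF D] smooth_on_det[OF F] smooth_on_det[OF del] det)
  show "minv (F w) $$ (p, q) = inverse (Determinant.det (F w)) * ((-1) ^ (q + p) * Determinant.det (mat_delete (F w) q p))"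
    if "w \<in> D" for w
    unfolding minv_adj_mat[OF smooth_mat_carrier[OF F that] det[OF that]]
    using smooth_mat_carrier[OF F that] pq by (simp add: adj_mat_def cofactor_def)
qed

lemma smooth_on_mtrace:
  assumes F: "smooth_mat N D r r F"
  shows "smooth_on N D (\<lambda>w. mtrace (F w))"
proof -
  have "smooth_on N D (\<lambda>w. \<Sum>p<r. F w $$ (p, p))"
    by (intro smooth_on_sum[OF D] smooth_mat_entry[OF F]) auto
  then show ?thesis
  proof (rule smooth_on_transform)
    show "mtrace (F w) = (\<Sum>p<r. F w $$ (p, p))" if "w \<in> D" for w
      using smooth_mat_carrier[OF F that] by (simp add: mtrace_def)
  qed
qed

lemma wirtinger_mtrace:
  assumes \<delta>: "wirtinger N \<delta>" and F: "smooth_mat N D r r F" and w: "w \<in> D"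
  shows "\<delta> (\<lambda>w. mtrace (F w)) w = mtrace (dmat \<delta> F w)"
proof -
  have "\<delta> (\<lambda>w. mtrace (F w)) w = \<delta> (\<lambda>w. \<Sum>p<r. F w $$ (p, p)) w"
  proof (rule wirtinger_rules(1)[OF \<delta> w])
    show "mtrace (F w) = (\<Sum>p<r. F w $$ (p, p))" if "w \<in> D" for w
      using smooth_mat_carrier[OF F that] by (simp add: mtrace_def)
  qed
  also have "\<dots> = (\<Sum>p<r. dmat \<delta> F w $$ (p, p))"
    by (subst wirtinger_rules(5)[OF \<delta> w]) (auto intro: smooth_mat_entry[OF F] simp: dmat_index[OF F w])
  finally show ?thesis using dmat_carrier[OF F w, of \<delta>] by (simp add: mtrace_def)
qed

end


section \<open>Chern connection, curvature and the Hessian of the norm of a bundle map\<close>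

definition smooth_metric :: "nat \<Rightarrow> cvec set \<Rightarrow> nat \<Rightarrow> (cvec \<Rightarrow> complex mat) \<Rightarrow> bool" where
  "smooth_metric N D r H \<longleftrightarrow> smooth_mat N D r r H \<and> (\<forall>w\<in>D. herm_pos r (H w))"

context
  fixes N :: nat and D :: "cvec set"
  assumes D: "rel_open N D"
begin

lemma smooth_metric_inverse:
  assumes H: "smooth_metric N D r H"
  shows "smooth_mat N D r r (\<lambda>w. minv (H w))"
    and "w \<in> D \<Longrightarrow> H w * minv (H w) = 1\<^sub>m r" "w \<in> D \<Longrightarrow> minv (H w) * H w = 1\<^sub>m r"
  using H minv_inverse[OF smooth_mat_carrier herm_pos_det]
  by (auto simp: smooth_metric_def intro!: smooth_mat_minv[OF D] herm_pos_det)

lemma smooth_chern_conn: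
  assumes H: "smooth_metric N D r H" and A: "A < N"
  shows "smooth_mat N D r r (chern_conn A H)"
  unfolding chern_conn_def[abs_def]
  using H smooth_metric_inverse(1)[OF H]
  by (intro smooth_mat_mult[OF D] smooth_mat_dmat[OF D wirtinger_wdel[OF A]]) (auto simp: smooth_metric_def)

lemma smooth_curv:
  assumes H: "smooth_metric N D r H" and A: "A < N" and B: "B < N"
  shows "smooth_mat N D r r (curv A B H)"
  unfolding curv_def[abs_def]
  by (intro smooth_mat_uminus[OF D] smooth_mat_dmat[OF D wirtinger_wdelbar[OF B]] smooth_chern_conn[OF H A])

text \<open>Comes from differentiating the product of \<open>minv (H w)\<close> and
  \<open>H w\<close>, which is constant, and multiplying by the inverse from the right.\<close>

lemma dmat_minv:
  assumes H: "smooth_metric N D r H" and \<delta>: "wirtinger N \<delta>" and w: "w \<in> D"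
  shows "dmat \<delta> (\<lambda>w. minv (H w)) w = - (minv (H w) * dmat \<delta> H w * minv (H w))"
proof -
  have sH: "smooth_mat N D r r H" using H by (simp add: smooth_metric_def)
  note sI = smooth_metric_inverse(1)[OF H]
  note c = smooth_mat_carrier[OF sH w] smooth_mat_carrier[OF sI w] dmat_carrier[OF D sH w, of \<delta>]
    dmat_carrier[OF D sI w, of \<delta>]
  have "dmat \<delta> (\<lambda>w. minv (H w) * H w) w = dmat \<delta> (\<lambda>w. 1\<^sub>m r) w"
    by (rule dmat_cong[OF D \<delta> smooth_mat_mult[OF D sI sH] smooth_metric_inverse(3)[OF H] w])
  also have "\<dots> = 0\<^sub>m r r"
    by (rule eq_matI) (auto simp: dmat_def wirtinger_rules(2)[OF D \<delta> w])
  finally have z: "dmat \<delta> (\<lambda>w. minv (H w)) w * H w + minv (H w) * dmat \<delta> H w = 0\<^sub>m r r"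
    by (simp add: dmat_mult[OF D \<delta> sI sH w])
  have "0\<^sub>m r r = (dmat \<delta> (\<lambda>w. minv (H w)) w * H w + minv (H w) * dmat \<delta> H w) * minv (H w)"
    using z c by simp
  also have "\<dots> = dmat \<delta> (\<lambda>w. minv (H w)) w * H w * minv (H w) + minv (H w) * dmat \<delta> H w * minv (H w)"
    using c by (intro add_mult_distrib_mat) auto
  also have "dmat \<delta> (\<lambda>w. minv (H w)) w * H w * minv (H w) = dmat \<delta> (\<lambda>w. minv (H w)) w * (H w * minv (H w))"
    using c by (intro assoc_mult_mat) auto
  also have "\<dots> = dmat \<delta> (\<lambda>w. minv (H w)) w"
    using c by (simp add: smooth_metric_inverse(2)[OF H w])
  finally have 0: "0\<^sub>m r r = dmat \<delta> (\<lambda>w. minv (H w)) w + minv (H w) * dmat \<delta> H w * minv (H w)" .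
  have eq_uminus: "X = - Y" if "X \<in> carrier_mat r r" "Y \<in> carrier_mat r r" "0\<^sub>m r r = X + Y" for X Y :: "complex mat"
  proof (rule eq_matI)
    fix i j assume "i < dim_row (- Y)" "j < dim_col (- Y)"
    then have ij: "i < r" "j < r" using that by auto
    have "X $$ (i, j) + Y $$ (i, j) = (X + Y) $$ (i, j)" using that ij by simp
    also have "\<dots> = 0" using that(3)[symmetric] ij by simp
    finally show "X $$ (i, j) = (- Y) $$ (i, j)" using that ij by (simp add: eq_neg_iff_add_eq_0)
  qed (use that in auto)
  show ?thesis
    by (rule eq_uminus[OF c(4) _ 0]) (use c in auto)
qed

context
  fixes a b :: nat and Ht Hh \<Phi> :: "cvec \<Rightarrow> complex mat"
  assumes Ht: "smooth_metric N D a Ht" and Hh: "smooth_metric N D b Hh" and \<Phi>: "smooth_mat N D b a \<Phi>"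
    and hol: "\<And>B p q w. B < N \<Longrightarrow> p < b \<Longrightarrow> q < a \<Longrightarrow> w \<in> D \<Longrightarrow> wdelbar B (\<lambda>w. \<Phi> w $$ (p, q)) w = 0"
begin

private lemma sHt: "smooth_mat N D a a Ht" and sHh: "smooth_mat N D b b Hh"
  using Ht Hh by (auto simp: smooth_metric_def)

lemma smooth_hadj: "smooth_mat N D a b (hadj Ht Hh \<Phi>)"
  unfolding hadj_def[abs_def]
  by (rule smooth_mat_mult[OF D smooth_mat_mult[OF D smooth_metric_inverse(1)[OF Ht] smooth_mat_adjoint[OF D \<Phi>]] sHh])

lemma smooth_cov_del:
  assumes A: "A < N"
  shows "smooth_mat N D b a (cov_del A Ht Hh \<Phi>)"
  unfolding cov_del_def[abs_def]
  by (intro smooth_mat_diff[OF D] smooth_mat_add[OF D] smooth_mat_dmat[OF D wirtinger_wdel[OF A] \<Phi>]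
      smooth_mat_mult[OF D smooth_chern_conn[OF Hh A] \<Phi>] smooth_mat_mult[OF D \<Phi> smooth_chern_conn[OF Ht A]])

lemma smooth_cov_delbar_adj: "B < N \<Longrightarrow> smooth_mat N D a b (cov_delbar_adj B Ht Hh \<Phi>)"
  unfolding cov_delbar_adj_def[abs_def]
  by (intro smooth_mat_dmat[OF D wirtinger_wdelbar] smooth_hadj)

text \<open>\<open>\<Phi>\<close> is holomorphic, so its conjugate transpose has vanishing
  \<open>wdel\<close> derivative and only the metrics are differentiated. Read covariantly, the
  adjoint of \<open>\<Phi>\<close> is parallel in holomorphic directions.\<close>

lemma dmat_hadj:
  assumes A: "A < N" and w: "w \<in> D"
  shows "dmat (wdel A) (hadj Ht Hh \<Phi>) w =
    hadj Ht Hh \<Phi> w * chern_conn A Hh w - chern_conn A Ht w * hadj Ht Hh \<Phi> w"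
proof -
  note \<delta> = wirtinger_wdel[OF A]
  note sI = smooth_metric_inverse(1)[OF Ht] and sJ = smooth_metric_inverse(1)[OF Hh]
    and s\<Phi> = smooth_mat_adjoint[OF D \<Phi>]
  define I J P M dH dM where defs: "I = minv (Ht w)" "J = minv (Hh w)" "P = mat_adjoint (\<Phi> w)" "M = Hh w"
    "dH = dmat (wdel A) Ht w" "dM = dmat (wdel A) Hh w"
  have c: "I \<in> carrier_mat a a" "J \<in> carrier_mat b b" "P \<in> carrier_mat a b" "M \<in> carrier_mat b b"
    "dH \<in> carrier_mat a a" "dM \<in> carrier_mat b b"
    unfolding defs
    by (rule smooth_mat_carrier[OF sI w] smooth_mat_carrier[OF sJ w] smooth_mat_carrier[OF s\<Phi> w]
        smooth_mat_carrier[OF sHh w] dmat_carrier[OF D sHt w] dmat_carrier[OF D sHh w])+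
  have d\<Phi>: "dmat (wdel A) (\<lambda>w. mat_adjoint (\<Phi> w)) w = 0\<^sub>m a b"
    by (rule dmat_eqI[OF D s\<Phi> w \<delta> zero_carrier_mat mat_adjoint_index[OF smooth_mat_carrier[OF \<Phi>]]])
       (simp_all add: wdel_cnj[OF D smooth_mat_entry[OF \<Phi>] A w] hol[OF A _ _ w])
  have "dmat (wdel A) (\<lambda>w. minv (Ht w) * mat_adjoint (\<Phi> w)) w = - (I * dH * I) * P + I * 0\<^sub>m a b"
    unfolding dmat_mult[OF D \<delta> sI s\<Phi> w] dmat_minv[OF Ht \<delta> w] d\<Phi> defs ..
  also have "\<dots> = - (I * dH * I * P)"
    using c by (subst uminus_mult_left_mat) auto
  finally have "dmat (wdel A) (hadj Ht Hh \<Phi>) w = - (I * dH * I * P) * M + I * P * dM"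
    unfolding hadj_def[abs_def] dmat_mult[OF D \<delta> smooth_mat_mult[OF D sI s\<Phi>] sHh w] defs by simp
  also have "- (I * dH * I * P) * M = - (I * dH * I * P * M)"
    using c by (intro uminus_mult_left_mat) auto
  also have "I * dH * I * P * M = (I * dH) * (I * P * M)"
  proof -
    have "I * dH * I * P = I * dH * (I * P)" using c by (intro assoc_mult_mat[of _ a a _ a _ b]) auto
    moreover have "I * dH * (I * P) * M = I * dH * (I * P * M)"
      using c by (intro assoc_mult_mat[of _ a a _ b _ b]) auto
    ultimately show ?thesis by simp
  qed
  \<comment> \<open>Inserts \<open>M * J\<close>, the identity, to make the connection matrix of the
    head appear.\<close>
  also have "I * P * dM = I * P * M * (J * dM)"
  proof -
    have "M * (J * dM) = M * J * dM" using c by (intro assoc_mult_mat[symmetric]) auto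
    also have "\<dots> = dM" using c smooth_metric_inverse(2)[OF Hh w] by (simp add: defs)
    finally have "I * P * dM = I * P * (M * (J * dM))" by simp
    also have "\<dots> = I * P * M * (J * dM)" using c by (intro assoc_mult_mat[symmetric, of _ a b _ b _ b]) auto
    finally show ?thesis .
  qed
  also have "- (I * dH * (I * P * M)) + I * P * M * (J * dM) = I * P * M * (J * dM) - I * dH * (I * P * M)"
    using c by (intro eq_matI) (auto simp del: index_mult_mat(1))
  finally show ?thesis by (simp add: hadj_def[abs_def] chern_conn_def defs)
qed

text \<open>As the adjoint is parallel, only \<open>\<Phi>\<close> contributes: cyclicity of the
  trace turns the connection terms coming from the adjoint into those of
  \<open>cov_del\<close>.\<close>

lemma wdel_norm:
  assumes A: "A < N" and w: "w \<in> D"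
  shows "wdel A (\<lambda>w. mtrace (\<Phi> w * hadj Ht Hh \<Phi> w)) w = mtrace (cov_del A Ht Hh \<Phi> w * hadj Ht Hh \<Phi> w)"
proof -
  note \<delta> = wirtinger_wdel[OF A]
  define S P dP t h where defs: "S = hadj Ht Hh \<Phi> w" "P = \<Phi> w" "dP = dmat (wdel A) \<Phi> w"
    "t = chern_conn A Ht w" "h = chern_conn A Hh w"
  have c: "S \<in> carrier_mat a b" "P \<in> carrier_mat b a" "dP \<in> carrier_mat b a" "t \<in> carrier_mat a a" "h \<in> carrier_mat b b"
    unfolding defs
    by (rule smooth_mat_carrier[OF smooth_hadj w] smooth_mat_carrier[OF \<Phi> w] dmat_carrier[OF D \<Phi> w]
        smooth_mat_carrier[OF smooth_chern_conn[OF Ht A] w] smooth_mat_carrier[OF smooth_chern_conn[OF Hh A] w])+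
  have "wdel A (\<lambda>w. mtrace (\<Phi> w * hadj Ht Hh \<Phi> w)) w = mtrace (dP * S + P * (S * h - t * S))"
    unfolding wirtinger_mtrace[OF D \<delta> smooth_mat_mult[OF D \<Phi> smooth_hadj] w]
      dmat_mult[OF D \<delta> \<Phi> smooth_hadj w] dmat_hadj[OF A w] defs ..
  also have "P * (S * h - t * S) = P * (S * h) - P * (t * S)"
    using c by (intro mult_minus_distrib_mat) auto
  also have "mtrace (dP * S + (P * (S * h) - P * (t * S))) = mtrace (dP * S) + (mtrace (P * (S * h)) - mtrace (P * (t * S)))"
  proof -
    have p: "dP * S \<in> carrier_mat b b" "P * (S * h) \<in> carrier_mat b b" "P * (t * S) \<in> carrier_mat b b"
      using c by auto
    show ?thesis by (simp only: mtrace_add[OF p(1) minus_carrier_mat[OF p(3)]] mtrace_minus[OF p(2,3)])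
  qed
  also have "mtrace (P * (S * h)) = mtrace (h * P * S)"
  proof -
    have "P * (S * h) = P * S * h" using c by (intro assoc_mult_mat[symmetric]) auto
    moreover have "mtrace (P * S * h) = mtrace (h * (P * S))" using c by (intro mtrace_mult_comm) auto
    moreover have "h * (P * S) = h * P * S" using c by (intro assoc_mult_mat[symmetric]) auto
    ultimately show ?thesis by simp
  qed
  also have "P * (t * S) = P * t * S" using c by (intro assoc_mult_mat[symmetric]) auto
  also have "mtrace (dP * S) + (mtrace (h * P * S) - mtrace (P * t * S)) = mtrace (dP * S + h * P * S - P * t * S)"
  proof -
    have p: "dP * S \<in> carrier_mat b b" "h * P * S \<in> carrier_mat b b" "P * t * S \<in> carrier_mat b b"
      using c by auto
    show ?thesis by (simp add: mtrace_add[OF p(1,2)] mtrace_minus[OF add_carrier_mat[OF p(2)] p(3)])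
  qed
  also have "dP * S + h * P * S = (dP + h * P) * S"
    using c by (intro add_mult_distrib_mat[symmetric]) auto
  also have "(dP + h * P) * S - P * t * S = (dP + h * P - P * t) * S"
    using c by (intro minus_mult_distrib_mat[symmetric]) auto
  finally show ?thesis by (simp add: cov_del_def defs)
qed

text \<open>The derivatives commute, so \<open>wdel\<close> may act first, where it produces nothing
  but the covariant derivative of \<open>\<Phi>\<close>. In that expression \<open>wdelbar\<close>
  only hits the connection matrices, whose derivatives are the negative curvatures.\<close>

lemma wdel_wdelbar_norm:
  assumes A: "A < N" and B: "B < N" and w: "w \<in> D"
  shows "wdel A (wdelbar B (\<lambda>w. mtrace (\<Phi> w * hadj Ht Hh \<Phi> w))) w =
    mtrace (cov_del A Ht Hh \<Phi> w * cov_delbar_adj B Ht Hh \<Phi> w)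
    + mtrace (curv A B Ht w * (hadj Ht Hh \<Phi> w * \<Phi> w)) - mtrace (curv A B Hh w * (\<Phi> w * hadj Ht Hh \<Phi> w))"
proof -
  note \<delta> = wirtinger_wdelbar[OF B]
  note sC = smooth_cov_del[OF A] and sdP = smooth_mat_dmat[OF D wirtinger_wdel[OF A] \<Phi>]
    and sh = smooth_chern_conn[OF Hh A] and st = smooth_chern_conn[OF Ht A]
  define S P t h Rt Rh C dS where defs: "S = hadj Ht Hh \<Phi> w" "P = \<Phi> w" "t = chern_conn A Ht w" "h = chern_conn A Hh w"
    "Rt = curv A B Ht w" "Rh = curv A B Hh w" "C = cov_del A Ht Hh \<Phi> w" "dS = cov_delbar_adj B Ht Hh \<Phi> w"
  have c: "S \<in> carrier_mat a b" "P \<in> carrier_mat b a" "t \<in> carrier_mat a a" "h \<in> carrier_mat b b"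
    "Rt \<in> carrier_mat a a" "Rh \<in> carrier_mat b b" "C \<in> carrier_mat b a" "dS \<in> carrier_mat a b"
    unfolding defs
    by (rule smooth_mat_carrier[OF smooth_hadj w] smooth_mat_carrier[OF \<Phi> w] smooth_mat_carrier[OF st w]
        smooth_mat_carrier[OF sh w] smooth_mat_carrier[OF smooth_curv[OF Ht A B] w]
        smooth_mat_carrier[OF smooth_curv[OF Hh A B] w] smooth_mat_carrier[OF sC w]
        smooth_mat_carrier[OF smooth_cov_delbar_adj[OF B] w])+
  have dP: "dmat (wdelbar B) \<Phi> w = 0\<^sub>m b a"
    by (rule eq_matI) (use dmat_carrier[OF D \<Phi> w, of "wdelbar B"] dmat_index[OF D \<Phi> w, of _ _ "wdelbar B"] hol[OF B _ _ w] in auto)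
  have ddP: "dmat (wdelbar B) (dmat (wdel A) \<Phi>) w = 0\<^sub>m b a"
  proof (rule dmat_eqI[OF D sdP w \<delta> zero_carrier_mat dmat_index[OF D \<Phi>]])
    fix p q assume pq: "p < b" "q < a"
    have "wdelbar B (wdel A (\<lambda>w. \<Phi> w $$ (p, q))) w = wdel A (wdelbar B (\<lambda>w. \<Phi> w $$ (p, q))) w"
      by (rule wdel_wdelbar_commute[OF D smooth_mat_entry[OF \<Phi> pq] A B w, symmetric])
    also have "\<dots> = wdel A (\<lambda>w. 0) w"
      by (rule wdel_cong(1)[OF D A w]) (rule hol[OF B pq])
    finally show "wdelbar B (wdel A (\<lambda>w. \<Phi> w $$ (p, q))) w = 0\<^sub>m b a $$ (p, q)"
      using pq wdel_const[OF D] by simp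
  qed auto
  have dth: "dmat (wdelbar B) (chern_conn A Ht) w = - Rt" "dmat (wdelbar B) (chern_conn A Hh) w = - Rh"
    using dmat_carrier[OF D st w, of "wdelbar B"] dmat_carrier[OF D sh w, of "wdelbar B"] by (simp_all add: defs curv_def)
  \<comment> \<open>Minus the curvature of the bundle of homomorphisms applied to
    \<open>\<Phi>\<close>, because \<open>wdelbar\<close> annihilates \<open>\<Phi>\<close>
    itself.\<close>
  have dC: "dmat (wdelbar B) (cov_del A Ht Hh \<Phi>) w = P * Rt - Rh * P"
  proof -
    have "dmat (wdelbar B) (cov_del A Ht Hh \<Phi>) w =
        0\<^sub>m b a + (- Rh * P + h * 0\<^sub>m b a) - (0\<^sub>m b a * t + P * (- Rt))"
      unfolding cov_del_def[abs_def]
        dmat_diff[OF D \<delta> smooth_mat_add[OF D sdP smooth_mat_mult[OF D sh \<Phi>]] smooth_mat_mult[OF D \<Phi> st] w]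
        dmat_add[OF D \<delta> sdP smooth_mat_mult[OF D sh \<Phi>] w] dmat_mult[OF D \<delta> sh \<Phi> w]
        dmat_mult[OF D \<delta> \<Phi> st w] dP ddP dth unfolding defs ..
    also have "- Rh * P = - (Rh * P)" using c by (intro uminus_mult_left_mat) auto
    also have "P * (- Rt) = - (P * Rt)" using c by (intro uminus_mult_right_mat) auto
    also have "0\<^sub>m b a + (- (Rh * P) + h * 0\<^sub>m b a) - (0\<^sub>m b a * t + - (P * Rt)) = P * Rt - Rh * P"
      using c by (intro eq_matI) (auto simp del: index_mult_mat(1))
    finally show ?thesis .
  qed
  have "wdel A (wdelbar B (\<lambda>w. mtrace (\<Phi> w * hadj Ht Hh \<Phi> w))) w =
      wdelbar B (wdel A (\<lambda>w. mtrace (\<Phi> w * hadj Ht Hh \<Phi> w))) w"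
    by (rule wdel_wdelbar_commute[OF D smooth_on_mtrace[OF D smooth_mat_mult[OF D \<Phi> smooth_hadj]] A B w])
  also have "\<dots> = wdelbar B (\<lambda>w. mtrace (cov_del A Ht Hh \<Phi> w * hadj Ht Hh \<Phi> w)) w"
    by (rule wdel_cong(2)[OF D B w]) (rule wdel_norm[OF A])
  also have "\<dots> = mtrace ((P * Rt - Rh * P) * S + C * dS)"
    unfolding wirtinger_mtrace[OF D \<delta> smooth_mat_mult[OF D sC smooth_hadj] w]
      dmat_mult[OF D \<delta> sC smooth_hadj w] dC unfolding defs cov_delbar_adj_def ..
  also have "(P * Rt - Rh * P) * S = P * Rt * S - Rh * P * S"
    using c by (intro minus_mult_distrib_mat) auto
  also have "mtrace (P * Rt * S - Rh * P * S + C * dS) = mtrace (P * Rt * S) - mtrace (Rh * P * S) + mtrace (C * dS)"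
  proof -
    have p: "P * Rt * S \<in> carrier_mat b b" "Rh * P * S \<in> carrier_mat b b" "C * dS \<in> carrier_mat b b"
      using c by auto
    show ?thesis by (simp only: mtrace_add[OF minus_carrier_mat[OF p(2)] p(3)] mtrace_minus[OF p(1,2)])
  qed
  also have "mtrace (P * Rt * S) = mtrace (Rt * (S * P))"
  proof -
    have "P * Rt * S = P * (Rt * S)" using c by (intro assoc_mult_mat) auto
    moreover have "mtrace (P * (Rt * S)) = mtrace (Rt * S * P)" using c by (intro mtrace_mult_comm) auto
    moreover have "Rt * S * P = Rt * (S * P)" using c by (intro assoc_mult_mat) auto
    ultimately show ?thesis by simp
  qed
  also have "Rh * P * S = Rh * (P * S)" using c by (intro assoc_mult_mat) auto
  finally show ?thesis by (simp add: defs)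
qed

end

end


section \<open>Integration along the fibers\<close>


lemma join_in_Cn: "z \<in> Cn n \<Longrightarrow> u \<in> Cn N \<Longrightarrow> join n z u \<in> Cn (n + N)"
  by (auto simp: join_def Cn_def)

lemma fiber_part_join: "z \<in> Cn n \<Longrightarrow> fiber_part n (join n z u) = z"
  by (auto simp: join_def Cn_def fiber_part_def fun_eq_iff)

lemma join_upd_fiber: "A < n \<Longrightarrow> join n (z(A := x)) u = (join n z u)(A := x)"
  and join_upd_base: "join n z (u(i := x)) = (join n z u)(n + i := x)"
  by (auto simp: join_def fun_eq_iff)

lemma join_fiber: "A < n \<Longrightarrow> join n z u A = z A" and join_base: "join n z u (n + i) = u i"
  by (auto simp: join_def)

definition prod_box :: "nat \<Rightarrow> cvec set \<Rightarrow> cvec set \<Rightarrow> cvec set" where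
  "prod_box n Z U = {join n z u | z u. z \<in> Z \<and> u \<in> U}"

lemma join_in_prod_box: "z \<in> Z \<Longrightarrow> u \<in> U \<Longrightarrow> join n z u \<in> prod_box n Z U"
  by (auto simp: prod_box_def)

lemma rel_open_prod_box:
  assumes Z: "rel_open n Z" and U: "rel_open N U"
  shows "rel_open (n + N) (prod_box n Z U)"
proof -
  let ?p = "fiber_part n" and ?q = "\<lambda>w :: cvec. \<lambda>i. w (i + n)"
  have coord: "continuous_on S (\<lambda>w :: cvec. w i)" for S i
    by (rule continuous_on_product_then_coordinatewise[OF continuous_on_id])
  have p: "continuous_on S ?p" for S
  proof (rule continuous_on_coordinatewise_then_product)
    show "continuous_on S (\<lambda>w. ?p w i)" for i
      by (cases "i < n") (auto simp: fiber_part_def coord)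
  qed
  have q: "continuous_on S ?q" for S
    by (rule continuous_on_coordinatewise_then_product) (rule coord)
  have "rel_open (n + N) (Cn (n + N) \<inter> ?p -` Z)"
    using Z by (rule continuous_openin_preimage[OF p, rotated]) (auto simp: Cn_def fiber_part_def)
  moreover have "rel_open (n + N) (Cn (n + N) \<inter> ?q -` U)"
    using U by (rule continuous_openin_preimage[OF q, rotated]) (auto simp: Cn_def)
  ultimately have "rel_open (n + N) ((Cn (n + N) \<inter> ?p -` Z) \<inter> (Cn (n + N) \<inter> ?q -` U))"
    by (rule openin_Int)
  also have "(Cn (n + N) \<inter> ?p -` Z) \<inter> (Cn (n + N) \<inter> ?q -` U) = prod_box n Z U"
  proof (intro equalityI subsetI)
    fix w assume "w \<in> (Cn (n + N) \<inter> ?p -` Z) \<inter> (Cn (n + N) \<inter> ?q -` U)"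
    moreover have "w = join n (?p w) (?q w)" by (auto simp: join_def fiber_part_def)
    ultimately show "w \<in> prod_box n Z U" using join_in_prod_box[of "?p w" Z "?q w" U n] by auto
  next
    fix w assume "w \<in> prod_box n Z U"
    then obtain z u where w: "w = join n z u" "z \<in> Z" "u \<in> U" by (auto simp: prod_box_def)
    then have "z \<in> Cn n" "u \<in> Cn N" using rel_open_subset Z U by auto
    with w show "w \<in> (Cn (n + N) \<inter> ?p -` Z) \<inter> (Cn (n + N) \<inter> ?q -` U)"
      by (auto simp: fiber_part_join join_in_Cn) (simp add: join_def)
  qed
  finally show ?thesis .
qed

lemma sets_lebesgue_Cn [simp]: "sets (lebesgue_Cn n) = sets borel"
  and space_lebesgue_Cn [simp]: "space (lebesgue_Cn n) = UNIV"
  by (simp_all add: lebesgue_Cn_def)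

lemma Cn_borel: "Cn n \<in> sets borel"
proof -
  have "closed (\<Inter>i\<in>{n..}. {w :: cvec. w i = 0})"
    by (intro closed_INT ballI closed_Collect_eq continuous_intros
        continuous_on_product_then_coordinatewise[OF continuous_on_id])
  also have "(\<Inter>i\<in>{n..}. {w :: cvec. w i = 0}) = Cn n" by (auto simp: Cn_def)
  finally show ?thesis by simp
qed

lemma rel_open_borel: "rel_open n Z \<Longrightarrow> Z \<in> sets borel"
  using Cn_borel by (auto simp: openin_open)

text \<open>Each of the finitely many coordinates is bounded on \<open>C\<close>, so the part of the
  product space that maps to \<open>C\<close> lies in a product of discs of finite measure.\<close>

lemma emeasure_lebesgue_Cn_compact:
  assumes C: "compact C"
  shows "emeasure (lebesgue_Cn n) C < \<infinity>"
proof -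
  have "\<exists>r. \<forall>z\<in>C. norm (z i) \<le> r" for i
  proof -
    have "compact ((\<lambda>z. z i) ` C)"
      by (intro compact_continuous_image C continuous_on_product_then_coordinatewise[OF continuous_on_id])
    then show ?thesis using compact_imp_bounded bounded_iff by (metis imageI)
  qed
  then obtain r where r: "\<And>i z. z \<in> C \<Longrightarrow> norm (z i) \<le> r i" by metis
  interpret finite_product_sigma_finite "\<lambda>_ :: nat. lborel :: complex measure" "{..<n}"
    by standard auto
  let ?M = "PiM {..<n} (\<lambda>_. lborel :: complex measure)"
  let ?T = "\<lambda>z i. if i < n then z i else 0 :: complex"
  have T: "?T \<in> measurable ?M borel"
  proof (rule measurable_coordinatewise_then_product)
    show "(\<lambda>z. ?T z i) \<in> borel_measurable ?M" for i
      using measurable_component_singleton[of i "{..<n}" "\<lambda>_. lborel :: complex measure"]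
      by (cases "i < n") auto
  qed
  have "emeasure (lebesgue_Cn n) C = emeasure ?M (?T -` C \<inter> space ?M)"
    unfolding lebesgue_Cn_def using T C by (intro emeasure_distr) (auto intro: borel_compact)
  also have "\<dots> \<le> emeasure ?M (\<Pi>\<^sub>E i\<in>{..<n}. cball 0 (r i))"
  proof (rule emeasure_mono)
    show "?T -` C \<inter> space ?M \<subseteq> (\<Pi>\<^sub>E i\<in>{..<n}. cball 0 (r i))"
    proof
      fix z assume z: "z \<in> ?T -` C \<inter> space ?M"
      have "norm (z i) \<le> r i" if "i < n" for i using r[of "?T z" i] z that by auto
      then show "z \<in> (\<Pi>\<^sub>E i\<in>{..<n}. cball 0 (r i))" using z by (auto simp: space_PiM PiE_iff)
    qed
  qed (auto intro!: sets_PiM_I_finite)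
  also have "\<dots> = (\<Prod>i\<in>{..<n}. emeasure lborel (cball (0 :: complex) (r i)))"
    by (rule measure_times) auto
  also have "\<dots> < \<infinity>"
    using emeasure_lborel_cball_finite[of "0 :: complex"]
    by (simp add: less_top[symmetric] ennreal_prod_eq_top order.strict_implies_not_eq)
  finally show ?thesis .
qed

text \<open>The integrands of the fiber integrals are of the form \<open>k * h\<close> with such a weight \<open>k\<close>.\<close>

definition fiber_kernel :: "nat \<Rightarrow> cvec set \<Rightarrow> cvec set \<Rightarrow> (cvec \<Rightarrow> complex) \<Rightarrow> bool" where
  "fiber_kernel n Z C k \<longleftrightarrow> rel_open n Z \<and> compact C \<and> C \<subseteq> Z \<and> continuous_on Z k \<and> (\<forall>z. z \<notin> C \<longrightarrow> k z = 0)"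

text \<open>\<open>h\<close> is only controlled on \<open>Z\<close>, but \<open>k\<close> vanishes
  off a compact subset of \<open>Z\<close>: the product is bounded there, zero elsewhere, and
  measurable as the extension by zero from a Borel set.\<close>

lemma fiber_kernel_integrable:
  assumes k: "fiber_kernel n Z C k" and h: "continuous_on Z h"
  shows "integrable (lebesgue_Cn n) (\<lambda>z. k z * h z)"
proof -
  have C: "compact C" "C \<subseteq> Z" "Z \<in> sets borel" using k rel_open_borel by (auto simp: fiber_kernel_def)
  have kh: "continuous_on Z (\<lambda>z. k z * h z)" using k h by (auto simp: fiber_kernel_def intro!: continuous_intros)
  then have "bounded ((\<lambda>z. k z * h z) ` C)"
    using C by (intro compact_imp_bounded compact_continuous_image) (auto intro: continuous_on_subset)
  then obtain B where B: "\<And>z. z \<in> C \<Longrightarrow> norm (k z * h z) \<le> B" by (auto simp: bounded_iff)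
  have eq: "(\<lambda>z. indicator Z z *\<^sub>R (k z * h z)) = (\<lambda>z. k z * h z)"
    "(\<lambda>z. indicator C z *\<^sub>R (k z * h z)) = (\<lambda>z. k z * h z)"
    using k by (auto simp: fiber_kernel_def fun_eq_iff indicator_def)
  have "(\<lambda>z. k z * h z) \<in> borel_measurable (lebesgue_Cn n)"
    using borel_measurable_continuous_on_indicator[OF C(3) kh] by (simp add: eq measurable_def)
  then have "integrable (lebesgue_Cn n) (\<lambda>z. indicator C z *\<^sub>R (k z * h z))"
    using C(1) B emeasure_lebesgue_Cn_compact[OF C(1)]
    by (intro integrableI_bounded_set_indicator[where B = B]) (auto intro: borel_compact)
  then show ?thesis by (simp add: eq)
qed

text \<open>Derivatives are tested along sequences, because dominated convergence is a statement
  about sequences.\<close>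

lemma has_vector_derivative_seqI:
  fixes F :: "real \<Rightarrow> complex"
  assumes "e > 0" "\<And>X. (\<And>m. \<bar>X m\<bar> < e \<and> X m \<noteq> 0) \<Longrightarrow> X \<longlonglongrightarrow> 0 \<Longrightarrow>
    (\<lambda>m. norm (F (X m) - F 0 - X m *\<^sub>R F') / \<bar>X m\<bar>) \<longlonglongrightarrow> 0"
  shows "(F has_vector_derivative F') (at 0)"
proof -
  have "(F has_vector_derivative F') (at 0 within {-e<..<e})"
    unfolding has_vector_derivative_def has_derivative_iff_norm
  proof
    show "((\<lambda>y. norm (F y - F 0 - (y - 0) *\<^sub>R F') / norm (y - 0)) \<longlongrightarrow> 0) (at 0 within {-e<..<e})"
      unfolding tendsto_at_iff_sequentially
    proof (intro allI impI)
      fix X :: "nat \<Rightarrow> real" assume X: "\<forall>i. X i \<in> {-e<..<e} - {0}" "X \<longlonglongrightarrow> 0"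
      have "\<bar>X m\<bar> < e \<and> X m \<noteq> 0" for m using X(1)[rule_format, of m] by auto
      from assms(2)[OF this X(2)] show "((\<lambda>y. norm (F y - F 0 - (y - 0) *\<^sub>R F') / norm (y - 0)) \<circ> X) \<longlonglongrightarrow> 0"
        by (simp add: o_def)
    qed
  qed (rule bounded_linear_scaleR_left)
  then show ?thesis using assms(1) by (simp add: at_within_open[of _ "{-e<..<e}"])
qed

lemma continuous_on_join:
  "continuous_on S (\<lambda>p. join n (fst p) (u(i := u i + of_real (snd p) * c)))"
proof (rule continuous_on_coordinatewise_then_product)
  fix q
  have "continuous_on S (\<lambda>p :: cvec \<times> real. fst p q)"
    by (rule continuous_on_product_then_coordinatewise[OF continuous_on_fst[OF continuous_on_id]])
  then show "continuous_on S (\<lambda>p. join n (fst p) (u(i := u i + of_real (snd p) * c)) q)"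
    unfolding join_def by (cases "q < n"; cases "q - n = i"; simp) (auto intro!: continuous_intros)
qed

lemma continuous_on_join_slice:
  assumes "continuous_on (prod_box n Z U) f" "u \<in> U"
  shows "continuous_on Z (\<lambda>z. f (join n z u))"
proof (rule continuous_on_compose2[OF assms(1)])
  show "continuous_on Z (\<lambda>z. join n z u)"
  proof (rule continuous_on_coordinatewise_then_product)
    show "continuous_on Z (\<lambda>z. join n z u q)" for q
      unfolding join_def using continuous_on_product_then_coordinatewise[OF continuous_on_id]
      by (cases "q < n") auto
  qed
qed (use assms(2) in \<open>auto intro: join_in_prod_box\<close>)

text \<open>The derivative of the integrand is bounded over \<open>C\<close> and a compact interval
  of parameters, so the remainders of its difference quotients are dominated by a multiple of the
  weight, which is integrable.\<close>

lemma fiber_kernel_derivative: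
  assumes k: "fiber_kernel n Z C k" and U: "rel_open N U" and f: "smooth_on (n + N) (prod_box n Z U) f"
    and u: "u \<in> U" and i: "i < N" "c \<in> {1, \<i>}"
  shows "(pline i c (\<lambda>u. \<integral>z. k z * f (join n z u) \<partial>lebesgue_Cn n) u has_vector_derivative
    (\<integral>z. k z * pdir (n + i) c f (join n z u) \<partial>lebesgue_Cn n)) (at 0)"
proof -
  have Z: "rel_open n Z" and C: "compact C" "C \<subseteq> Z" and k0: "\<And>z. z \<notin> C \<Longrightarrow> k z = 0"
    using k by (auto simp: fiber_kernel_def)
  note D = rel_open_prod_box[OF Z U]
  let ?M = "lebesgue_Cn n" and ?f' = "pdir (n + i) c f"
  have ni: "n + i < n + N" using i by simp
  note f' = smooth_on_pline[OF f ni i(2)]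
  define v where "v t = u(i := u i + of_real t * c)" for t :: real
  obtain r where r: "r > 0" "\<And>t. \<bar>t\<bar> < r \<Longrightarrow> v t \<in> U"
    using eventually_pline[OF U u i] unfolding eventually_nhds_metric v_def dist_real_def by auto
  \<comment> \<open>Halved, so that the closed interval \<open>{-e..e}\<close>, which is compact as
    needed for the bound \<open>B\<close>, is still admissible.\<close>
  define e where "e = r / 2"
  have e: "e > 0" "\<And>t. \<bar>t\<bar> \<le> e \<Longrightarrow> v t \<in> U" using r by (auto simp: e_def)
  have v0: "v 0 = u" by (simp add: v_def)
  have deriv: "((\<lambda>t. f (join n z (v t))) has_vector_derivative ?f' (join n z (v t))) (at t within T)"
    if "z \<in> Z" "\<bar>t\<bar> \<le> e" for z t T
  proof -
    have "join n z (v t) \<in> prod_box n Z U" using that e(2) by (intro join_in_prod_box)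
    then have "(pline (n + i) c f (join n z (v t)) has_vector_derivative ?f' (join n z (v t))) (at (t - t))"
      using f'(1) by simp
    moreover have "pline (n + i) c f (join n z (v t)) = (\<lambda>h. f (join n z (v (t + h))))"
      by (simp add: pline_def v_def join_upd_base join_base algebra_simps fun_eq_iff)
    ultimately have "((\<lambda>x. f (join n z (v (t + (x - t))))) has_vector_derivative ?f' (join n z (v t))) (at t)"
      using vector_diff_chain_at[of "\<lambda>x. x - t" 1 t "\<lambda>h. f (join n z (v (t + h)))" "?f' (join n z (v t))"]
        has_vector_derivative_diff[OF has_vector_derivative_id[of "at t"] has_vector_derivative_const[of t]]
      by (auto simp: o_def)
    then show ?thesis by (simp add: has_vector_derivative_at_within)
  qed
  have "compact ((\<lambda>p. ?f' (join n (fst p) (v (snd p)))) ` (C \<times> {-e..e}))"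
  proof (intro compact_continuous_image compact_Times C compact_Icc)
    show "continuous_on (C \<times> {-e..e}) (\<lambda>p. ?f' (join n (fst p) (v (snd p))))"
    proof (rule continuous_on_compose2[OF smooth_on_continuous[OF f'(2)]])
      show "continuous_on (C \<times> {-e..e}) (\<lambda>p. join n (fst p) (v (snd p)))"
        unfolding v_def by (rule continuous_on_join)
      show "(\<lambda>p. join n (fst p) (v (snd p))) ` (C \<times> {-e..e}) \<subseteq> prod_box n Z U"
        using C(2) e(2) by (auto intro!: join_in_prod_box)
    qed
  qed
  then have "bounded ((\<lambda>p. ?f' (join n (fst p) (v (snd p)))) ` (C \<times> {-e..e}))"
    by (rule compact_imp_bounded)
  then obtain B where B': "\<And>p. p \<in> C \<times> {-e..e} \<Longrightarrow> norm (?f' (join n (fst p) (v (snd p)))) \<le> B"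
    unfolding bounded_iff by blast
  have B: "norm (?f' (join n z (v t))) \<le> B" if "z \<in> C" "\<bar>t\<bar> \<le> e" for z t
    using B'[of "(z, t)"] that by (auto simp: abs_le_iff)
  have int: "integrable ?M (\<lambda>z. k z * h (join n z (v t)))" if "continuous_on (prod_box n Z U) h" "\<bar>t\<bar> \<le> e" for h t
    by (rule fiber_kernel_integrable[OF k continuous_on_join_slice[OF that(1) e(2)[OF that(2)]]])
  note fc = smooth_on_continuous[OF f] and f'c = smooth_on_continuous[OF f'(2)]
  show ?thesis
    unfolding pline_def v_def[symmetric] unfolding v0[symmetric]
  proof (rule has_vector_derivative_seqI[OF e(1)])
    fix X :: "nat \<Rightarrow> real" assume X: "\<And>m. \<bar>X m\<bar> < e \<and> X m \<noteq> 0" "X \<longlonglongrightarrow> 0"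
    have Xe: "\<bar>X m\<bar> \<le> e" for m using X(1)[of m] by simp
    \<comment> \<open>The remainder of the linear approximation divided by the step size; its
      integral against \<open>k\<close> is the corresponding remainder of the integral.\<close>
    define q where "q m z = (f (join n z (v (X m))) - f (join n z (v 0)) - X m *\<^sub>R ?f' (join n z (v 0))) /\<^sub>R \<bar>X m\<bar>" for m z
    have int_q: "integrable ?M (\<lambda>z. k z * q m z)" and int_eq: "(\<integral>z. k z * q m z \<partial>?M) =
        ((\<integral>z. k z * f (join n z (v (X m))) \<partial>?M) - (\<integral>z. k z * f (join n z (v 0)) \<partial>?M)
          - X m *\<^sub>R (\<integral>z. k z * ?f' (join n z (v 0)) \<partial>?M)) /\<^sub>R \<bar>X m\<bar>" for m
    proof -
      have eq: "(\<lambda>z. k z * q m z) = (\<lambda>z. (k z * f (join n z (v (X m))) - k z * f (join n z (v 0))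
          - X m *\<^sub>R (k z * ?f' (join n z (v 0)))) /\<^sub>R \<bar>X m\<bar>)"
        by (auto simp: q_def fun_eq_iff scaleR_conv_of_real algebra_simps)
      have i1: "integrable ?M (\<lambda>z. k z * f (join n z (v (X m))))" "integrable ?M (\<lambda>z. k z * f (join n z (v 0)))"
        "integrable ?M (\<lambda>z. k z * ?f' (join n z (v 0)))"
        using int[OF fc Xe] int[OF fc, of 0] int[OF f'c, of 0] e(1) by auto
      show "integrable ?M (\<lambda>z. k z * q m z)"
        unfolding eq by (intro Bochner_Integration.integrable_diff integrable_scaleR_right i1)
      show "(\<integral>z. k z * q m z \<partial>?M) = ((\<integral>z. k z * f (join n z (v (X m))) \<partial>?M) - (\<integral>z. k z * f (join n z (v 0)) \<partial>?M)
          - X m *\<^sub>R (\<integral>z. k z * ?f' (join n z (v 0)) \<partial>?M)) /\<^sub>R \<bar>X m\<bar>"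
        unfolding eq using i1 by (simp add: integral_diff integral_scaleR_right)
    qed
    have "(\<lambda>m. \<integral>z. k z * q m z \<partial>?M) \<longlonglongrightarrow> (\<integral>z. 0 \<partial>?M)"
    proof (rule integral_dominated_convergence[where w = "\<lambda>z. norm (k z * 1) * (B + B)"])
      show "integrable ?M (\<lambda>z. norm (k z * 1) * (B + B))"
        by (intro integrable_mult_left integrable_norm fiber_kernel_integrable[OF k]) simp
      show "(\<lambda>z. k z * q m z) \<in> borel_measurable ?M" for m using int_q by auto
      show "AE z in ?M. norm (k z * q m z) \<le> norm (k z * 1) * (B + B)" for m
      proof (intro AE_I2)
        fix z
        show "norm (k z * q m z) \<le> norm (k z * 1) * (B + B)"
        proof (cases "z \<in> C")
          case True
          then have z: "z \<in> Z" using C by auto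
          \<comment> \<open>Mean value estimate for the linear remainder: two values of the
            derivative differ by at most \<open>B + B\<close>.\<close>
          have "norm (f (join n z (v (X m))) - f (join n z (v 0)) - (X m - 0) *\<^sub>R ?f' (join n z (v 0))) \<le> norm (X m - 0) * (B + B)"
          proof (rule vector_differentiable_bound_linearization[where S = "{-e..e}"])
            show "((\<lambda>t. f (join n z (v t))) has_vector_derivative ?f' (join n z (v t))) (at t within {-e..e})"
              if "t \<in> {-e..e}" for t using that by (intro deriv z) auto
            show "closed_segment 0 (X m) \<subseteq> {-e..e}"
              using Xe[of m] e(1) by (intro closed_segment_subset) auto
            show "norm (?f' (join n z (v t)) - ?f' (join n z (v 0))) \<le> B + B" if "t \<in> {-e..e}" for t
            proof -
              have "\<bar>t\<bar> \<le> e" using that by auto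
              then show ?thesis
                using B[OF True, of t] B[OF True, of 0] e(1) norm_triangle_ineq4[of "?f' (join n z (v t))" "?f' (join n z (v 0))"]
                by linarith
            qed
          qed (use e(1) in auto)
          moreover have "norm (q m z) = norm (f (join n z (v (X m))) - f (join n z (v 0)) - (X m - 0) *\<^sub>R ?f' (join n z (v 0))) / \<bar>X m\<bar>"
            by (simp add: q_def divide_inverse mult.commute)
          ultimately have "norm (q m z) \<le> B + B"
            using X(1)[of m] by (simp add: pos_divide_le_eq mult.commute)
          then show ?thesis by (simp add: norm_mult mult_left_mono)
        qed (simp add: k0)
      qed
      show "AE z in ?M. (\<lambda>m. k z * q m z) \<longlonglongrightarrow> 0"
      proof (intro AE_I2)
        fix z
        show "(\<lambda>m. k z * q m z) \<longlonglongrightarrow> 0"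
        proof (cases "z \<in> C")
          case True
          then have "((\<lambda>t. f (join n z (v t))) has_vector_derivative ?f' (join n z (v 0))) (at 0 within UNIV)"
            using C e(1) by (intro deriv) auto
          then have "((\<lambda>y. norm (f (join n z (v y)) - f (join n z (v 0)) - (y - 0) *\<^sub>R ?f' (join n z (v 0))) / norm (y - 0)) \<longlongrightarrow> 0) (at 0)"
            unfolding has_vector_derivative_def has_derivative_iff_norm by simp
          then have "(\<lambda>m. norm (q m z)) \<longlonglongrightarrow> 0"
            unfolding tendsto_at_iff_sequentially using X by (auto simp: o_def q_def divide_inverse mult.commute)
          then show ?thesis by (intro tendsto_mult_right_zero) (simp add: tendsto_norm_zero_iff)
        qed (simp add: k0)
      qed
    qed auto
    then have "(\<lambda>m. norm (\<integral>z. k z * q m z \<partial>?M)) \<longlonglongrightarrow> 0"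
      by (simp add: tendsto_norm_zero_iff)
    then show "(\<lambda>m. norm ((\<integral>z. k z * f (join n z (v (X m))) \<partial>?M) - (\<integral>z. k z * f (join n z (v 0)) \<partial>?M)
        - X m *\<^sub>R (\<integral>z. k z * ?f' (join n z (v 0)) \<partial>?M)) / \<bar>X m\<bar>) \<longlonglongrightarrow> 0"
      unfolding int_eq by (simp add: divide_inverse mult.commute)
  qed
qed


section \<open>Charts, weights of the pieces and rules for the fiber integral\<close>

lemma chart_properties:
  assumes "complex_manifold n AX" "c \<in> AX"
  obtains \<kappa> where "open (patch c)" "homeomorphism (patch c) (coords c ` patch c) (coords c) \<kappa>"
    "rel_open n (coords c ` patch c)" "inj_on (coords c) (patch c)"
proof -
  have "local_model c" "rel_open n (coords c ` patch c)"
    using assms by (auto simp: complex_manifold_def complex_space_def compatible_chart_def)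
  then obtain \<kappa> where \<kappa>: "open (patch c)" "homeomorphism (patch c) (coords c ` patch c) (coords c) \<kappa>"
    by (auto simp: local_model_def)
  have "inj_on (coords c) (patch c)"
    by (rule inj_on_inverseI[of _ \<kappa>]) (rule homeomorphism_apply1[OF \<kappa>(2)])
  with \<kappa> show thesis using that \<open>rel_open n (coords c ` patch c)\<close> by blast
qed

lemma cinv_coords: "inj_on (coords c) (patch c) \<Longrightarrow> x \<in> patch c \<Longrightarrow> cinv c (coords c x) = x"
  by (simp add: cinv_def)

lemma rel_open_coords_image:
  assumes "complex_manifold n AX" "c \<in> AX" "open X" "X \<subseteq> patch c"
  shows "rel_open n (coords c ` X)"
proof -
  obtain \<kappa> where \<kappa>: "homeomorphism (patch c) (coords c ` patch c) (coords c) \<kappa>" "rel_open n (coords c ` patch c)"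
    using chart_properties[OF assms(1,2)] by metis
  have "openin (top_of_set (patch c)) X" using assms(3,4) by (auto simp: openin_open)
  from openin_trans[OF homeomorphism_imp_open_map[OF \<kappa>(1) this] \<kappa>(2)] show ?thesis .
qed

lemma continuous_on_wedge:
  assumes "finite K" "\<And>I. I \<subseteq> K \<Longrightarrow> continuous_on Z (\<lambda>z. \<alpha> z I)" "\<And>I. I \<subseteq> K \<Longrightarrow> continuous_on Z (\<lambda>z. \<beta> z I)"
  shows "continuous_on Z (\<lambda>z. wedge (\<alpha> z) (\<beta> z) K)"
  unfolding wedge_def using assms by (auto intro!: continuous_intros)

lemma continuous_on_fpow:
  "finite K \<Longrightarrow> (\<And>I. finite I \<Longrightarrow> continuous_on Z (\<lambda>z. \<alpha> z I)) \<Longrightarrow> continuous_on Z (\<lambda>z. fpow (\<alpha> z) m K)"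
proof (induction m arbitrary: K)
  case (Suc m)
  show ?case
    unfolding fpow.simps using Suc.prems
    by (intro continuous_on_wedge Suc.IH) (auto intro: finite_subset)
qed simp

text \<open>The factors of the integrand that do not depend on the base point: the weight of the
  piece, the Jacobian constant and the top coefficient of omega_X^n / n!.\<close>

definition piece_kernel ::
  "nat \<Rightarrow> ('x chart \<Rightarrow> cvec \<Rightarrow> complex mat) \<Rightarrow> 'x pieces \<Rightarrow> nat \<Rightarrow> cvec \<Rightarrow> complex" where
  "piece_kernel n g P j z = indicator (coords (pchart P j) ` pnbhd P j) z *
     of_real (pweight P j (cinv (pchart P j) z)) *
     ((-2 * \<i>) ^ n * (1 / fact n * fpow (kform n g (pchart P j) z) n {..<2 * n}))"

text \<open>The closed support of a weight is compact as a closed subset of \<open>X\<close>, and it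
  lies inside the piece, so the chart maps it to a compact subset of the coordinate domain.\<close>

lemma fiber_kernel_piece:
  fixes AX :: "'x::t2_space chart set"
  assumes X: "compact (UNIV :: 'x set)" and g: "kaehler_manifold n AX g"
    and P: "partition_of_unity AX P" and j: "j < psize P"
  shows "fiber_kernel n (coords (pchart P j) ` pnbhd P j)
    (coords (pchart P j) ` closure {x. pweight P j x \<noteq> 0}) (piece_kernel n g P j)"
proof -
  let ?c = "pchart P j" and ?X = "pnbhd P j" and ?S = "closure {x. pweight P j x \<noteq> 0}"
  have c: "?c \<in> AX" "open ?X" "?X \<subseteq> patch ?c" "?S \<subseteq> ?X" and \<rho>: "smooth_fun AX UNIV (\<lambda>x. of_real (pweight P j x))"
    using P j by (auto simp: partition_of_unity_def)
  have mfd: "complex_manifold n AX" using g by (simp add: kaehler_manifold_def)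
  obtain \<kappa> where \<kappa>: "homeomorphism (patch ?c) (coords ?c ` patch ?c) (coords ?c) \<kappa>"
    "rel_open n (coords ?c ` patch ?c)" "inj_on (coords ?c) (patch ?c)"
    using chart_properties[OF mfd c(1)] by metis
  have "edim ?c = n" using mfd c(1) by (simp add: complex_manifold_def)
  show ?thesis
    unfolding fiber_kernel_def
  proof (intro conjI allI impI)
    show Z: "rel_open n (coords ?c ` ?X)" by (rule rel_open_coords_image[OF mfd c(1-3)])
    have "compact ?S" using X compact_Int_closed[of UNIV ?S] by simp
    then show "compact (coords ?c ` ?S)"
      using homeomorphism_cont1[OF \<kappa>(1)] c by (intro compact_continuous_image) (auto intro: continuous_on_subset)
    show "coords ?c ` ?S \<subseteq> coords ?c ` ?X" using c(4) by auto
    show "piece_kernel n g P j z = 0" if z: "z \<notin> coords ?c ` ?S" for z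
    proof (cases "z \<in> coords ?c ` ?X")
      case True
      then obtain x where x: "x \<in> ?X" "z = coords ?c x" by auto
      then have "cinv ?c z = x" using c \<kappa>(3) by (auto intro: cinv_coords)
      moreover have "pweight P j x = 0" using z x closure_subset[of "{x. pweight P j x \<noteq> 0}"] by auto
      ultimately show ?thesis by (simp add: piece_kernel_def)
    qed (simp add: piece_kernel_def)
    have sub: "coords ?c ` ?X \<subseteq> Cn n" by (rule rel_open_subset[OF Z])
    \<comment> \<open>Smoothness of a weight is defined by local extensions in the chart, so its
      continuity in coordinates is established locally.\<close>
    have \<rho>c: "continuous_on (coords ?c ` ?X) (\<lambda>z. complex_of_real (pweight P j (cinv ?c z)))"
    proof (rule continuous_on_locally)
      fix z assume "z \<in> coords ?c ` ?X"
      then obtain x where x: "x \<in> patch ?c" "z = coords ?c x" using c by auto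
      from \<rho> c(1) have "locally_extends smooth_on ?c UNIV (\<lambda>x. complex_of_real (pweight P j x))"
        by (simp add: smooth_fun_def)
      with x \<open>edim ?c = n\<close> obtain V F where V: "rel_open n V" "z \<in> V" "smooth_on n V F"
        "\<And>y. y \<in> patch ?c \<Longrightarrow> coords ?c y \<in> V \<Longrightarrow> complex_of_real (pweight P j y) = F (coords ?c y)"
        unfolding locally_extends_def by fastforce
      obtain T where T: "open T" "V = Cn n \<inter> T" using V(1) by (auto simp: openin_open)
      have "continuous_on (coords ?c ` ?X \<inter> T) F"
        by (rule continuous_on_subset[OF smooth_on_continuous[OF V(3)]]) (use T sub in auto)
      moreover have "F z' = complex_of_real (pweight P j (cinv ?c z'))" if "z' \<in> coords ?c ` ?X \<inter> T" for z'
      proof -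
        from that obtain y where y: "y \<in> patch ?c" "z' = coords ?c y" using c by auto
        moreover have "z' \<in> V" using that T sub by auto
        ultimately show ?thesis using V(4)[OF y(1)] cinv_coords[OF \<kappa>(3) y(1)] by simp
      qed
      ultimately have "continuous_on (coords ?c ` ?X \<inter> T) (\<lambda>z. complex_of_real (pweight P j (cinv ?c z)))"
        by (rule continuous_on_eq)
      then show "\<exists>T. open T \<and> z \<in> T \<and> continuous_on (coords ?c ` ?X \<inter> T) (\<lambda>z. complex_of_real (pweight P j (cinv ?c z)))"
        using T V(2) by blast
    qed
    have form: "continuous_on (coords ?c ` ?X) (\<lambda>z. kform n g ?c z I)" for I
    proof -
      have "continuous_on (coords ?c ` ?X) (\<lambda>z. g ?c z $$ (\<alpha>, \<beta>))" if "\<alpha> < n" "\<beta> < n" for \<alpha> \<beta>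
      proof -
        have "smooth_on n (coords ?c ` patch ?c) (\<lambda>z. g ?c z $$ (\<alpha>, \<beta>))"
          using g c(1) that by (simp add: kaehler_manifold_def)
        then show ?thesis using c(3) by (blast intro: continuous_on_subset smooth_on_continuous)
      qed
      then show ?thesis unfolding kform_def form11_def by (auto intro!: continuous_intros)
    qed
    have "continuous_on (coords ?c ` ?X) (\<lambda>z. complex_of_real (pweight P j (cinv ?c z)) *
        ((-2 * \<i>) ^ n * (1 / fact n * fpow (kform n g ?c z) n {..<2 * n})))"
      by (intro continuous_on_mult \<rho>c continuous_on_const continuous_on_fpow form) auto
    then show "continuous_on (coords ?c ` ?X) (piece_kernel n g P j)"
      by (rule continuous_on_eq) (simp add: piece_kernel_def)
  qed
qed

context
  fixes n N :: nat and AX :: "'x::t2_space chart set" and g :: "'x chart \<Rightarrow> cvec \<Rightarrow> complex mat"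
    and \<E> :: "('x, 'q, 'a, 'i) local_ext" and U :: "cvec set" and Z :: "nat \<Rightarrow> cvec set"
  assumes X: "compact (UNIV :: 'x set)" and g: "kaehler_manifold n AX g"
    and P: "partition_of_unity AX (pou \<E>)" and U: "rel_open N U"
  defines "Z \<equiv> \<lambda>j. coords (pchart (pou \<E>) j) ` pnbhd (pou \<E>) j"
begin

lemma piece_open: "j < psize (pou \<E>) \<Longrightarrow> rel_open n (Z j)"
  using fiber_kernel_piece[OF X g P] by (auto simp: fiber_kernel_def Z_def)

lemma omegaX_pow_join:
  assumes "j < psize (pou \<E>)" "z \<in> Z j"
  shows "omegaX_pow n g \<E> m j (join n z s) = fscale (1 / fact m) (fpow (kform n g (pchart (pou \<E>) j) z) m)"
proof -
  have "z \<in> Cn n" using assms rel_open_subset[OF piece_open] by auto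
  then show ?thesis by (simp add: omegaX_pow_def omegaX_def fiber_part_join)
qed

text \<open>Once the relevant coefficient of the form is a multiple \<open>h\<close> of the volume
  coefficient, only \<open>h\<close> is left to integrate against the fixed weight.\<close>

lemma fiber_int_eq:
  assumes "\<And>j z. j < psize (pou \<E>) \<Longrightarrow> z \<in> Z j \<Longrightarrow> \<eta> j (join n z s) ({..<2 * n} \<union> (+) (2 * n) ` K) =
    h j (join n z s) * (1 / fact n * fpow (kform n g (pchart (pou \<E>) j) z) n {..<2 * n})"
  shows "fiber_int n (pou \<E>) \<eta> s K =
    (\<Sum>j<psize (pou \<E>). \<integral>z. piece_kernel n g (pou \<E>) j z * h j (join n z s) \<partial>lebesgue_Cn n)"
  unfolding fiber_int_def
proof (intro sum.cong refl Bochner_Integration.integral_cong)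
  fix j z assume "j \<in> {..<psize (pou \<E>)}"
  then show "indicator (coords (pchart (pou \<E>) j) ` pnbhd (pou \<E>) j) z * of_real (pweight (pou \<E>) j (cinv (pchart (pou \<E>) j) z)) *
      ((-2 * \<i>) ^ n * \<eta> j (join n z s) ({..<2 * n} \<union> (+) (2 * n) ` K)) =
      piece_kernel n g (pou \<E>) j z * h j (join n z s)"
    using assms[of j z] by (cases "z \<in> Z j") (simp_all add: piece_kernel_def Z_def)
qed

lemma fiber_int_fun_eq:
  "fiber_int_fun n g \<E> f s = (\<Sum>j<psize (pou \<E>). \<integral>z. piece_kernel n g (pou \<E>) j z * f j (join n z s) \<partial>lebesgue_Cn n)"
  unfolding fiber_int_fun_def by (rule fiber_int_eq) (simp add: fscale_def omegaX_pow_join)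

lemma fiber_int_fun_cong:
  assumes "\<And>j z. j < psize (pou \<E>) \<Longrightarrow> z \<in> Z j \<Longrightarrow> f j (join n z s) = h j (join n z s)"
  shows "fiber_int_fun n g \<E> f s = fiber_int_fun n g \<E> h s"
  unfolding fiber_int_fun_eq
proof (intro sum.cong refl Bochner_Integration.integral_cong)
  fix j z assume "j \<in> {..<psize (pou \<E>)}"
  then show "piece_kernel n g (pou \<E>) j z * f j (join n z s) = piece_kernel n g (pou \<E>) j z * h j (join n z s)"
    using assms[of j z] by (cases "z \<in> Z j") (simp_all add: piece_kernel_def Z_def)
qed

lemma piece_integrable:
  assumes "j < psize (pou \<E>)" "continuous_on (prod_box n (Z j) U) f" "s \<in> U"
  shows "integrable (lebesgue_Cn n) (\<lambda>z. piece_kernel n g (pou \<E>) j z * f (join n z s))"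
  using fiber_kernel_integrable[OF fiber_kernel_piece[OF X g P assms(1)] continuous_on_join_slice[OF assms(2,3), unfolded Z_def]] .

lemma fiber_int_fun_add:
  assumes "\<And>j. j < psize (pou \<E>) \<Longrightarrow> continuous_on (prod_box n (Z j) U) (f j)"
    "\<And>j. j < psize (pou \<E>) \<Longrightarrow> continuous_on (prod_box n (Z j) U) (h j)" "s \<in> U"
  shows "fiber_int_fun n g \<E> (\<lambda>j w. f j w + h j w) s = fiber_int_fun n g \<E> f s + fiber_int_fun n g \<E> h s"
  unfolding fiber_int_fun_eq sum.distrib[symmetric]
  using piece_integrable[OF _ assms(1,3)] piece_integrable[OF _ assms(2,3)]
  by (intro sum.cong refl) (simp add: distrib_left)

lemma fiber_int_fun_scale: "fiber_int_fun n g \<E> (\<lambda>j w. a * f j w) s = a * fiber_int_fun n g \<E> f s"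
  unfolding fiber_int_fun_eq sum_distrib_left by (simp add: mult.left_commute)

lemma fiber_int_fun_sum:
  assumes "\<And>x j. x \<in> S \<Longrightarrow> j < psize (pou \<E>) \<Longrightarrow> continuous_on (prod_box n (Z j) U) (f x j)" "s \<in> U"
  shows "fiber_int_fun n g \<E> (\<lambda>j w. \<Sum>x\<in>S. f x j w) s = (\<Sum>x\<in>S. fiber_int_fun n g \<E> (f x) s)"
  using assms(1)
proof (induction S rule: infinite_finite_induct)
  case (insert x S)
  then show ?case using fiber_int_fun_add[of "f x" "\<lambda>j w. \<Sum>x\<in>S. f x j w" s] assms(2)
    by (simp add: continuous_on_sum)
qed (simp_all add: fiber_int_fun_eq)

lemma fiber_int_fun_pline:
  assumes f: "\<And>j. j < psize (pou \<E>) \<Longrightarrow> smooth_on (n + N) (prod_box n (Z j) U) (f j)"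
    and s: "s \<in> U" and i: "i < N" "c \<in> {1, \<i>}"
  shows "(pline i c (fiber_int_fun n g \<E> f) s has_vector_derivative fiber_int_fun n g \<E> (\<lambda>j. pdir (n + i) c (f j)) s) (at 0)"
proof -
  have "((\<lambda>t. \<Sum>j<psize (pou \<E>). pline i c (\<lambda>s. \<integral>z. piece_kernel n g (pou \<E>) j z * f j (join n z s) \<partial>lebesgue_Cn n) s t)
      has_vector_derivative fiber_int_fun n g \<E> (\<lambda>j. pdir (n + i) c (f j)) s) (at 0)"
    unfolding fiber_int_fun_eq
    by (intro has_vector_derivative_sum fiber_kernel_derivative[OF fiber_kernel_piece[OF X g P] U f[unfolded Z_def] s i]) auto
  then show ?thesis by (simp add: pline_def fiber_int_fun_eq[abs_def])
qed

lemma fiber_int_fun_wdel: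
  assumes f: "\<And>j. j < psize (pou \<E>) \<Longrightarrow> smooth_on (n + N) (prod_box n (Z j) U) (f j)"
    and s: "s \<in> U" and i: "i < N"
  shows "wdel i (fiber_int_fun n g \<E> f) s = fiber_int_fun n g \<E> (\<lambda>j. wdel (n + i) (f j)) s"
    and "wdelbar i (fiber_int_fun n g \<E> f) s = fiber_int_fun n g \<E> (\<lambda>j. wdelbar (n + i) (f j)) s"
proof -
  have ni: "n + i < n + N" using i by simp
  note eq = pdir_eqI[OF fiber_int_fun_pline[OF f s i]]
  note c = smooth_on_continuous[OF smooth_on_pline(2)[OF f ni]]
  have lin: "fiber_int_fun n g \<E> (\<lambda>j w. a * pdir (n + i) 1 (f j) w + b * pdir (n + i) \<i> (f j) w) s =
      a * fiber_int_fun n g \<E> (\<lambda>j. pdir (n + i) 1 (f j)) s + b * fiber_int_fun n g \<E> (\<lambda>j. pdir (n + i) \<i> (f j)) s" for a b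
    using s by (subst fiber_int_fun_add) (auto intro!: continuous_intros c simp: fiber_int_fun_scale)
  have "(\<lambda>j. wdel (n + i) (f j)) = (\<lambda>j w. 1 / 2 * pdir (n + i) 1 (f j) w + (- \<i> / 2) * pdir (n + i) \<i> (f j) w)"
    by (auto simp: wdel_def fun_eq_iff diff_divide_distrib)
  then show "wdel i (fiber_int_fun n g \<E> f) s = fiber_int_fun n g \<E> (\<lambda>j. wdel (n + i) (f j)) s"
    by (simp only: lin wdel_def eq insertI1 insertI2) (simp add: diff_divide_distrib)
  have "(\<lambda>j. wdelbar (n + i) (f j)) = (\<lambda>j w. 1 / 2 * pdir (n + i) 1 (f j) w + (\<i> / 2) * pdir (n + i) \<i> (f j) w)"
    by (auto simp: wdelbar_def fun_eq_iff add_divide_distrib)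
  then show "wdelbar i (fiber_int_fun n g \<E> f) s = fiber_int_fun n g \<E> (\<lambda>j. wdelbar (n + i) (f j)) s"
    by (simp only: lin wdelbar_def eq insertI1 insertI2) (simp add: add_divide_distrib)
qed

lemma fiber_int_fun_wdel_wdelbar:
  assumes f: "\<And>j. j < psize (pou \<E>) \<Longrightarrow> smooth_on (n + N) (prod_box n (Z j) U) (f j)"
    and s: "s \<in> U" and i: "i < N" and l: "l < N"
  shows "wdel i (wdelbar l (fiber_int_fun n g \<E> f)) s =
    fiber_int_fun n g \<E> (\<lambda>j. wdel (n + i) (wdelbar (n + l) (f j))) s"
proof -
  \<comment> \<open>The inner exchange is used at all points of \<open>U\<close>, since its result
    is differentiated once more.\<close>
  have "wdel i (wdelbar l (fiber_int_fun n g \<E> f)) s = wdel i (fiber_int_fun n g \<E> (\<lambda>j. wdelbar (n + l) (f j))) s"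
    by (rule wdel_cong(1)[OF U i s]) (rule fiber_int_fun_wdel(2)[OF f _ l])
  also have "\<dots> = fiber_int_fun n g \<E> (\<lambda>j. wdel (n + i) (wdelbar (n + l) (f j))) s"
    using l by (intro fiber_int_fun_wdel(1)[OF _ s i] smooth_on_wdelbar[OF rel_open_prod_box[OF piece_open U]] f) auto
  finally show ?thesis .
qed

end


section \<open>The fiberwise identity\<close>


lemma pdir_join:
  assumes Z: "rel_open n Z" and z: "z \<in> Z" and A: "A < n" "c \<in> {1, \<i>}"
    and f: "\<And>z. z \<in> Z \<Longrightarrow> f z = F (join n z u)"
  shows "pdir A c f z = pdir A c F (join n z u)"
proof -
  have "eventually (\<lambda>t. pline A c f z t = pline A c F (join n z u) t) (nhds 0)"
    using eventually_pline[OF Z z A] by eventually_elim (simp add: pline_def f join_upd_fiber[OF A(1)] join_fiber[OF A(1)])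
  then have "(pline A c f z has_vector_derivative d) (at 0) \<longleftrightarrow> (pline A c F (join n z u) has_vector_derivative d) (at 0)" for d
    by (intro has_vector_derivative_cong_ev) (auto dest: eventually_nhds_x_imp_x elim: eventually_mono)
  then show ?thesis by (simp add: pdir_def vector_derivative_def)
qed

text \<open>Fiber derivatives keep the base coordinates fixed, so the restricted metric has the
  fiber part of the curvature on the product. The metrics have to agree on all of \<open>Z\<close>
  because they are differentiated twice.\<close>

lemma curv_join:
  assumes Z: "rel_open n Z" and z: "z \<in> Z" and AB: "A < n" "B < n"
    and H: "\<And>z. z \<in> Z \<Longrightarrow> H z = H' (join n z u)"
  shows "curv A B H z = curv A B H' (join n z u)"
proof -
  have w: "wdel A f z = wdel A F (join n z u)" "wdelbar B f z = wdelbar B F (join n z u)"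
    if "z \<in> Z" "\<And>z. z \<in> Z \<Longrightarrow> f z = F (join n z u)" for f F z
    using pdir_join[OF Z that(1) AB(1), of _ f F u] pdir_join[OF Z that(1) AB(2), of _ f F u] that(2)
    by (simp_all add: wdel_def wdelbar_def)
  have "chern_conn A H z = chern_conn A H' (join n z u)" if "z \<in> Z" for z
    using that unfolding chern_conn_def dmat_def
    by (simp add: H) (intro arg_cong2[where f = "(*)"] cong_mat refl; auto intro!: w(1) simp: H)
  then show ?thesis
    unfolding curv_def dmat_def using z
    by (simp, intro arg_cong[where f = uminus] cong_mat refl) (auto intro!: w(2))
qed

lemma hadj_carrier:
  assumes "herm_pos a (Ht w)" "herm_pos b (Hh w)" "\<Phi> w \<in> carrier_mat b a"
  shows "hadj Ht Hh \<Phi> w \<in> carrier_mat a b"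
proof -
  have "Ht w \<in> carrier_mat a a" "Hh w \<in> carrier_mat b b" using assms by (auto simp: herm_pos_def)
  then show ?thesis
    using minv_inverse(1)[OF _ herm_pos_det[OF assms(1)]] mat_adjoint_carrier[OF assms(3)]
    unfolding hadj_def by (intro mult_carrier_mat) auto
qed

lemma form11_add: "form11 N f K + form11 N h K = form11 N (\<lambda>i l. f i l + h i l) K"
  and form11_scale: "c * form11 N f K = form11 N (\<lambda>i l. c * f i l) K"
  and form11_sum: "(\<Sum>x\<in>S. form11 N (F x) K) = form11 N (\<lambda>i l. \<Sum>x\<in>S. F x i l) K"
  unfolding form11_def
  by (simp_all add: sum_distrib_left sum_distrib_right distrib_right sum.distrib mult.assoc sum.swap[of _ S])

lemma form11_cong:
  "(\<And>i l. i < N \<Longrightarrow> l < N \<Longrightarrow> f i l = h i l) \<Longrightarrow> form11 N f K = form11 N h K"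
  unfolding form11_def by (intro sum.cong refl) auto

text \<open>At each \<open>I\<close> at most one summand of \<open>fdelbar\<close> is nonzero, so
  the outer derivative passes the sum without any differentiability of \<open>f\<close>.\<close>

lemma fdel_fdelbar_fconst:
  "fdel N (fdelbar N (\<lambda>s. fconst (f s))) u K = form11 N (\<lambda>i l. wdel i (wdelbar l f) u) K"
proof -
  have const: "wdel A (\<lambda>w. 0) w = 0" "wdelbar A (\<lambda>w. 0) w = 0" for A w
    using pdir_eqI[of A _ "\<lambda>w. 0" w 0] by (simp_all add: wdel_def wdelbar_def pline_def)
  have 1: "wedge (dwbar B) (\<lambda>I. wdelbar B (\<lambda>w. fconst (f w) I) w) I = wdelbar B f w * dwbar B I" for B I w
  proof (cases "finite I")
    case True
    have "wedge (dwbar B) (\<lambda>I. wdelbar B (\<lambda>w. fconst (f w) I) w) I = wedge (dwbar B) (fconst (wdelbar B f w)) I"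
      by (intro wedge_cong) (auto simp: fconst_def const)
    then show ?thesis using True by (simp add: wedge_fconst_right)
  qed (auto simp: wedge_infinite dwbar_def)
  have 2: "wdel A (\<lambda>w. \<Sum>B<N. wdelbar B f w * dwbar B I) w = (\<Sum>B<N. wdel A (wdelbar B f) w * dwbar B I)" for A I w
  proof (cases "\<exists>B<N. I = {2 * B + 1}")
    case True
    then obtain B where B: "B < N" "I = {2 * B + 1}" by auto
    then have "(\<Sum>B'<N. h B' * dwbar B' I) = (\<Sum>B'<N. if B' = B then h B' else 0)" for h :: "nat \<Rightarrow> complex"
      by (intro sum.cong refl) (auto simp: dwbar_def)
    then show ?thesis using B by simp
  next
    case False
    then have "dwbar B I = 0" if "B < N" for B using that by (auto simp: dwbar_def)
    then show ?thesis by (simp add: const)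
  qed
  show ?thesis
    unfolding fdel_def fdelbar_def 1 2 form11_def
    by (simp add: wedge_sum_right wedge_scale_right)
qed


lemma sum_swap_triple:
  fixes f :: "_ \<Rightarrow> _ \<Rightarrow> _ \<Rightarrow> complex"
  shows "(\<Sum>a\<in>A. \<Sum>b\<in>B. \<Sum>c\<in>C. f a b c) = (\<Sum>b\<in>B. \<Sum>c\<in>C. \<Sum>a\<in>A. f a b c)"
proof -
  have "(\<Sum>a\<in>A. \<Sum>b\<in>B. \<Sum>c\<in>C. f a b c) = (\<Sum>b\<in>B. \<Sum>a\<in>A. \<Sum>c\<in>C. f a b c)" by (rule sum.swap)
  also have "\<dots> = (\<Sum>b\<in>B. \<Sum>c\<in>C. \<Sum>a\<in>A. f a b c)" by (rule sum.cong[OF refl], rule sum.swap)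
  finally show ?thesis .
qed

lemma sum_swap_pairs:
  fixes f :: "_ \<Rightarrow> _ \<Rightarrow> _ \<Rightarrow> _ \<Rightarrow> complex"
  shows "(\<Sum>a\<in>A. \<Sum>b\<in>B. \<Sum>c\<in>C. \<Sum>d\<in>D. f a b c d) = (\<Sum>c\<in>C. \<Sum>d\<in>D. \<Sum>a\<in>A. \<Sum>b\<in>B. f a b c d)"
proof -
  have "(\<Sum>a\<in>A. \<Sum>b\<in>B. \<Sum>c\<in>C. \<Sum>d\<in>D. f a b c d) = (\<Sum>a\<in>A. \<Sum>c\<in>C. \<Sum>d\<in>D. \<Sum>b\<in>B. f a b c d)"
    by (rule sum.cong[OF refl], rule sum_swap_triple)
  also have "\<dots> = (\<Sum>c\<in>C. \<Sum>d\<in>D. \<Sum>a\<in>A. \<Sum>b\<in>B. f a b c d)" by (rule sum_swap_triple)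
  finally show ?thesis .
qed

section \<open>The extended data on the fiber over \<open>s0\<close>\<close>

context
  fixes n N :: nat and AX :: "'x::t2_space chart set" and g :: "'x chart \<Rightarrow> cvec \<Rightarrow> complex mat"
    and AS :: "'s::t2_space chart set"
    and Q :: "('q, 'a) quiver" and R :: "('q, 'a) relation set" and m :: "'q \<Rightarrow> nat" and \<tau> :: "'q \<Rightarrow> real"
    and E :: "'q \<Rightarrow> ('x \<times> 's, 'i) vbundle" and \<phi> :: "'a \<Rightarrow> 'i \<Rightarrow> 'i \<Rightarrow> 'x \<times> 's \<Rightarrow> complex mat"
    and k :: "'q \<Rightarrow> 'i \<Rightarrow> 'x \<times> 's \<Rightarrow> complex mat"
    and s0 :: 's and c :: "'s chart" and \<E> :: "('x, 'q, 'a, 'i) local_ext"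
    and u :: cvec and U :: "cvec set" and V :: "'q set" and W :: "'a set" and Z :: "nat \<Rightarrow> cvec set"
  assumes n: "1 \<le> n"
    and X: "compact (UNIV :: 'x set)"
    and g: "kaehler_manifold n AX g"
    and Q: "locally_finite_quiver Q"
    and E: "quiver_bundle (prod_atlas AX AS) Q R E \<phi>"
    and k: "\<forall>v\<in>verts Q. herm_metric (prod_atlas AX AS) (E v) (k v)"
    and vortex: "quiver_vortex n AX g Q m \<tau> (\<lambda>v. restrict_bundle s0 (E v)) (restrict_mor s0 \<phi>)
               (restrict_metric s0 k)"
    and s0: "s0 \<in> patch c"
    and ext: "local_extension_at n AX Q E \<phi> k c s0 \<E>"
    and N: "N = edim c"
  defines "u \<equiv> coords c s0" and "U \<equiv> amb \<E>" and "V \<equiv> verts' Q E" and "W \<equiv> arrows' Q E"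
    and "Z \<equiv> \<lambda>j. coords (pchart (pou \<E>) j) ` pnbhd (pou \<E>) j"
begin

lemma extension:
  shows "partition_of_unity AX (pou \<E>)" "rel_open N U" "u \<in> U"
    and "j < psize (pou \<E>) \<Longrightarrow> v \<in> V \<Longrightarrow> fr \<E> j v \<in> idx (E v)"
    and "j < psize (pou \<E>) \<Longrightarrow> v \<in> V \<Longrightarrow> x \<in> pnbhd (pou \<E>) j \<Longrightarrow> (x, s0) \<in> tdom (E v) (fr \<E> j v)"
    and "j < psize (pou \<E>) \<Longrightarrow> v \<in> V \<Longrightarrow> smooth_metric (n + N) (prod_box n (Z j) U) (rk (E v)) (met \<E> j v)"
    and "j < psize (pou \<E>) \<Longrightarrow> v \<in> V \<Longrightarrow> x \<in> pnbhd (pou \<E>) j \<Longrightarrow>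
      met \<E> j v (join n (coords (pchart (pou \<E>) j) x) u) = k v (fr \<E> j v) (x, s0)"
    and "j < psize (pou \<E>) \<Longrightarrow> a \<in> W \<Longrightarrow> w \<in> prod_box n (Z j) U \<Longrightarrow>
      mor \<E> j a w \<in> carrier_mat (rk (E (head Q a))) (rk (E (tail Q a)))"
    and "j < psize (pou \<E>) \<Longrightarrow> a \<in> W \<Longrightarrow> p < rk (E (head Q a)) \<Longrightarrow> q < rk (E (tail Q a)) \<Longrightarrow>
      holo_on (n + N) (prod_box n (Z j) U) (\<lambda>w. mor \<E> j a w $$ (p, q))"
    and "j < psize (pou \<E>) \<Longrightarrow> a \<in> W \<Longrightarrow> x \<in> pnbhd (pou \<E>) j \<Longrightarrow>
      mor \<E> j a (join n (coords (pchart (pou \<E>) j) x) u) =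
        \<phi> a (fr \<E> j (tail Q a)) (fr \<E> j (head Q a)) (x, s0)"
proof -
  show P: "partition_of_unity AX (pou \<E>)" and U: "rel_open N U" and u: "u \<in> U"
    using ext by (simp_all add: local_extension_at_def U_def u_def N)
  note box = prod_box_def[of n "Z j" U, unfolded Z_def U_def, symmetric]
  have s: "s0 \<in> {s \<in> patch c. coords c s \<in> amb \<E>}" using s0 u by (simp add: u_def U_def)
  note e = ext[unfolded local_extension_at_def Let_def N[symmetric] u_def[symmetric] U_def[symmetric]
      V_def[symmetric] W_def[symmetric], THEN conjunct2, THEN conjunct2, THEN conjunct2, rule_format, of j]
  assume j: "j < psize (pou \<E>)"
  note ev = e[OF j, THEN conjunct1, rule_format, of v] and ea = e[OF j, THEN conjunct2, rule_format, of a]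
  {
    assume v: "v \<in> V"
    note ev = ev[OF v]
    show "fr \<E> j v \<in> idx (E v)" using ev by blast
    show "(x, s0) \<in> tdom (E v) (fr \<E> j v)" if "x \<in> pnbhd (pou \<E>) j"
      using ev that s by (auto simp: U_def)
    show "smooth_metric (n + N) (prod_box n (Z j) U) (rk (E v)) (met \<E> j v)"
    proof -
      have "\<forall>w\<in>prod_box n (Z j) U. herm_pos (rk (E v)) (met \<E> j v w)"
        and "\<forall>p<rk (E v). \<forall>q<rk (E v). smooth_on (n + N) (prod_box n (Z j) U) (\<lambda>w. met \<E> j v w $$ (p, q))"
        using ev unfolding prod_box_def Z_def by blast+
      then show ?thesis by (simp add: smooth_metric_def smooth_mat_def herm_pos_def)
    qed
    show "met \<E> j v (join n (coords (pchart (pou \<E>) j) x) u) = k v (fr \<E> j v) (x, s0)" if "x \<in> pnbhd (pou \<E>) j"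
      using ev that s unfolding u_def U_def by blast
  }
  {
    assume a: "a \<in> W"
    note ea = ea[OF a]
    show "mor \<E> j a w \<in> carrier_mat (rk (E (head Q a))) (rk (E (tail Q a)))" if "w \<in> prod_box n (Z j) U"
      using ea that unfolding prod_box_def Z_def by blast
    show "holo_on (n + N) (prod_box n (Z j) U) (\<lambda>w. mor \<E> j a w $$ (p, q))"
      if "p < rk (E (head Q a))" "q < rk (E (tail Q a))"
      using ea that unfolding prod_box_def Z_def by blast
    show "mor \<E> j a (join n (coords (pchart (pou \<E>) j) x) u) =
        \<phi> a (fr \<E> j (tail Q a)) (fr \<E> j (head Q a)) (x, s0)" if "x \<in> pnbhd (pou \<E>) j"
      using ea that s unfolding u_def U_def by blast
  }
qed

lemmas partition = extension(1) and U_open = extension(2) and u_in_U = extension(3)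

lemma chart_facts:
  assumes "j < psize (pou \<E>)"
  shows "pchart (pou \<E>) j \<in> AX" "pnbhd (pou \<E>) j \<subseteq> patch (pchart (pou \<E>) j)" "rel_open n (Z j)"
    "x \<in> pnbhd (pou \<E>) j \<Longrightarrow> cinv (pchart (pou \<E>) j) (coords (pchart (pou \<E>) j) x) = x"
    "z \<in> Z j \<Longrightarrow> herm_pos n (g (pchart (pou \<E>) j) z)"
proof -
  show c: "pchart (pou \<E>) j \<in> AX" and sub: "pnbhd (pou \<E>) j \<subseteq> patch (pchart (pou \<E>) j)"
    using partition assms by (auto simp: partition_of_unity_def)
  show "rel_open n (Z j)" unfolding Z_def by (rule piece_open[OF X g partition U_open assms])
  have "complex_manifold n AX" using g by (simp add: kaehler_manifold_def)
  from chart_properties[OF this c] have "inj_on (coords (pchart (pou \<E>) j)) (patch (pchart (pou \<E>) j))"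
    by metis
  then show "cinv (pchart (pou \<E>) j) (coords (pchart (pou \<E>) j) x) = x" if "x \<in> pnbhd (pou \<E>) j"
    using that sub by (auto intro: cinv_coords)
  show "herm_pos n (g (pchart (pou \<E>) j) z)" if "z \<in> Z j"
  proof -
    have "\<forall>z\<in>coords (pchart (pou \<E>) j) ` patch (pchart (pou \<E>) j). herm_pos n (g (pchart (pou \<E>) j) z)"
      using g c by (simp add: kaehler_manifold_def)
    then show ?thesis using sub that unfolding Z_def by blast
  qed
qed

lemma box_open: "j < psize (pou \<E>) \<Longrightarrow> rel_open (n + N) (prod_box n (Z j) U)"
  by (rule rel_open_prod_box[OF chart_facts(3) U_open])

text \<open>Every arrow of \<open>W\<close> is adjacent to one of the finitely many vertices of
  \<open>V\<close>, and the quiver is locally finite.\<close>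

lemma finite_VW: "finite V" "finite W"
proof -
  show V: "finite V" using E by (simp add: quiver_bundle_def V_def)
  have "W \<subseteq> (\<Union>v\<in>V. {a \<in> arrows Q. head Q a = v \<or> tail Q a = v})"
    by (auto simp: W_def V_def arrows'_def)
  moreover have "finite (\<Union>v\<in>V. {a \<in> arrows Q. head Q a = v \<or> tail Q a = v})"
    using V Q by (intro finite_UN_I) (auto simp: locally_finite_quiver_def V_def verts'_def)
  ultimately show "finite W" by (rule finite_subset)
qed

lemma W_ends: "a \<in> W \<Longrightarrow> head Q a \<in> V" "a \<in> W \<Longrightarrow> tail Q a \<in> V"
  by (auto simp: W_def V_def arrows'_def)

lemma mor_smooth:
  assumes j: "j < psize (pou \<E>)" and a: "a \<in> W"
  shows "smooth_mat (n + N) (prod_box n (Z j) U) (rk (E (head Q a))) (rk (E (tail Q a))) (mor \<E> j a)"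
    and "B < n + N \<Longrightarrow> p < rk (E (head Q a)) \<Longrightarrow> q < rk (E (tail Q a)) \<Longrightarrow> w \<in> prod_box n (Z j) U \<Longrightarrow>
      wdelbar B (\<lambda>w. mor \<E> j a w $$ (p, q)) w = 0"
  using extension(8)[OF j a] holo_on_smooth[OF box_open[OF j] extension(9)[OF j a]]
    holo_on_wdelbar[OF extension(9)[OF j a], of p q B w]
  by (simp_all add: smooth_mat_def)

text \<open>Carries the equation from the restricted bundle on \<open>X\<close>, where it is stated
  in frames of the family and with all arrows of \<open>Q\<close>, to the extended matrices at
  \<open>w\<close>, with sums over \<open>W\<close>.\<close>

lemma vortex_equation:
  assumes j: "j < psize (pou \<E>)" and z: "z \<in> Z j" and v: "v \<in> V" and pq: "p < rk (E v)" "q < rk (E v)"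
  defines "w \<equiv> join n z u" and "H \<equiv> met \<E> j" and "\<Phi> \<equiv> mor \<E> j"
  shows "of_nat (m v) * (\<Sum>\<alpha><n. \<Sum>\<beta><n. ginv g (pchart (pou \<E>) j) z \<beta> \<alpha> * curv \<alpha> \<beta> (H v) w $$ (p, q))
    + (\<Sum>a | a \<in> W \<and> head Q a = v. (\<Phi> a w * hadj (H (tail Q a)) (H (head Q a)) (\<Phi> a) w) $$ (p, q))
    - (\<Sum>a | a \<in> W \<and> tail Q a = v. (hadj (H (tail Q a)) (H (head Q a)) (\<Phi> a) w * \<Phi> a w) $$ (p, q))
    = of_real (\<tau> v) * (if p = q then 1 else 0)"
proof -
  let ?c = "pchart (pou \<E>) j"
  from z obtain x where x: "x \<in> pnbhd (pou \<E>) j" "z = coords ?c x" by (auto simp: Z_def)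
  have "\<exists>i. i \<in> idx (E v) \<and> (x, s0) \<in> tdom (E v) i" if "v \<in> verts Q" for v
  proof -
    have "holo_bundle (prod_atlas AX AS) (E v)" using E that by (simp add: quiver_bundle_def)
    then have "(\<Union>i\<in>idx (E v). tdom (E v) i) = UNIV" by (simp add: holo_bundle_def)
    then show ?thesis by auto
  qed
  then obtain fr0 where fr0: "\<And>v. v \<in> verts Q \<Longrightarrow> fr0 v \<in> idx (E v) \<and> (x, s0) \<in> tdom (E v) (fr0 v)"
    by metis
  \<comment> \<open>\<open>quiver_vortex\<close> asks for a frame at every vertex, while the
    extension fixes frames on \<open>V\<close> only; at the other vertices any frame around the
    point will do.\<close>
  define f where "f v = (if v \<in> V then fr \<E> j v else fr0 v)" for v
  have f: "f v \<in> idx (E v)" "(x, s0) \<in> tdom (E v) (f v)" if "v \<in> verts Q" for v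
    using fr0[OF that] extension(4,5)[OF j] x by (auto simp: f_def)
  define H' where "H' v = in_chart ?c (restrict_metric s0 k v (f v))" for v
  define \<Phi>' where "\<Phi>' a = in_chart ?c (restrict_mor s0 \<phi> a (f (tail Q a)) (f (head Q a)))" for a
  define S where "S a = hadj (H' (tail Q a)) (H' (head Q a)) (\<Phi>' a) z" for a
  have cx: "cinv ?c z = x" using chart_facts(4)[OF j x(1)] x(2) by simp
  have VQ: "V \<subseteq> verts Q" by (auto simp: V_def verts'_def)
  have eqn: "of_nat (m v) * mean_curv_entry n g ?c (H' v) z p q
      + (\<Sum>a | a \<in> arrows Q \<and> head Q a = v. (\<Phi>' a z * S a) $$ (p, q))
      - (\<Sum>a | a \<in> arrows Q \<and> tail Q a = v. (S a * \<Phi>' a z) $$ (p, q))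
      = of_real (\<tau> v) * (if p = q then 1 else 0)"
  proof -
    have fr: "frames_at Q (\<lambda>v. restrict_bundle s0 (E v)) f x"
      using f by (auto simp: frames_at_def restrict_bundle_def)
    have v': "v \<in> verts' Q (\<lambda>v. restrict_bundle s0 (E v))"
      using v by (auto simp: V_def verts'_def restrict_bundle_def)
    have c: "?c \<in> AX" "x \<in> patch ?c" using chart_facts[OF j] x by auto
    have rk: "p < rk (restrict_bundle s0 (E v))" "q < rk (restrict_bundle s0 (E v))"
      using pq by (simp_all add: restrict_bundle_def)
    have "of_nat (m v) * mean_curv_entry n g ?c (H' v) z p q
        + (\<Sum>a | a \<in> arrows Q \<and> head Q a = v. (\<Phi>' a z * S a) $$ (p, q))
        - (\<Sum>a | a \<in> arrows Q \<and> tail Q a = v. (S a * \<Phi>' a z) $$ (p, q))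
        = of_real (\<tau> v) * (1\<^sub>m (rk (restrict_bundle s0 (E v))) $$ (p, q))"
      unfolding H'_def \<Phi>'_def S_def x(2)
      by (rule vortex[unfolded quiver_vortex_def Let_def, rule_format, OF c fr v' rk])
    also have "1\<^sub>m (rk (restrict_bundle s0 (E v))) $$ (p, q) = (if p = q then 1 else 0 :: complex)"
      using rk by simp
    finally show ?thesis .
  qed
  \<comment> \<open>On all of \<open>Z j\<close>, since the curvature differentiates the metrics;
    the bundle maps are compared at \<open>z\<close> alone.\<close>
  have HH: "H' v z' = H v (join n z' u)" if "v \<in> V" "z' \<in> Z j" for v z'
  proof -
    from that(2) obtain x' where x': "x' \<in> pnbhd (pou \<E>) j" "z' = coords ?c x'" by (auto simp: Z_def)
    then show ?thesis
      using extension(7)[OF j that(1) x'(1)] chart_facts(4)[OF j x'(1)] that(1)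
      by (simp add: H'_def H_def in_chart_def restrict_metric_def f_def)
  qed
  have \<Phi>\<Phi>: "\<Phi>' a z = \<Phi> a w" if "a \<in> W" for a
    using extension(10)[OF j that x(1)] W_ends[OF that] cx
    by (simp add: \<Phi>'_def \<Phi>_def in_chart_def restrict_mor_def f_def w_def x(2))
  have SS: "S a = hadj (H (tail Q a)) (H (head Q a)) (\<Phi> a) w" if "a \<in> W" for a
    using HH[OF W_ends(1)[OF that] z] HH[OF W_ends(2)[OF that] z] \<Phi>\<Phi>[OF that]
    by (simp add: S_def hadj_def w_def)
  have mean: "mean_curv_entry n g ?c (H' v) z p q =
      (\<Sum>\<alpha><n. \<Sum>\<beta><n. ginv g ?c z \<beta> \<alpha> * curv \<alpha> \<beta> (H v) w $$ (p, q))"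
  proof -
    have "curv \<alpha> \<beta> (H' v) z = curv \<alpha> \<beta> (H v) w" if "\<alpha> < n" "\<beta> < n" for \<alpha> \<beta>
      unfolding w_def by (rule curv_join[OF chart_facts(3)[OF j] z that]) (rule HH[OF v])
    then show ?thesis unfolding mean_curv_entry_def by (intro sum.cong refl) simp
  qed
  have ends: "head Q a \<in> verts Q" "tail Q a \<in> verts Q" if "a \<in> arrows Q" for a
    using Q that by (auto simp: locally_finite_quiver_def)
  have pos: "herm_pos (rk (E v)) (H' v z)" if "v \<in> verts Q" for v
  proof -
    have "\<forall>i\<in>idx (E v). \<forall>y\<in>tdom (E v) i. herm_pos (rk (E v)) (k v i y)"
      using bspec[OF k that] unfolding herm_metric_def by blast
    then show ?thesis using f[OF that] cx by (simp add: H'_def in_chart_def restrict_metric_def)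
  qed
  have \<Phi>c: "\<Phi>' a z \<in> carrier_mat (rk (E (head Q a))) (rk (E (tail Q a)))" if "a \<in> arrows Q" for a
  proof -
    have "\<forall>i\<in>idx (E (tail Q a)). \<forall>j\<in>idx (E (head Q a)). \<forall>y\<in>tdom (E (tail Q a)) i \<inter> tdom (E (head Q a)) j.
        \<phi> a i j y \<in> carrier_mat (rk (E (head Q a))) (rk (E (tail Q a)))"
      using E[unfolded quiver_bundle_def Let_def, THEN conjunct2, THEN conjunct2, THEN conjunct1, THEN bspec, OF that,
          THEN conjunct1] by blast
    then show ?thesis
      using f[OF ends(1)[OF that]] f[OF ends(2)[OF that]] cx by (simp add: \<Phi>'_def in_chart_def restrict_mor_def)
  qed
  have Sc: "S a \<in> carrier_mat (rk (E (tail Q a))) (rk (E (head Q a)))" if "a \<in> arrows Q" for a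
    unfolding S_def using pos[OF ends(2)[OF that]] pos[OF ends(1)[OF that]] \<Phi>c[OF that] by (rule hadj_carrier)
  have "finite {a \<in> arrows Q. head Q a = v \<or> tail Q a = v}"
    using Q v VQ by (auto simp: locally_finite_quiver_def)
  then have fin: "finite {a \<in> arrows Q. head Q a = v}" "finite {a \<in> arrows Q. tail Q a = v}"
    by (rule rev_finite_subset; blast)+
  \<comment> \<open>An arrow into \<open>v\<close> outside of \<open>W\<close> starts at a bundle of
    rank 0, so its matrix product is a sum over the empty set.\<close>
  have "(\<Sum>a | a \<in> arrows Q \<and> head Q a = v. (\<Phi>' a z * S a) $$ (p, q)) =
      (\<Sum>a | a \<in> W \<and> head Q a = v. (\<Phi>' a z * S a) $$ (p, q))"
  proof (rule sum.mono_neutral_right[OF fin(1)])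
    show "\<forall>a\<in>{a \<in> arrows Q. head Q a = v} - {a \<in> W. head Q a = v}. (\<Phi>' a z * S a) $$ (p, q) = 0"
    proof
      fix a assume a: "a \<in> {a \<in> arrows Q. head Q a = v} - {a \<in> W. head Q a = v}"
      then have "rk (E (tail Q a)) = 0"
        using v ends by (auto simp: W_def V_def arrows'_def verts'_def)
      then show "(\<Phi>' a z * S a) $$ (p, q) = 0"
        using mult_mat_index[OF \<Phi>c Sc, of a p q] a pq by auto
    qed
  qed (auto simp: W_def arrows'_def)
  also have "\<dots> = (\<Sum>a | a \<in> W \<and> head Q a = v. (\<Phi> a w * hadj (H (tail Q a)) (H (head Q a)) (\<Phi> a) w) $$ (p, q))"
    by (intro sum.cong refl) (simp add: \<Phi>\<Phi> SS)
  finally have heads: "(\<Sum>a | a \<in> arrows Q \<and> head Q a = v. (\<Phi>' a z * S a) $$ (p, q)) = \<dots>" .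
  have "(\<Sum>a | a \<in> arrows Q \<and> tail Q a = v. (S a * \<Phi>' a z) $$ (p, q)) =
      (\<Sum>a | a \<in> W \<and> tail Q a = v. (S a * \<Phi>' a z) $$ (p, q))"
  proof (rule sum.mono_neutral_right[OF fin(2)])
    show "\<forall>a\<in>{a \<in> arrows Q. tail Q a = v} - {a \<in> W. tail Q a = v}. (S a * \<Phi>' a z) $$ (p, q) = 0"
    proof
      fix a assume a: "a \<in> {a \<in> arrows Q. tail Q a = v} - {a \<in> W. tail Q a = v}"
      then have "rk (E (head Q a)) = 0"
        using v ends by (auto simp: W_def V_def arrows'_def verts'_def)
      then show "(S a * \<Phi>' a z) $$ (p, q) = 0"
        using mult_mat_index[OF Sc \<Phi>c, of a p q] a pq by auto
    qed
  qed (auto simp: W_def arrows'_def)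
  also have "\<dots> = (\<Sum>a | a \<in> W \<and> tail Q a = v. (hadj (H (tail Q a)) (H (head Q a)) (\<Phi> a) w * \<Phi> a w) $$ (p, q))"
    by (intro sum.cong refl) (simp add: \<Phi>\<Phi> SS)
  finally have tails: "(\<Sum>a | a \<in> arrows Q \<and> tail Q a = v. (S a * \<Phi>' a z) $$ (p, q)) = \<dots>" .
  show ?thesis using eqn unfolding mean heads tails .
qed

lemma Z_eq: "Z j = coords (pchart (pou \<E>) j) ` pnbhd (pou \<E>) j"
  by (simp add: Z_def)

lemmas int_eq = fiber_int_eq[OF X g partition U_open, folded Z_eq]
  and int_fun_eq = fiber_int_fun_eq[OF X g partition U_open, folded Z_eq]
  and int_fun_cong = fiber_int_fun_cong[OF X g partition U_open, folded Z_eq]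
  and int_fun_add = fiber_int_fun_add[OF X g partition U_open, folded Z_eq]
  and int_fun_scale = fiber_int_fun_scale[OF X g partition U_open]
  and int_fun_sum = fiber_int_fun_sum[OF X g partition U_open, folded Z_eq]
  and int_fun_wdel_wdelbar = fiber_int_fun_wdel_wdelbar[OF X g partition U_open, folded Z_eq]

lemma ginv_sums:
  assumes j: "j < psize (pou \<E>)" and z: "z \<in> Z j" and ab: "a < n" "b < n"
  shows "(\<Sum>\<alpha><n. ginv g (pchart (pou \<E>) j) z a \<alpha> * g (pchart (pou \<E>) j) z $$ (\<alpha>, b)) = (if a = b then 1 else 0)"
    and "(\<Sum>\<beta><n. g (pchart (pou \<E>) j) z $$ (a, \<beta>) * ginv g (pchart (pou \<E>) j) z \<beta> b) = (if a = b then 1 else 0)"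
proof -
  let ?g = "g (pchart (pou \<E>) j) z"
  have pos: "herm_pos n ?g" by (rule chart_facts(5)[OF j z])
  then have c: "?g \<in> carrier_mat n n" by (simp add: herm_pos_def)
  note i = minv_inverse[OF c herm_pos_det[OF pos]]
  show "(\<Sum>\<alpha><n. ginv g (pchart (pou \<E>) j) z a \<alpha> * ?g $$ (\<alpha>, b)) = (if a = b then 1 else 0)"
    using mult_mat_index[OF i(1) c ab] ab i(3) by (simp add: ginv_def)
  show "(\<Sum>\<beta><n. ?g $$ (a, \<beta>) * ginv g (pchart (pou \<E>) j) z \<beta> b) = (if a = b then 1 else 0)"
    using mult_mat_index[OF c i(1) ab] ab i(2) by (simp add: ginv_def)
qed

lemma ginv_continuous:
  assumes j: "j < psize (pou \<E>)" and ab: "\<beta> < n" "\<alpha> < n"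
  shows "continuous_on (prod_box n (Z j) U) (\<lambda>w. ginv g (pchart (pou \<E>) j) (fiber_part n w) \<beta> \<alpha>)"
proof -
  let ?c = "pchart (pou \<E>) j" and ?Z = "coords (pchart (pou \<E>) j) ` patch (pchart (pou \<E>) j)"
  note cf = chart_facts[OF j]
  have mfd: "complex_manifold n AX" using g by (simp add: kaehler_manifold_def)
  have Zo: "rel_open n ?Z" using mfd cf(1) by (simp add: complex_manifold_def)
  have g': "\<forall>z\<in>?Z. herm_pos n (g ?c z)" "\<forall>\<alpha><n. \<forall>\<beta><n. smooth_on n ?Z (\<lambda>z. g ?c z $$ (\<alpha>, \<beta>))"
    using g cf(1) by (simp_all add: kaehler_manifold_def)
  then have "smooth_mat n ?Z n n (g ?c)" by (simp add: smooth_mat_def herm_pos_def)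
  then have "smooth_mat n ?Z n n (\<lambda>z. minv (g ?c z))"
    by (rule smooth_mat_minv[OF Zo]) (use g' herm_pos_det in blast)
  then have "continuous_on ?Z (\<lambda>z. ginv g ?c z \<beta> \<alpha>)"
    unfolding ginv_def using ab by (intro smooth_on_continuous smooth_mat_entry)
  then show ?thesis
  proof (rule continuous_on_compose2)
    show "continuous_on (prod_box n (Z j) U) (fiber_part n)"
    proof (rule continuous_on_coordinatewise_then_product)
      show "continuous_on (prod_box n (Z j) U) (\<lambda>w. fiber_part n w i)" for i
        unfolding fiber_part_def using continuous_on_product_then_coordinatewise[OF continuous_on_id]
        by (cases "i < n") auto
    qed
    show "fiber_part n ` prod_box n (Z j) U \<subseteq> ?Z"
    proof
      fix y assume "y \<in> fiber_part n ` prod_box n (Z j) U"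
      then obtain z s where "y = fiber_part n (join n z s)" "z \<in> Z j" by (auto simp: prod_box_def)
      then have "y = z" using rel_open_subset[OF cf(3)] fiber_part_join by blast
      with \<open>z \<in> Z j\<close> show "y \<in> ?Z" using cf(2) by (auto simp: Z_def)
    qed
  qed
qed

section \<open>The integrands and the three terms of the formula\<close>

lemma curv_smooth:
  "j < psize (pou \<E>) \<Longrightarrow> v \<in> V \<Longrightarrow> A < n + N \<Longrightarrow> B < n + N \<Longrightarrow>
    smooth_mat (n + N) (prod_box n (Z j) U) (rk (E v)) (rk (E v)) (curv A B (met \<E> j v))"
  by (intro smooth_curv[OF box_open extension(6)])

text \<open>The curvature part of the integrand of \<open>G_WP\<close>, for one vertex and without
  the factor \<open>m v\<close>.\<close>

definition mixed_trace :: "'q \<Rightarrow> nat \<Rightarrow> nat \<Rightarrow> nat \<Rightarrow> cvec \<Rightarrow> complex" where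
  "mixed_trace v i l j w = (\<Sum>\<alpha><n. \<Sum>\<beta><n. ginv g (pchart (pou \<E>) j) (fiber_part n w) \<beta> \<alpha> *
     mtrace (curv (n + i) \<beta> (met \<E> j v) w * curv \<alpha> (n + l) (met \<E> j v) w))"

text \<open>Summing over the fiber indices first, this is the trace of the base curvature times the
  mean curvature, which is the quantity that the vortex equation controls.\<close>

definition mean_trace :: "'q \<Rightarrow> nat \<Rightarrow> nat \<Rightarrow> nat \<Rightarrow> cvec \<Rightarrow> complex" where
  "mean_trace v i l j w = (\<Sum>\<alpha><n. \<Sum>\<beta><n. ginv g (pchart (pou \<E>) j) (fiber_part n w) \<beta> \<alpha> *
     mtrace (curv (n + i) (n + l) (met \<E> j v) w * curv \<alpha> \<beta> (met \<E> j v) w))"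

definition base_trace :: "'q \<Rightarrow> nat \<Rightarrow> nat \<Rightarrow> nat \<Rightarrow> cvec \<Rightarrow> complex" where
  "base_trace v i l j w = mtrace (curv (n + i) (n + l) (met \<E> j v) w)"

text \<open>The part of the integrand of \<open>G_WP\<close> that belongs to one arrow.\<close>

definition mor_trace :: "'a \<Rightarrow> nat \<Rightarrow> nat \<Rightarrow> nat \<Rightarrow> cvec \<Rightarrow> complex" where
  "mor_trace a i l j w =
     mtrace (cov_del (n + i) (met \<E> j (tail Q a)) (met \<E> j (head Q a)) (mor \<E> j a) w *
             cov_delbar_adj (n + l) (met \<E> j (tail Q a)) (met \<E> j (head Q a)) (mor \<E> j a) w)"

text \<open>Fiber integrals of sums can be split because continuous integrands are integrable
  against the weights.\<close>

lemma continuous_traces: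
  assumes j: "j < psize (pou \<E>)" and il: "i < N" "l < N"
  shows "v \<in> V \<Longrightarrow> continuous_on (prod_box n (Z j) U) (mixed_trace v i l j)"
    and "v \<in> V \<Longrightarrow> continuous_on (prod_box n (Z j) U) (mean_trace v i l j)"
    and "v \<in> V \<Longrightarrow> continuous_on (prod_box n (Z j) U) (base_trace v i l j)"
    and "a \<in> W \<Longrightarrow> continuous_on (prod_box n (Z j) U) (mor_trace a i l j)"
proof -
  note box = box_open[OF j]
  note tr = smooth_on_continuous[OF smooth_on_mtrace[OF box]] and mult = smooth_mat_mult[OF box]
  {
    assume v: "v \<in> V"
    note R = curv_smooth[OF j v]
    have RR: "continuous_on (prod_box n (Z j) U) (\<lambda>w. mtrace (curv A B (met \<E> j v) w * curv A' B' (met \<E> j v) w))"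
      if "A < n + N" "B < n + N" "A' < n + N" "B' < n + N" for A B A' B'
      by (rule tr[OF mult[OF R[OF that(1,2)] R[OF that(3,4)]]])
    show "continuous_on (prod_box n (Z j) U) (mixed_trace v i l j)"
      unfolding mixed_trace_def[abs_def] using il
      by (intro continuous_on_sum continuous_on_mult ginv_continuous[OF j] RR) auto
    show "continuous_on (prod_box n (Z j) U) (mean_trace v i l j)"
      unfolding mean_trace_def[abs_def] using il
      by (intro continuous_on_sum continuous_on_mult ginv_continuous[OF j] RR) auto
    show "continuous_on (prod_box n (Z j) U) (base_trace v i l j)"
      unfolding base_trace_def[abs_def] using il by (intro tr[OF R]) auto
  }
  show "continuous_on (prod_box n (Z j) U) (mor_trace a i l j)" if a: "a \<in> W"
  proof -
    note Ht = extension(6)[OF j W_ends(2)[OF a]] and Hh = extension(6)[OF j W_ends(1)[OF a]]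
    show ?thesis
      unfolding mor_trace_def[abs_def]
      by (rule tr[OF mult[OF smooth_cov_del[OF box Ht Hh mor_smooth[OF j a]]
            smooth_cov_delbar_adj[OF box Ht Hh mor_smooth[OF j a]]]]) (use il in auto)
  qed
qed

lemma int_fun_form11:
  assumes "\<And>i l j. i < N \<Longrightarrow> l < N \<Longrightarrow> j < psize (pou \<E>) \<Longrightarrow> continuous_on (prod_box n (Z j) U) (f i l j)"
  shows "fiber_int_fun n g \<E> (\<lambda>j w. form11 N (\<lambda>i l. f i l j w) K) u = form11 N (\<lambda>i l. fiber_int_fun n g \<E> (f i l) u) K"
proof -
  have "fiber_int_fun n g \<E> (\<lambda>j w. form11 N (\<lambda>i l. f i l j w) K) u =
      (\<Sum>i<N. fiber_int_fun n g \<E> (\<lambda>j w. \<Sum>l<N. f i l j w * wedge (dw i) (dwbar l) K) u)"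
    unfolding form11_def
    by (rule int_fun_sum[OF _ u_in_U]) (auto intro!: continuous_on_sum continuous_on_mult assms continuous_on_const)
  also have "\<dots> = (\<Sum>i<N. \<Sum>l<N. fiber_int_fun n g \<E> (\<lambda>j w. f i l j w * wedge (dw i) (dwbar l) K) u)"
    by (intro sum.cong refl int_fun_sum[OF _ u_in_U]) (auto intro!: continuous_on_mult assms continuous_on_const)
  also have "\<dots> = form11 N (\<lambda>i l. fiber_int_fun n g \<E> (f i l) u) K"
    unfolding form11_def by (simp add: int_fun_scale mult.commute[of _ "wedge (dw i) (dwbar l) K" for i l])
  finally show ?thesis .
qed

text \<open>Summed over matrix entries, the four terms of the double contraction become traces, and
  cyclicity makes them equal in pairs. This is the 2 that the factor 1/2 in front of the first term
  compensates.\<close>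

lemma sum_trace_wedge:
  assumes j: "j < psize (pou \<E>)" and z: "z \<in> Z j" and v: "v \<in> V" and K: "K \<subseteq> {..<2 * N}"
  shows "wedge (fscale (of_nat (m v)) (tr_Omega_Omega (n + N) (met \<E> j v) (join n z u)))
      (omegaX_pow n g \<E> (n - 1) j (join n z u)) ({..<2 * n} \<union> (+) (2 * n) ` K) =
    form11 N (\<lambda>i l. 2 * \<i> * of_nat (m v) * (mixed_trace v i l j (join n z u) - mean_trace v i l j (join n z u))) K *
    (1 / fact n * fpow (kform n g (pchart (pou \<E>) j) z) n {..<2 * n})"
proof -
  let ?c = "pchart (pou \<E>) j" and ?w = "join n z u" and ?r = "rk (E v)" and ?L = "{..<2 * n} \<union> (+) (2 * n) ` K"
  let ?R = "\<lambda>A B. curv A B (met \<E> j v) ?w" and ?\<omega> = "kform n g (pchart (pou \<E>) j) z"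
  have w: "?w \<in> prod_box n (Z j) U" using z u_in_U by (rule join_in_prod_box)
  have dim: "dim_row (met \<E> j v ?w) = ?r"
    using extension(6)[OF j v] w by (auto simp: smooth_metric_def smooth_mat_def)
  have R: "?R A B \<in> carrier_mat ?r ?r" if "A < n + N" "B < n + N" for A B
    by (rule smooth_mat_carrier[OF curv_smooth[OF j v that] w])
  have fp: "fiber_part n ?w = z" using z rel_open_subset[OF chart_facts(3)[OF j]] fiber_part_join by blast
  define D where "D p q i l = (\<Sum>\<alpha><n. \<Sum>\<beta><n. ginv g ?c z \<beta> \<alpha> *
      (?R (n + i) \<beta> $$ (p, q) * ?R \<alpha> (n + l) $$ (q, p) + ?R \<alpha> (n + l) $$ (p, q) * ?R (n + i) \<beta> $$ (q, p)
       - ?R (n + i) (n + l) $$ (p, q) * ?R \<alpha> \<beta> $$ (q, p) - ?R \<alpha> \<beta> $$ (p, q) * ?R (n + i) (n + l) $$ (q, p)))" for p q i l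
  have wedge: "of_nat n * wedge (wedge (Omega (n + N) (met \<E> j v) ?w p q) (Omega (n + N) (met \<E> j v) ?w q p)) (fpow ?\<omega> (n - 1)) ?L
      = \<i> * fpow ?\<omega> n {..<2 * n} * form11 N (D p q) K" for p q
    unfolding Omega_def kform_def D_def
    by (rule wedge_form11_form11_fpow[OF n ginv_sums[OF j z] K])
  have sumD: "(\<Sum>p<?r. \<Sum>q<?r. D p q i l) = 2 * (mixed_trace v i l j ?w - mean_trace v i l j ?w)" if il: "i < N" "l < N" for i l
  proof -
    have "(\<Sum>p<?r. \<Sum>q<?r. D p q i l) = (\<Sum>\<alpha><n. \<Sum>\<beta><n. \<Sum>p<?r. \<Sum>q<?r. ginv g ?c z \<beta> \<alpha> *
      (?R (n + i) \<beta> $$ (p, q) * ?R \<alpha> (n + l) $$ (q, p) + ?R \<alpha> (n + l) $$ (p, q) * ?R (n + i) \<beta> $$ (q, p)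
       - ?R (n + i) (n + l) $$ (p, q) * ?R \<alpha> \<beta> $$ (q, p) - ?R \<alpha> \<beta> $$ (p, q) * ?R (n + i) (n + l) $$ (q, p)))"
      unfolding D_def by (rule sum_swap_pairs)
    also have "\<dots> = (\<Sum>\<alpha><n. \<Sum>\<beta><n. ginv g ?c z \<beta> \<alpha> * (2 * mtrace (?R (n + i) \<beta> * ?R \<alpha> (n + l))
        - 2 * mtrace (?R (n + i) (n + l) * ?R \<alpha> \<beta>)))"
    proof (intro sum.cong refl)
      fix \<alpha> \<beta> assume "\<alpha> \<in> {..<n}" "\<beta> \<in> {..<n}"
      then have ab: "\<alpha> < n + N" "\<beta> < n + N" "n + i < n + N" "n + l < n + N" using il by auto
      note tr = mtrace_mult[OF R R, symmetric]
      have comm: "mtrace (?R \<alpha> (n + l) * ?R (n + i) \<beta>) = mtrace (?R (n + i) \<beta> * ?R \<alpha> (n + l))"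
        "mtrace (?R \<alpha> \<beta> * ?R (n + i) (n + l)) = mtrace (?R (n + i) (n + l) * ?R \<alpha> \<beta>)"
        by (rule mtrace_mult_comm[OF R[OF ab(1,4)] R[OF ab(3,2)]], rule mtrace_mult_comm[OF R[OF ab(1,2)] R[OF ab(3,4)]])
      show "(\<Sum>p<?r. \<Sum>q<?r. ginv g ?c z \<beta> \<alpha> *
          (?R (n + i) \<beta> $$ (p, q) * ?R \<alpha> (n + l) $$ (q, p) + ?R \<alpha> (n + l) $$ (p, q) * ?R (n + i) \<beta> $$ (q, p)
           - ?R (n + i) (n + l) $$ (p, q) * ?R \<alpha> \<beta> $$ (q, p) - ?R \<alpha> \<beta> $$ (p, q) * ?R (n + i) (n + l) $$ (q, p))) =
          ginv g ?c z \<beta> \<alpha> * (2 * mtrace (?R (n + i) \<beta> * ?R \<alpha> (n + l)) - 2 * mtrace (?R (n + i) (n + l) * ?R \<alpha> \<beta>))"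
        unfolding sum_distrib_left[symmetric] sum.distrib sum_subtractf
          tr[OF ab(3,2,1,4)] tr[OF ab(1,4,3,2)] tr[OF ab(3,4,1,2)] tr[OF ab(1,2,3,4)] comm
        by (simp add: algebra_simps)
    qed
    also have "\<dots> = 2 * (mixed_trace v i l j ?w - mean_trace v i l j ?w)"
      unfolding mixed_trace_def mean_trace_def fp
      by (simp add: sum_distrib_left sum_subtractf[symmetric] algebra_simps)
    finally show ?thesis .
  qed
  have "wedge (fscale (of_nat (m v)) (tr_Omega_Omega (n + N) (met \<E> j v) ?w)) (omegaX_pow n g \<E> (n - 1) j ?w) ?L
      = of_nat (m v) * (1 / fact (n - 1)) * (\<Sum>p<?r. \<Sum>q<?r.
          wedge (wedge (Omega (n + N) (met \<E> j v) ?w p q) (Omega (n + N) (met \<E> j v) ?w q p)) (fpow ?\<omega> (n - 1)) ?L)"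
    unfolding omegaX_pow_join[OF X g partition U_open j z[unfolded Z_eq]] tr_Omega_Omega_def fscale_def dim wedge_linear_left wedge_linear_right
    by (simp add: sum_divide_distrib sum_distrib_left)
  \<comment> \<open>1 / (n-1)! is n / n!, which supplies the factor \<open>of_nat n\<close> of the
    algebraic identity.\<close>
  also have "\<dots> = of_nat (m v) * (1 / fact n) * (\<Sum>p<?r. \<Sum>q<?r. \<i> * fpow ?\<omega> n {..<2 * n} * form11 N (D p q) K)"
    unfolding wedge[symmetric] sum_distrib_left[symmetric] using n by (simp add: fact_reduce field_simps)
  also have "\<dots> = of_nat (m v) * (1 / fact n) * (\<i> * fpow ?\<omega> n {..<2 * n} * form11 N (\<lambda>i l. \<Sum>p<?r. \<Sum>q<?r. D p q i l) K)"
    unfolding sum_distrib_left[symmetric] form11_sum ..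
  also have "form11 N (\<lambda>i l. \<Sum>p<?r. \<Sum>q<?r. D p q i l) K = form11 N (\<lambda>i l. 2 * (mixed_trace v i l j ?w - mean_trace v i l j ?w)) K"
    by (rule form11_cong) (rule sumD)
  also have "of_nat (m v) * (1 / fact n) * (\<i> * fpow ?\<omega> n {..<2 * n} * \<dots>) =
      (\<i> * of_nat (m v) * form11 N (\<lambda>i l. 2 * (mixed_trace v i l j ?w - mean_trace v i l j ?w)) K) * (1 / fact n * fpow ?\<omega> n {..<2 * n})"
    by (simp only: mult_ac)
  also have "\<i> * of_nat (m v) * form11 N (\<lambda>i l. 2 * (mixed_trace v i l j ?w - mean_trace v i l j ?w)) K =
      form11 N (\<lambda>i l. 2 * \<i> * of_nat (m v) * (mixed_trace v i l j ?w - mean_trace v i l j ?w)) K"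
    unfolding form11_scale by (simp only: mult_ac)
  finally show ?thesis .
qed

lemma first_term:
  assumes v: "v \<in> V" and K: "K \<subseteq> {..<2 * N}"
  shows "fiber_int n (pou \<E>)
      (\<lambda>j w. wedge (fscale (of_nat (m v)) (tr_Omega_Omega (n + N) (met \<E> j v) w)) (omegaX_pow n g \<E> (n - 1) j w)) u K =
    form11 N (\<lambda>i l. 2 * \<i> * of_nat (m v) * fiber_int_fun n g \<E> (\<lambda>j w. mixed_trace v i l j w - mean_trace v i l j w) u) K"
proof -
  have "fiber_int n (pou \<E>)
      (\<lambda>j w. wedge (fscale (of_nat (m v)) (tr_Omega_Omega (n + N) (met \<E> j v) w)) (omegaX_pow n g \<E> (n - 1) j w)) u K =
    fiber_int_fun n g \<E> (\<lambda>j w. form11 N (\<lambda>i l. 2 * \<i> * of_nat (m v) * (mixed_trace v i l j w - mean_trace v i l j w)) K) u"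
    unfolding int_fun_eq by (rule int_eq) (rule sum_trace_wedge[OF _ _ v K])
  also have "\<dots> = form11 N (\<lambda>i l. fiber_int_fun n g \<E> (\<lambda>j w. 2 * \<i> * of_nat (m v) * (mixed_trace v i l j w - mean_trace v i l j w)) u) K"
    by (rule int_fun_form11) (intro continuous_on_mult continuous_on_diff continuous_on_const continuous_traces v)
  finally show ?thesis unfolding int_fun_scale .
qed

text \<open>omega_X^n exhausts the fiber covectors, so of the trace of the curvature only the part
  with two base indices remains.\<close>

lemma second_term:
  assumes v: "v \<in> V" and K: "K \<subseteq> {..<2 * N}"
  shows "fiber_int n (pou \<E>) (\<lambda>j w. wedge (tr_Omega (n + N) (met \<E> j v) w) (omegaX_pow n g \<E> n j w)) u K =
    form11 N (\<lambda>i l. fiber_int_fun n g \<E> (base_trace v i l) u) K"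
proof -
  have "fiber_int n (pou \<E>) (\<lambda>j w. wedge (tr_Omega (n + N) (met \<E> j v) w) (omegaX_pow n g \<E> n j w)) u K =
      fiber_int_fun n g \<E> (\<lambda>j w. form11 N (\<lambda>i l. base_trace v i l j w) K) u"
    unfolding int_fun_eq
  proof (rule int_eq)
    fix j z assume j: "j < psize (pou \<E>)" and z: "z \<in> Z j"
    let ?w = "join n z u"
    have w: "?w \<in> prod_box n (Z j) U" using z u_in_U by (rule join_in_prod_box)
    have dim: "dim_row (met \<E> j v ?w) = rk (E v)"
      using extension(6)[OF j v] w by (auto simp: smooth_metric_def smooth_mat_def)
    have "(\<Sum>p<rk (E v). curv (n + i) (n + l) (met \<E> j v) ?w $$ (p, p)) = base_trace v i l j ?w" if "i < N" "l < N" for i l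
      using smooth_mat_carrier[OF curv_smooth[OF j v] w, of "n + i" "n + l"] that by (simp add: base_trace_def mtrace_def)
    then have tr: "form11 N (\<lambda>i l. \<Sum>p<rk (E v). curv (n + i) (n + l) (met \<E> j v) ?w $$ (p, p)) K =
        form11 N (\<lambda>i l. base_trace v i l j ?w) K"
      by (intro form11_cong) auto
    show "wedge (tr_Omega (n + N) (met \<E> j v) ?w) (omegaX_pow n g \<E> n j ?w) ({..<2 * n} \<union> (+) (2 * n) ` K) =
        form11 N (\<lambda>i l. base_trace v i l j ?w) K * (1 / fact n * fpow (kform n g (pchart (pou \<E>) j) z) n {..<2 * n})"
      unfolding omegaX_pow_join[OF X g partition U_open j z[unfolded Z_eq]] tr_Omega_def fscale_def dim Omega_def kform_def
        wedge_linear_left wedge_linear_right wedge_form11_fpow_top[OF K] sum_distrib_right[symmetric] form11_sum tr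
      by (simp only: mult_ac)
  qed
  also have "\<dots> = form11 N (\<lambda>i l. fiber_int_fun n g \<E> (base_trace v i l) u) K"
    by (rule int_fun_form11) (rule continuous_traces(3)[OF _ _ _ v])
  finally show ?thesis .
qed

text \<open>The integrand of the third term, for one arrow, after both derivatives have been moved
  under the fiber integral.\<close>

definition mor_hessian :: "'a \<Rightarrow> nat \<Rightarrow> nat \<Rightarrow> nat \<Rightarrow> cvec \<Rightarrow> complex" where
  "mor_hessian a i l j = wdel (n + i) (wdelbar (n + l) (norm_mor Q \<E> a j))"

lemma mor_hessian:
  assumes j: "j < psize (pou \<E>)" and a: "a \<in> W" and il: "i < N" "l < N"
  shows "w \<in> prod_box n (Z j) U \<Longrightarrow> mor_hessian a i l j w = mor_trace a i l j w
      + mtrace (curv (n + i) (n + l) (met \<E> j (tail Q a)) w *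
          (hadj (met \<E> j (tail Q a)) (met \<E> j (head Q a)) (mor \<E> j a) w * mor \<E> j a w))
      - mtrace (curv (n + i) (n + l) (met \<E> j (head Q a)) w *
          (mor \<E> j a w * hadj (met \<E> j (tail Q a)) (met \<E> j (head Q a)) (mor \<E> j a) w))"
    and "smooth_on (n + N) (prod_box n (Z j) U) (norm_mor Q \<E> a j)"
    and "continuous_on (prod_box n (Z j) U) (mor_hessian a i l j)"
proof -
  note box = box_open[OF j] and Ht = extension(6)[OF j W_ends(2)[OF a]] and Hh = extension(6)[OF j W_ends(1)[OF a]]
    and \<Phi> = mor_smooth[OF j a]
  have il': "n + i < n + N" "n + l < n + N" using il by auto
  show "mor_hessian a i l j w = mor_trace a i l j w
      + mtrace (curv (n + i) (n + l) (met \<E> j (tail Q a)) w *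
          (hadj (met \<E> j (tail Q a)) (met \<E> j (head Q a)) (mor \<E> j a) w * mor \<E> j a w))
      - mtrace (curv (n + i) (n + l) (met \<E> j (head Q a)) w *
          (mor \<E> j a w * hadj (met \<E> j (tail Q a)) (met \<E> j (head Q a)) (mor \<E> j a) w))"
    if "w \<in> prod_box n (Z j) U"
    unfolding mor_hessian_def norm_mor_def[abs_def] mor_trace_def
    by (rule wdel_wdelbar_norm[OF box Ht Hh \<Phi> il' that])
  show s: "smooth_on (n + N) (prod_box n (Z j) U) (norm_mor Q \<E> a j)"
    unfolding norm_mor_def[abs_def]
    by (rule smooth_on_mtrace[OF box smooth_mat_mult[OF box \<Phi>(1) smooth_hadj[OF box Ht Hh \<Phi>]]])
  show "continuous_on (prod_box n (Z j) U) (mor_hessian a i l j)"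
    unfolding mor_hessian_def
    by (rule smooth_on_continuous[OF smooth_on_wdel[OF box smooth_on_wdelbar[OF box s il'(2)] il'(1)]])
qed

lemma third_term:
  assumes a: "a \<in> W"
  shows "fdel N (fdelbar N (\<lambda>s. fconst (fiber_int_fun n g \<E> (norm_mor Q \<E> a) s))) u K =
    form11 N (\<lambda>i l. fiber_int_fun n g \<E> (mor_hessian a i l) u) K"
  unfolding fdel_fdelbar_fconst
proof (rule form11_cong)
  fix i l assume il: "i < N" "l < N"
  show "wdel i (wdelbar l (fiber_int_fun n g \<E> (norm_mor Q \<E> a))) u = fiber_int_fun n g \<E> (mor_hessian a i l) u"
    unfolding mor_hessian_def[abs_def]
    by (rule int_fun_wdel_wdelbar[OF mor_hessian(2)[OF _ a il] u_in_U il])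
qed

text \<open>The trace of the vortex equation against the curvature in the base directions.\<close>

lemma vortex_trace:
  assumes j: "j < psize (pou \<E>)" and z: "z \<in> Z j" and il: "i < N" "l < N"
  defines "w \<equiv> join n z u"
  shows "(\<Sum>a\<in>W. mor_hessian a i l j w - mor_trace a i l j w) =
    (\<Sum>v\<in>V. of_nat (m v) * mean_trace v i l j w - of_real (\<tau> v) * base_trace v i l j w)"
proof -
  define S where "S a = hadj (met \<E> j (tail Q a)) (met \<E> j (head Q a)) (mor \<E> j a) w" for a
  define \<Phi> where "\<Phi> a = mor \<E> j a w" for a
  define R where "R v = curv (n + i) (n + l) (met \<E> j v) w" for v
  have w: "w \<in> prod_box n (Z j) U" unfolding w_def using z u_in_U by (rule join_in_prod_box)
  have fp: "fiber_part n w = z"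
    unfolding w_def using z rel_open_subset[OF chart_facts(3)[OF j]] fiber_part_join by blast
  have Rc: "R v \<in> carrier_mat (rk (E v)) (rk (E v))" if "v \<in> V" for v
    unfolding R_def using il by (intro smooth_mat_carrier[OF curv_smooth[OF j that] w]) auto
  have c: "S a \<in> carrier_mat (rk (E (tail Q a))) (rk (E (head Q a)))" "\<Phi> a \<in> carrier_mat (rk (E (head Q a))) (rk (E (tail Q a)))"
    if "a \<in> W" for a
    unfolding S_def \<Phi>_def
    using smooth_mat_carrier[OF smooth_hadj[OF box_open[OF j] extension(6)[OF j W_ends(2)[OF that]]
          extension(6)[OF j W_ends(1)[OF that]] mor_smooth[OF j that]] w]
      smooth_mat_carrier[OF mor_smooth(1)[OF j that] w] by auto
  have vt: "of_nat (m v) * mean_trace v i l j w - of_real (\<tau> v) * base_trace v i l j w =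
      (\<Sum>a | a \<in> W \<and> tail Q a = v. mtrace (R v * (S a * \<Phi> a))) - (\<Sum>a | a \<in> W \<and> head Q a = v. mtrace (R v * (\<Phi> a * S a)))"
    if v: "v \<in> V" for v
  proof -
    let ?r = "rk (E v)"
    \<comment> \<open>The mean curvature endomorphism at \<open>v\<close>, to which the vortex
      equation applies entry by entry.\<close>
    define M where "M p q = (\<Sum>\<alpha><n. \<Sum>\<beta><n. ginv g (pchart (pou \<E>) j) z \<beta> \<alpha> * curv \<alpha> \<beta> (met \<E> j v) w $$ (p, q))" for p q
    have mean: "mean_trace v i l j w = (\<Sum>p<?r. \<Sum>q<?r. R v $$ (p, q) * M q p)"
    proof -
      have "mtrace (R v * curv \<alpha> \<beta> (met \<E> j v) w) = (\<Sum>p<?r. \<Sum>q<?r. R v $$ (p, q) * curv \<alpha> \<beta> (met \<E> j v) w $$ (q, p))"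
        if "\<alpha> < n" "\<beta> < n" for \<alpha> \<beta>
        using that by (intro mtrace_mult[OF Rc[OF v]] smooth_mat_carrier[OF curv_smooth[OF j v] w]) auto
      then have "mean_trace v i l j w = (\<Sum>\<alpha><n. \<Sum>\<beta><n. \<Sum>p<?r. \<Sum>q<?r. ginv g (pchart (pou \<E>) j) z \<beta> \<alpha> *
          (R v $$ (p, q) * curv \<alpha> \<beta> (met \<E> j v) w $$ (q, p)))"
        unfolding mean_trace_def fp R_def[symmetric] by (intro sum.cong refl) (simp add: sum_distrib_left)
      also have "\<dots> = (\<Sum>p<?r. \<Sum>q<?r. \<Sum>\<alpha><n. \<Sum>\<beta><n. ginv g (pchart (pou \<E>) j) z \<beta> \<alpha> *
          (R v $$ (p, q) * curv \<alpha> \<beta> (met \<E> j v) w $$ (q, p)))"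
        by (rule sum_swap_pairs)
      also have "\<dots> = (\<Sum>p<?r. \<Sum>q<?r. R v $$ (p, q) * M q p)"
        unfolding M_def sum_distrib_left by (intro sum.cong refl) (simp only: mult_ac)
      finally show ?thesis .
    qed
    have base: "base_trace v i l j w = (\<Sum>p<?r. \<Sum>q<?r. R v $$ (p, q) * (if q = p then 1 else 0))"
    proof -
      have "(\<Sum>q<?r. R v $$ (p, q) * (if q = p then 1 else 0)) = R v $$ (p, p)" if "p < ?r" for p
      proof -
        have "(\<Sum>q<?r. R v $$ (p, q) * (if q = p then 1 else 0)) = (\<Sum>q<?r. if q = p then R v $$ (p, q) else 0)"
          by (intro sum.cong refl) simp
        then show ?thesis using that by simp
      qed
      then show ?thesis using Rc[OF v] by (simp add: base_trace_def R_def[symmetric] mtrace_def)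
    qed
    have tails: "(\<Sum>a | a \<in> W \<and> tail Q a = v. mtrace (R v * (S a * \<Phi> a))) =
        (\<Sum>p<?r. \<Sum>q<?r. R v $$ (p, q) * (\<Sum>a | a \<in> W \<and> tail Q a = v. (S a * \<Phi> a) $$ (q, p)))"
    proof -
      have "mtrace (R v * (S a * \<Phi> a)) = (\<Sum>p<?r. \<Sum>q<?r. R v $$ (p, q) * (S a * \<Phi> a) $$ (q, p))"
        if "a \<in> W" "tail Q a = v" for a
        using c[OF that(1)] that by (intro mtrace_mult[OF Rc[OF v]] mult_carrier_mat[of _ _ "rk (E (head Q a))"]) auto
      then have "(\<Sum>a | a \<in> W \<and> tail Q a = v. mtrace (R v * (S a * \<Phi> a))) =
          (\<Sum>a | a \<in> W \<and> tail Q a = v. \<Sum>p<?r. \<Sum>q<?r. R v $$ (p, q) * (S a * \<Phi> a) $$ (q, p))"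
        by (intro sum.cong refl) auto
      also have "\<dots> = (\<Sum>p<?r. \<Sum>q<?r. \<Sum>a | a \<in> W \<and> tail Q a = v. R v $$ (p, q) * (S a * \<Phi> a) $$ (q, p))"
        by (rule sum_swap_triple)
      finally show ?thesis unfolding sum_distrib_left .
    qed
    have heads: "(\<Sum>a | a \<in> W \<and> head Q a = v. mtrace (R v * (\<Phi> a * S a))) =
        (\<Sum>p<?r. \<Sum>q<?r. R v $$ (p, q) * (\<Sum>a | a \<in> W \<and> head Q a = v. (\<Phi> a * S a) $$ (q, p)))"
    proof -
      have "mtrace (R v * (\<Phi> a * S a)) = (\<Sum>p<?r. \<Sum>q<?r. R v $$ (p, q) * (\<Phi> a * S a) $$ (q, p))"
        if "a \<in> W" "head Q a = v" for a
        using c[OF that(1)] that by (intro mtrace_mult[OF Rc[OF v]] mult_carrier_mat[of _ _ "rk (E (tail Q a))"]) auto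
      then have "(\<Sum>a | a \<in> W \<and> head Q a = v. mtrace (R v * (\<Phi> a * S a))) =
          (\<Sum>a | a \<in> W \<and> head Q a = v. \<Sum>p<?r. \<Sum>q<?r. R v $$ (p, q) * (\<Phi> a * S a) $$ (q, p))"
        by (intro sum.cong refl) auto
      also have "\<dots> = (\<Sum>p<?r. \<Sum>q<?r. \<Sum>a | a \<in> W \<and> head Q a = v. R v $$ (p, q) * (\<Phi> a * S a) $$ (q, p))"
        by (rule sum_swap_triple)
      finally show ?thesis unfolding sum_distrib_left .
    qed
    \<comment> \<open>The vortex equation at the entry (q, p), because the trace of a product pairs
      it with the entry (p, q) of \<open>R v\<close>.\<close>
    have eqn: "(\<Sum>a | a \<in> W \<and> tail Q a = v. (S a * \<Phi> a) $$ (q, p)) = of_nat (m v) * M q p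
        + (\<Sum>a | a \<in> W \<and> head Q a = v. (\<Phi> a * S a) $$ (q, p)) - of_real (\<tau> v) * (if q = p then 1 else 0)"
      if "p < ?r" "q < ?r" for p q
      using vortex_equation[OF j z v that(2,1)] unfolding M_def S_def \<Phi>_def w_def
      by (simp only: diff_eq_eq add_diff_eq eq_diff_eq) (simp only: add_ac)
    have "(\<Sum>a | a \<in> W \<and> tail Q a = v. mtrace (R v * (S a * \<Phi> a))) = (\<Sum>p<?r. \<Sum>q<?r. R v $$ (p, q) *
        (of_nat (m v) * M q p + (\<Sum>a | a \<in> W \<and> head Q a = v. (\<Phi> a * S a) $$ (q, p)) - of_real (\<tau> v) * (if q = p then 1 else 0)))"
      unfolding tails by (intro sum.cong refl) (simp only: eqn lessThan_iff)
    also have "\<dots> = of_nat (m v) * mean_trace v i l j w + (\<Sum>a | a \<in> W \<and> head Q a = v. mtrace (R v * (\<Phi> a * S a)))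
        - of_real (\<tau> v) * base_trace v i l j w"
      unfolding mean base heads
      by (simp only: distrib_left right_diff_distrib sum.distrib sum_subtractf sum_distrib_left mult.left_commute[of "R v $$ x" for x])
    finally show ?thesis by simp
  qed
  have "(\<Sum>v\<in>V. of_nat (m v) * mean_trace v i l j w - of_real (\<tau> v) * base_trace v i l j w) =
      (\<Sum>v\<in>V. \<Sum>a | a \<in> W \<and> tail Q a = v. mtrace (R (tail Q a) * (S a * \<Phi> a)))
      - (\<Sum>v\<in>V. \<Sum>a | a \<in> W \<and> head Q a = v. mtrace (R (head Q a) * (\<Phi> a * S a)))"
    unfolding sum_subtractf[symmetric] by (intro sum.cong refl) (simp add: vt)
  \<comment> \<open>Every arrow of \<open>W\<close> has exactly one tail and one head in
    \<open>V\<close>, so the double sums collapse to sums over arrows.\<close>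
  also have "\<dots> = (\<Sum>a\<in>W. mtrace (R (tail Q a) * (S a * \<Phi> a))) - (\<Sum>a\<in>W. mtrace (R (head Q a) * (\<Phi> a * S a)))"
    using W_ends by (intro arg_cong2[where f = minus] sum.group finite_VW) auto
  also have "\<dots> = (\<Sum>a\<in>W. mor_hessian a i l j w - mor_trace a i l j w)"
    unfolding sum_subtractf[symmetric] R_def S_def \<Phi>_def
    by (intro sum.cong refl) (simp add: mor_hessian(1)[OF j _ il w])
  finally show ?thesis ..
qed

text \<open>\<open>vortex_trace\<close> trades \<open>mor_trace\<close> for the Hessian, at the cost
  of \<open>mean_trace\<close> and \<open>base_trace\<close>. It holds over the point
  \<open>u\<close> only, which suffices because this identity is integrated over the fiber and not
  differentiated.\<close>

lemma G_WP_eq: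
  assumes il: "i < N" "l < N"
  shows "G_WP n g Q m E \<E> u i l =
    (\<Sum>v\<in>V. of_nat (m v) * fiber_int_fun n g \<E> (\<lambda>j w. mixed_trace v i l j w - mean_trace v i l j w) u)
    + (\<Sum>v\<in>V. of_real (\<tau> v) * fiber_int_fun n g \<E> (base_trace v i l) u)
    + (\<Sum>a\<in>W. fiber_int_fun n g \<E> (mor_hessian a i l) u)"
proof -
  let ?F = "\<lambda>f. fiber_int_fun n g \<E> f u"
  note cont = continuous_traces[OF _ il] mor_hessian(3)[OF _ _ il]
  note intros = continuous_on_sum continuous_on_mult continuous_on_diff continuous_on_const cont
  have "G_WP n g Q m E \<E> u i l = ?F (\<lambda>j w. \<Sum>a\<in>W. mor_trace a i l j w) + ?F (\<lambda>j w. \<Sum>v\<in>V. of_nat (m v) * mixed_trace v i l j w)"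
    unfolding G_WP_def W_def[symmetric] V_def[symmetric] mor_trace_def mixed_trace_def ..
  also have "\<dots> = ?F (\<lambda>j w. (\<Sum>a\<in>W. mor_trace a i l j w) + (\<Sum>v\<in>V. of_nat (m v) * mixed_trace v i l j w))"
    by (rule int_fun_add[OF _ _ u_in_U, symmetric]) (intro intros; assumption)+
  also have "\<dots> = ?F (\<lambda>j w. ((\<Sum>v\<in>V. of_nat (m v) * (mixed_trace v i l j w - mean_trace v i l j w))
      + (\<Sum>v\<in>V. of_real (\<tau> v) * base_trace v i l j w)) + (\<Sum>a\<in>W. mor_hessian a i l j w))"
  proof (rule int_fun_cong)
    fix j z assume "j < psize (pou \<E>)" "z \<in> Z j"
    from vortex_trace[OF this il] show "(\<Sum>a\<in>W. mor_trace a i l j (join n z u)) + (\<Sum>v\<in>V. of_nat (m v) * mixed_trace v i l j (join n z u)) =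
        (\<Sum>v\<in>V. of_nat (m v) * (mixed_trace v i l j (join n z u) - mean_trace v i l j (join n z u)))
        + (\<Sum>v\<in>V. of_real (\<tau> v) * base_trace v i l j (join n z u)) + (\<Sum>a\<in>W. mor_hessian a i l j (join n z u))"
      by (simp add: sum_subtractf right_diff_distrib algebra_simps)
  qed
  also have "\<dots> = ?F (\<lambda>j w. (\<Sum>v\<in>V. of_nat (m v) * (mixed_trace v i l j w - mean_trace v i l j w))
      + (\<Sum>v\<in>V. of_real (\<tau> v) * base_trace v i l j w)) + ?F (\<lambda>j w. \<Sum>a\<in>W. mor_hessian a i l j w)"
    by (rule int_fun_add[OF _ _ u_in_U]) (intro continuous_on_add intros; assumption)+
  also have "?F (\<lambda>j w. (\<Sum>v\<in>V. of_nat (m v) * (mixed_trace v i l j w - mean_trace v i l j w))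
      + (\<Sum>v\<in>V. of_real (\<tau> v) * base_trace v i l j w)) =
      ?F (\<lambda>j w. \<Sum>v\<in>V. of_nat (m v) * (mixed_trace v i l j w - mean_trace v i l j w))
      + ?F (\<lambda>j w. \<Sum>v\<in>V. of_real (\<tau> v) * base_trace v i l j w)"
    by (rule int_fun_add[OF _ _ u_in_U]) (intro intros; assumption)+
  also have "?F (\<lambda>j w. \<Sum>v\<in>V. of_nat (m v) * (mixed_trace v i l j w - mean_trace v i l j w)) =
      (\<Sum>v\<in>V. of_nat (m v) * ?F (\<lambda>j w. mixed_trace v i l j w - mean_trace v i l j w))"
    unfolding int_fun_scale[symmetric] by (rule int_fun_sum[OF _ u_in_U]) (intro intros; assumption)
  also have "?F (\<lambda>j w. \<Sum>v\<in>V. of_real (\<tau> v) * base_trace v i l j w) = (\<Sum>v\<in>V. of_real (\<tau> v) * ?F (base_trace v i l))"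
    unfolding int_fun_scale[symmetric] by (rule int_fun_sum[OF _ u_in_U]) (intro intros; assumption)
  also have "?F (\<lambda>j w. \<Sum>a\<in>W. mor_hessian a i l j w) = (\<Sum>a\<in>W. ?F (mor_hessian a i l))"
    by (rule int_fun_sum[OF _ u_in_U]) (intro intros; assumption)
  finally show ?thesis .
qed

text \<open>The three sums of \<open>G_WP_eq\<close>, multiplied by \<open>\<i>\<close>, are the
  coefficients of the three terms; the factor \<open>2 * \<i>\<close> of \<open>first_term\<close>
  is halved on the way.\<close>

lemma omega_WP_eq:
  assumes K: "K \<subseteq> {..<2 * N}"
  shows "omega_WP n g Q m E N \<E> u K =
      1 / 2 * (\<Sum>v\<in>V. fiber_int n (pou \<E>)
          (\<lambda>j w. wedge (fscale (of_nat (m v)) (tr_Omega_Omega (n + N) (met \<E> j v) w))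
                       (omegaX_pow n g \<E> (n - 1) j w)) u K)
    + \<i> * (\<Sum>v\<in>V. of_real (\<tau> v) *
        fiber_int n (pou \<E>) (\<lambda>j w. wedge (tr_Omega (n + N) (met \<E> j v) w) (omegaX_pow n g \<E> n j w)) u K)
    + (\<Sum>a\<in>W. \<i> * fdel N (fdelbar N (\<lambda>s. fconst (fiber_int_fun n g \<E> (norm_mor Q \<E> a) s))) u K)"
proof -
  let ?F = "\<lambda>f. fiber_int_fun n g \<E> f u"
  have "omega_WP n g Q m E N \<E> u K = form11 N (\<lambda>i l.
      1 / 2 * (\<Sum>v\<in>V. 2 * \<i> * of_nat (m v) * ?F (\<lambda>j w. mixed_trace v i l j w - mean_trace v i l j w))
      + \<i> * (\<Sum>v\<in>V. of_real (\<tau> v) * ?F (base_trace v i l)) + (\<Sum>a\<in>W. \<i> * ?F (mor_hessian a i l))) K"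
    unfolding omega_WP_def
    by (rule form11_cong) (simp add: G_WP_eq distrib_left sum_distrib_left mult.assoc)
  also have "\<dots> = 1 / 2 * (\<Sum>v\<in>V. form11 N (\<lambda>i l. 2 * \<i> * of_nat (m v) * ?F (\<lambda>j w. mixed_trace v i l j w - mean_trace v i l j w)) K)
      + \<i> * (\<Sum>v\<in>V. of_real (\<tau> v) * form11 N (\<lambda>i l. ?F (base_trace v i l)) K)
      + (\<Sum>a\<in>W. \<i> * form11 N (\<lambda>i l. ?F (mor_hessian a i l)) K)"
    unfolding form11_scale form11_sum form11_add ..
  finally show ?thesis
    by (simp only: first_term[OF _ K] second_term[OF _ K] third_term cong: sum.cong)
qed

end

theorem proposition4p1:
  fixes n :: nat
    and AX :: "'x::t2_space chart set"
    and g :: "'x chart \<Rightarrow> cvec \<Rightarrow> complex mat"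
    and AS :: "'s::t2_space chart set"
    and Q :: "('q, 'a) quiver"
    and R :: "('q, 'a) relation set"
    and m :: "'q \<Rightarrow> nat"
    and \<tau> :: "'q \<Rightarrow> real"
    and E :: "'q \<Rightarrow> ('x \<times> 's, 'i) vbundle"
    and \<phi> :: "'a \<Rightarrow> 'i \<Rightarrow> 'i \<Rightarrow> 'x \<times> 's \<Rightarrow> complex mat"
    and k :: "'q \<Rightarrow> 'i \<Rightarrow> 'x \<times> 's \<Rightarrow> complex mat"
    and s0 :: 's
    and c :: "'s chart"
    and \<E> :: "('x, 'q, 'a, 'i) local_ext"
  assumes "1 \<le> n"
    and "compact (UNIV :: 'x set)"
    and "connected (UNIV :: 'x set)"
    and "kaehler_manifold n AX g"
    and "complex_space AS"
    and "quiver_with_relations Q R"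
    and "\<forall>v\<in>verts Q. 1 \<le> m v"
    and "quiver_bundle (prod_atlas AX AS) Q R E \<phi>"
    and "\<forall>s. stable_quiver_bundle n AX g Q m \<tau> (\<lambda>v. restrict_bundle s (E v)) (restrict_mor s \<phi>)"
    and "\<forall>v\<in>verts Q. herm_metric (prod_atlas AX AS) (E v) (k v)"
    and "\<forall>s. quiver_vortex n AX g Q m \<tau> (\<lambda>v. restrict_bundle s (E v)) (restrict_mor s \<phi>)
               (restrict_metric s k)"
    and "minimal_chart_at AS s0 c"
    and "local_extension_at n AX Q E \<phi> k c s0 \<E>"
  shows "\<forall>K \<subseteq> {..<2 * edim c}.
    omega_WP n g Q m E (edim c) \<E> (coords c s0) K =
      1 / 2 * (\<Sum>v \<in> verts' Q E.
        fiber_int n (pou \<E>)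
          (\<lambda>j w. wedge (fscale (of_nat (m v)) (tr_Omega_Omega (n + edim c) (met \<E> j v) w))
                       (omegaX_pow n g \<E> (n - 1) j w)) (coords c s0) K)
    + \<i> * (\<Sum>v \<in> verts' Q E. of_real (\<tau> v) *
        fiber_int n (pou \<E>)
          (\<lambda>j w. wedge (tr_Omega (n + edim c) (met \<E> j v) w) (omegaX_pow n g \<E> n j w))
          (coords c s0) K)
    + (\<Sum>a \<in> arrows' Q E. \<i> *
        fdel (edim c) (fdelbar (edim c) (\<lambda>s. fconst (fiber_int_fun n g \<E> (norm_mor Q \<E> a) s)))
          (coords c s0) K)"
proof -
  have Q: "locally_finite_quiver Q" and s0: "s0 \<in> patch c"
    using assms(6,12) by (simp_all add: quiver_with_relations_def minimal_chart_at_def)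
  show ?thesis
    by (intro allI impI) (rule omega_WP_eq[OF assms(1,2,4) Q assms(8,10) spec[OF assms(11)] s0 assms(13) refl])
qed

end
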